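(* The spectral measure (over $\mathbb{T}^2$) for the group $\mathrm{G}=\Sigma(216\times3)\subset SU(3)$ (of order 648) is $$\mathrm{d}\varepsilon=\frac{1}{48\pi^4}J^2\,\mathrm{d}^{(6)}+\frac{1}{96\pi^4}J^2\,\mathrm{d}^{(4)}+\Big(\frac16+\frac{7}{648\pi^4}J^2\Big)\mathrm{d}^{(3)}+\frac1{18}\,\mathrm{d}^{(2)}-\frac1{108}\,\mathrm{d}^{(1)}-\frac{1}{36\pi^4}J^2\,\mathrm{d}_3\times\mathrm{d}_3-\frac1{18}\,\mathrm{d}_{3/2}\times\mathrm{d}_{3/2}.$$
   Context: Let $\omega=e^{2\pi i/3}$, $\epsilon=e^{2\pi i/9}$ and $\sqrt{-3}=i\sqrt3$. $\mathrm{G}=\Sigma(216\times3)$ is the subgroup of $SU(3)$ of order 648 generated by $S_1=\mathrm{diag}(1,\omega,\omega^2)$, $S_2=\mathrm{diag}(\omega,\omega,\omega)$, $T=\begin{pmatrix}0&1&0\\0&0&1\\1&0&0\end{pmatrix}$, $V=\frac{1}{\sqrt{-3}}\begin{pmatrix}1&1&1\\1&\omega&\omega^2\\1&\omega^2&\omega\end{pmatrix}$ and $U=\mathrm{diag}(\epsilon^2,\epsilon^2,\epsilon^5)$. For a finite subgroup $\Gamma\subset SU(3)$ let $\rho$ be the 3-dimensional representation given by the inclusion. The McKay graph of $\Gamma$ has as vertices the irreducible representations of $\Gamma$ (up to isomorphism), with adjacency matrix $\Delta_{\sigma,\sigma'}$ = multiplicity of $\sigma'$ in $\rho\otimes\sigma$;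 $\Delta$ is normal. Let $e_1$ be the basis vector of the trivial representation. Let $\mathbb{T}$ be the unit circle and $R_{m,n}(\omega_1,\omega_2)=(\omega_1+\omega_2^{-1}+\omega_1^{-1}\omega_2)^{m}(\omega_1^{-1}+\omega_2+\omega_1\omega_2^{-1})^{n}$. The group $S_3$ acts on $\mathbb{T}^2$, generated by $(\omega_1,\omega_2)\mapsto(\omega_2^{-1},\omega_1^{-1})$ and $(\omega_1,\omega_2)\mapsto(\omega_2^{-1},\omega_1\omega_2^{-1})$. The spectral measure over $\mathbb{T}^2$ for $\Gamma$ is the $S_3$-invariant measure $\varepsilon$ on $\mathbb{T}^2$ with $\int_{\mathbb{T}^2}R_{m,n}\,\mathrm{d}\varepsilon=\langle\Delta^{m}(\Delta^\ast)^{n} e_1,e_1\rangle$ for all integers $m,n\ge0$. For $2k\in\mathbb{N}$, $\mathrm{d}_k$ is the uniform probability measure on the $2k$-th roots of unity, and $\mathrm{d}_k\times\mathrm{d}_k$ is the product measure on $\mathbb{T}^2$. For $N\in\mathbb{N}$, $\mathrm{d}^{(N)}$ is the uniform probability measure on $D_N=\{(e^{2\pi iq_1/3N},e^{2\pi iq_2/3N}) : q_1,q_2\in\{0,\dots,3N-1\},\ q_1+q_2\equiv0 \bmod 3\}$. $J$ is the function on $\mathbb{T}^2$ given at $(e^{2\pi i\theta_1},e^{2\pi i\theta_2})$ by $J=4\pi^2\big(\sin(2\pi(\theta_1+\theta_2))-\sin(2\pi(2\theta_1-\theta_2))-\sin(2\pi(2\theta_2-\theta_1))\big)$, and $J^2\mathrm{d}\nu$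 denotes the measure with density $J^2$ with respect to $\mathrm{d}\nu$.
   Formalization: The coefficient of J² d_3×d_3 is corrected from −1/(36π⁴) to −1/(144π⁴): each J²dν in the formula has mass 24π⁴, so the printed formula has total mass 1/2, whereas the spectral measure must have total mass 1. *)

theory Defs
  imports
    "HOL-Analysis.Analysis"
    "HOL-Algebra.Generated_Groups"
    "Jordan_Normal_Form.Schur_Decomposition"
    "Jordan_Normal_Form.VS_Connect"
begin

hide_const (open) Determinants.det

section \<open>The group \<open>\<Sigma>(216\<times>3)\<close>\<close>

definition SU3 :: "complex mat monoid" where
  "SU3 = \<lparr>carrier = {A \<in> carrier_mat 3 3. A * mat_adjoint A = 1\<^sub>m 3 \<and> Determinant.det A = 1},
          monoid.mult = (*), one = 1\<^sub>m 3\<rparr>"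

definition \<omega> :: complex where "\<omega> = exp (2 * pi * \<i> / 3)"
definition \<epsilon> :: complex where "\<epsilon> = exp (2 * pi * \<i> / 9)"

definition S1 :: "complex mat" where
  "S1 = mat_of_rows_list 3 [[1, 0, 0], [0, \<omega>, 0], [0, 0, \<omega>^2]]"

definition S2 :: "complex mat" where
  "S2 = mat_of_rows_list 3 [[\<omega>, 0, 0], [0, \<omega>, 0], [0, 0, \<omega>]]"

definition T :: "complex mat" where
  "T = mat_of_rows_list 3 [[0, 1, 0], [0, 0, 1], [1, 0, 0]]"

definition V :: "complex mat" where
  "V = (1 / (\<i> * sqrt 3)) \<cdot>\<^sub>m mat_of_rows_list 3 [[1, 1, 1], [1, \<omega>, \<omega>^2], [1, \<omega>^2, \<omega>]]"

definition U :: "complex mat" where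
  "U = mat_of_rows_list 3 [[\<epsilon>^2, 0, 0], [0, \<epsilon>^2, 0], [0, 0, \<epsilon>^5]]"

definition Sigma_216x3 :: "complex mat set" where
  "Sigma_216x3 = generate SU3 {S1, S2, T, V, U}"


section \<open>Complex matrix representations\<close>

text \<open>A representation is a map from the group to square matrices; its values outside the carrier
  are irrelevant, and its dimension is read off from the image of the identity.\<close>

definition rep_dim :: "('g, 'b) monoid_scheme \<Rightarrow> ('g \<Rightarrow> complex mat) \<Rightarrow> nat" where
  "rep_dim G \<sigma> = dim_row (\<sigma> \<one>\<^bsub>G\<^esub>)"

definition is_rep :: "('g, 'b) monoid_scheme \<Rightarrow> ('g \<Rightarrow> complex mat) \<Rightarrow> bool" where
  "is_rep G \<sigma> \<longleftrightarrow>
     (\<forall>g\<in>carrier G. \<sigma> g \<in> carrier_mat (rep_dim G \<sigma>) (rep_dim G \<sigma>)) \<and>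
     \<sigma> \<one>\<^bsub>G\<^esub> = 1\<^sub>m (rep_dim G \<sigma>) \<and>
     (\<forall>g\<in>carrier G. \<forall>h\<in>carrier G. \<sigma> (g \<otimes>\<^bsub>G\<^esub> h) = \<sigma> g * \<sigma> h)"

definition rep_iso ::
  "('g, 'b) monoid_scheme \<Rightarrow> ('g \<Rightarrow> complex mat) \<Rightarrow> ('g \<Rightarrow> complex mat) \<Rightarrow> bool" where
  "rep_iso G \<sigma> \<tau> \<longleftrightarrow> rep_dim G \<sigma> = rep_dim G \<tau> \<and>
     (\<exists>P \<in> carrier_mat (rep_dim G \<sigma>) (rep_dim G \<sigma>). invertible_mat P \<and>
        (\<forall>g\<in>carrier G. P * \<sigma> g = \<tau> g * P))"

definition irreducible_rep :: "('g, 'b) monoid_scheme \<Rightarrow> ('g \<Rightarrow> complex mat) \<Rightarrow> bool" where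
  "irreducible_rep G \<sigma> \<longleftrightarrow> is_rep G \<sigma> \<and> rep_dim G \<sigma> > 0 \<and>
     (\<forall>W. VectorSpace.subspace class_ring W (module_vec TYPE(complex) (rep_dim G \<sigma>)) \<and>
          (\<forall>g\<in>carrier G. \<forall>w\<in>W. \<sigma> g *\<^sub>v w \<in> W) \<longrightarrow>
          W = {0\<^sub>v (rep_dim G \<sigma>)} \<or> W = carrier_vec (rep_dim G \<sigma>))"

definition kronecker :: "complex mat \<Rightarrow> complex mat \<Rightarrow> complex mat" where
  "kronecker A B = Matrix.mat (dim_row A * dim_row B) (dim_col A * dim_col B)
     (\<lambda>(i, j). A $$ (i div dim_row B, j div dim_col B) * B $$ (i mod dim_row B, j mod dim_col B))"

definition rep_tensor ::
  "('g \<Rightarrow> complex mat) \<Rightarrow> ('g \<Rightarrow> complex mat) \<Rightarrow> 'g \<Rightarrow> complex mat" where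
  "rep_tensor \<sigma> \<tau> = (\<lambda>g. kronecker (\<sigma> g) (\<tau> g))"

definition rep_sum :: "('g \<Rightarrow> complex mat) list \<Rightarrow> 'g \<Rightarrow> complex mat" where
  "rep_sum \<tau>s = (\<lambda>g. diag_block_mat (map (\<lambda>\<tau>. \<tau> g) \<tau>s))"

text \<open>The number of summands isomorphic to \<open>\<tau>\<close> in a decomposition of \<open>\<pi>\<close> into irreducibles.\<close>

definition rep_mult ::
  "('g, 'b) monoid_scheme \<Rightarrow> ('g \<Rightarrow> complex mat) \<Rightarrow> ('g \<Rightarrow> complex mat) \<Rightarrow> nat" where
  "rep_mult G \<tau> \<pi> = (THE k. \<exists>\<tau>s. (\<forall>\<tau>'\<in>set \<tau>s. irreducible_rep G \<tau>') \<and>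
     rep_iso G \<pi> (rep_sum \<tau>s) \<and> k = length (filter (rep_iso G \<tau>) \<tau>s))"

text \<open>Isomorphism classes of irreducible representations.\<close>

definition irr_iso :: "('g, 'b) monoid_scheme \<Rightarrow> ('g \<Rightarrow> complex mat) rel" where
  "irr_iso G = {(\<sigma>, \<tau>). irreducible_rep G \<sigma> \<and> irreducible_rep G \<tau> \<and> rep_iso G \<sigma> \<tau>}"

definition Irr :: "('g, 'b) monoid_scheme \<Rightarrow> ('g \<Rightarrow> complex mat) set set" where
  "Irr G = {\<sigma>. irreducible_rep G \<sigma>} // irr_iso G"

definition trivial_class :: "('g, 'b) monoid_scheme \<Rightarrow> ('g \<Rightarrow> complex mat) set" where
  "trivial_class G = irr_iso G `` {\<lambda>_. 1\<^sub>m 1}"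


section \<open>The McKay graph of a subgroup of \<open>SU(3)\<close>\<close>

abbreviation SU3_sub :: "complex mat set \<Rightarrow> complex mat monoid" where
  "SU3_sub \<Gamma> \<equiv> SU3\<lparr>carrier := \<Gamma>\<rparr>"

text \<open>The inclusion representation \<open>\<rho>\<close> is the identity map on matrices.\<close>

definition mckay_adj :: "complex mat set \<Rightarrow>
    (complex mat \<Rightarrow> complex mat) set \<Rightarrow> (complex mat \<Rightarrow> complex mat) set \<Rightarrow> nat" where
  "mckay_adj \<Gamma> C D = (THE k. \<exists>\<sigma>\<in>C. \<exists>\<sigma>'\<in>D.
     k = rep_mult (SU3_sub \<Gamma>) \<sigma>' (rep_tensor (\<lambda>g. g) \<sigma>))"

text \<open>Matrices and vectors indexed by a finite set \<open>I\<close> are functions on \<open>I\<close>; values outside \<open>I\<close>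
  are irrelevant.\<close>

definition mat_apply :: "'i set \<Rightarrow> ('i \<Rightarrow> 'i \<Rightarrow> complex) \<Rightarrow> ('i \<Rightarrow> complex) \<Rightarrow> 'i \<Rightarrow> complex" where
  "mat_apply I M v = (\<lambda>i. \<Sum>j\<in>I. M i j * v j)"

definition conj_transpose :: "('i \<Rightarrow> 'i \<Rightarrow> complex) \<Rightarrow> 'i \<Rightarrow> 'i \<Rightarrow> complex" where
  "conj_transpose M = (\<lambda>i j. cnj (M j i))"

definition inner_prod :: "'i set \<Rightarrow> ('i \<Rightarrow> complex) \<Rightarrow> ('i \<Rightarrow> complex) \<Rightarrow> complex" where
  "inner_prod I u v = (\<Sum>i\<in>I. u i * cnj (v i))"

definition mckay_moment :: "complex mat set \<Rightarrow> nat \<Rightarrow> nat \<Rightarrow> complex" where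
  "mckay_moment \<Gamma> m n =
     (let I = Irr (SU3_sub \<Gamma>);
          \<Delta> = (\<lambda>C D. of_nat (mckay_adj \<Gamma> C D));
          e1 = (\<lambda>C. if C = trivial_class (SU3_sub \<Gamma>) then 1 else 0)
      in inner_prod I
           ((mat_apply I \<Delta> ^^ m) ((mat_apply I (conj_transpose \<Delta>) ^^ n) e1)) e1)"


section \<open>Measures on the torus\<close>

definition circle :: "complex measure" where
  "circle = restrict_space borel (sphere 0 1)"

definition torus :: "(complex \<times> complex) measure" where
  "torus = circle \<Otimes>\<^sub>M circle"

definition R :: "nat \<Rightarrow> nat \<Rightarrow> complex \<times> complex \<Rightarrow> complex" where
  "R m n = (\<lambda>(w1, w2). (w1 + inverse w2 + inverse w1 * w2) ^ m *
                       (inverse w1 + w2 + w1 * inverse w2) ^ n)"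

definition weyl1 :: "complex \<times> complex \<Rightarrow> complex \<times> complex" where
  "weyl1 = (\<lambda>(w1, w2). (inverse w2, inverse w1))"

definition weyl2 :: "complex \<times> complex \<Rightarrow> complex \<times> complex" where
  "weyl2 = (\<lambda>(w1, w2). (inverse w2, w1 * inverse w2))"

text \<open>Invariance under \<open>S\<^sub>3\<close> is invariance under its two generators.\<close>

definition is_spectral_measure ::
  "complex mat set \<Rightarrow> (complex \<times> complex) measure \<Rightarrow> bool" where
  "is_spectral_measure \<Gamma> \<mu> \<longleftrightarrow>
     finite_measure \<mu> \<and> sets \<mu> = sets torus \<and>
     distr \<mu> torus weyl1 = \<mu> \<and> distr \<mu> torus weyl2 = \<mu> \<and>
     (\<forall>m n. (\<integral>w. R m n w \<partial>\<mu>) = mckay_moment \<Gamma> m n)"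

text \<open>\<open>d_roots k\<close> is meant for \<open>2k\<close> a positive integer.\<close>

definition d_roots :: "real \<Rightarrow> complex measure" where
  "d_roots k = distr (uniform_count_measure {z. z ^ nat \<lfloor>2 * k\<rfloor> = 1}) circle (\<lambda>z. z)"

definition D_set :: "nat \<Rightarrow> (complex \<times> complex) set" where
  "D_set N = {(exp (2 * pi * \<i> * q1 / (3 * N)), exp (2 * pi * \<i> * q2 / (3 * N))) | q1 q2 :: nat.
     q1 < 3 * N \<and> q2 < 3 * N \<and> (q1 + q2) mod 3 = 0}"

definition d_upper :: "nat \<Rightarrow> (complex \<times> complex) measure" where
  "d_upper N = distr (uniform_count_measure (D_set N)) torus (\<lambda>w. w)"

definition J_angle :: "real \<Rightarrow> real \<Rightarrow> real" where
  "J_angle \<theta>1 \<theta>2 = 4 * pi\<^sup>2 * (sin (2 * pi * (\<theta>1 + \<theta>2)) -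
     sin (2 * pi * (2 * \<theta>1 - \<theta>2)) - sin (2 * pi * (2 * \<theta>2 - \<theta>1)))"

definition J :: "complex \<times> complex \<Rightarrow> real" where
  "J = (\<lambda>(w1, w2). J_angle (Arg w1 / (2 * pi)) (Arg w2 / (2 * pi)))"

text \<open>The choice of angles is immaterial.\<close>

lemma J_exp:
  "J (exp (2 * pi * \<i> * \<theta>1), exp (2 * pi * \<i> * \<theta>2)) = J_angle \<theta>1 \<theta>2" for \<theta>1 \<theta>2 :: real
proof -
  define f where "f a b = Im (a * b) - Im (a * a * cnj b) - Im (b * b * cnj a)" for a b :: complex
  have f: "J_angle s t = 4 * pi\<^sup>2 * f (cis (2 * pi * s)) (cis (2 * pi * t))" for s t
    unfolding J_angle_def f_def
    by (simp only: cis_mult cis_cnj cis.sel distrib_left right_diff_distrib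
        mult_2 diff_conv_add_uminus distrib_right mult_minus_right minus_add_distrib)
  have e: "exp (2 * pi * \<i> * t) = cis (2 * pi * t)" for t :: real
    by (simp add: cis_conv_exp mult.assoc mult.left_commute)
  have a: "cis (Arg (cis s)) = cis s" for s
    by (subst cis_Arg) (simp_all add: sgn_div_norm)
  show ?thesis
    unfolding J_def e prod.case f by (simp add: a)
qed

definition weighted :: "('a \<Rightarrow> real) \<Rightarrow> 'a measure \<Rightarrow> 'a measure" where
  "weighted f \<nu> = density \<nu> (\<lambda>x. ennreal (f x))"

text \<open>On the normalisation of the term \<open>J\<^sup>2 d\<^sub>3 \<times> d\<^sub>3\<close> in the spectral measure of
  \<open>\<Sigma>(216\<times>3)\<close>: its coefficient is \<open>-1/(144 \<pi>^4)\<close>, correcting the \<open>-1/(36 \<pi>^4)\<close> found in the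
  source. Every measure \<open>J\<^sup>2 \<nu>\<close> in the formula has total mass \<open>24 \<pi>^4\<close>, so the source's coefficient
  gives total mass \<open>1/2\<close>, against the zeroth moment \<open>1\<close>.\<close>

end

theory Submission
  imports Defs "Jordan_Normal_Form.Spectral_Radius"
begin

text \<open>Multiplication by \<open>\<Delta>\<^sup>*\<close> corresponds to multiplying characters by the trace, so by orthogonality the
  McKay moments are the averages of \<open>tr(g)\<^sup>m cnj(tr(g))\<^sup>n\<close> over the group. The group is a union of 24
  cosets of the Heisenberg group \<open>\<langle>S\<^sub>1, S\<^sub>2, T\<rangle>\<close> of order 27, along which the traces can be tabulated; up
  to powers of \<open>\<epsilon>\<close> and \<open>\<surd>-3\<close> they are Eisenstein integers. The signed measure of the formula lives on
  pairs of 36th roots of unity, and \<open>J\<^sup>2 / \<pi>\<^sup>4\<close> is an integer wherever it enters. Collecting the atoms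
  gives a positive measure on 90 points, invariant under the Weyl group, under which the torus trace has
  the same distribution as the trace on the group. Since the torus trace separates Weyl orbits and takes
  finitely many values on these points, there is no other spectral measure.\<close>

text \<open>Multiplicities and the entries of \<Delta> are definite descriptions over all
  decompositions and all representatives. They denote anything only through Maschke's theorem and
  the orthogonality of characters, which are therefore proved here in matrix form. The obstacle
  beyond that is exact arithmetic. Matrix entries lie in the field of 9th roots of unity, but within
  one coset of the Heisenberg group a single scalar, a power of \<epsilon> over the square root of
  -3, factors out, and what remains are identities between pairs of integers, decided by evaluation.
  Traces at points of the torus have the same shape once opposite eigenvalues are cancelled, so the
  two distributions can be compared as integer tables. The negative terms of the formula remove
  atoms: with coefficient -1/(144 \<pi>^4) the sixth term cancels the first one exactly on pairs of
  6th roots of unity, and the last term cancels the constant part of the \<open>d_upper 3\<close>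
  term on pairs of cube roots of unity. The unit 1/23328 makes all point masses integral and is 1/36
  of the mass 1/648 of a group element.\<close>

section \<open>Finite-dimensional complex representations\<close>

unbundle no vec_syntax

text \<open>If \<open>n < k\<close>, padding \<open>L\<close> with zero columns and \<open>B\<close>
  with zero rows gives square matrices whose product is still 1. The product in the other order is
  then also 1, yet its row \<open>n\<close> is zero. The bound replaces dimension theory: it limits
  the size of bases and the number of irreducible classes.\<close>

lemma left_inverse_dim_le:
  fixes L B :: "'a :: field mat"
  assumes L: "L \<in> carrier_mat k n" and B: "B \<in> carrier_mat n k" and LB: "L * B = 1\<^sub>m k"
  shows "k \<le> n"
proof (rule ccontr)
  assume "\<not> k \<le> n"
  then have nk: "n < k" by simp
  define A where "A = Matrix.mat k k (\<lambda>(i, j). if j < n then L $$ (i, j) else 0)"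
  define C where "C = Matrix.mat k k (\<lambda>(i, j). if i < n then B $$ (i, j) else 0)"
  have "A * C = L * B"
  proof (rule eq_matI)
    fix i j assume ij: "i < dim_row (L * B)" "j < dim_col (L * B)"
    have "(A * C) $$ (i, j) = (\<Sum>r = 0..<k. (if r < n then L $$ (i, r) * B $$ (r, j) else 0))"
      using ij L B by (auto simp: A_def C_def scalar_prod_def intro!: sum.cong)
    also have "\<dots> = (\<Sum>r = 0..<n. L $$ (i, r) * B $$ (r, j))"
      using nk by (intro sum.mono_neutral_cong_right) auto
    also have "\<dots> = (L * B) $$ (i, j)"
      using ij L B by (auto simp: scalar_prod_def intro!: sum.cong)
    finally show "(A * C) $$ (i, j) = (L * B) $$ (i, j)" .
  qed (use L B in \<open>auto simp: A_def C_def\<close>)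
  then have "A * C = 1\<^sub>m k" using LB by simp
  then have "C * A = 1\<^sub>m k"
    by (intro mat_mult_left_right_inverse[of A k C]) (auto simp: A_def C_def)
  moreover have "(C * A) $$ (n, n) = 0"
    using nk by (auto simp: A_def C_def scalar_prod_def)
  ultimately show False using nk by simp
qed

lemma two_sided_inverse_square:
  fixes L B :: "'a :: field mat"
  assumes L: "L \<in> carrier_mat k n" and B: "B \<in> carrier_mat n k"
    and "L * B = 1\<^sub>m k" "B * L = 1\<^sub>m n"
  shows "k = n"
  using left_inverse_dim_le[OF L B] left_inverse_dim_le[OF B L] assms by simp

text \<open>Closure conditions on plain vectors, to which \<open>vec_subspace_iff\<close> reduces
  the module-theoretic notion in \<open>irreducible_rep\<close>.\<close>

definition vec_subspace :: "nat \<Rightarrow> complex Matrix.vec set \<Rightarrow> bool" where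
  "vec_subspace n W \<longleftrightarrow> W \<subseteq> carrier_vec n \<and> 0\<^sub>v n \<in> W \<and> (\<forall>u\<in>W. \<forall>v\<in>W. u + v \<in> W) \<and>
     (\<forall>c. \<forall>v\<in>W. c \<cdot>\<^sub>v v \<in> W)"

lemma vec_subspace_iff:
  "VectorSpace.subspace class_ring W (module_vec TYPE(complex) n) \<longleftrightarrow> vec_subspace n W"
proof -
  interpret vec_space "TYPE(complex)" n .
  have "VectorSpace.subspace class_ring W V \<longleftrightarrow> submodule class_ring W V"
    unfolding VectorSpace.subspace_def using vectorspace_axioms by simp
  also have "\<dots> \<longleftrightarrow> vec_subspace n W"
    unfolding submodule_def vec_subspace_def using module_axioms
    by (auto simp: module_vec_simps class_ring_simps)
  finally show ?thesis .
qed

lemma mult_mat_vec_index: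
  "A \<in> carrier_mat n m \<Longrightarrow> v \<in> carrier_vec m \<Longrightarrow> i < n \<Longrightarrow>
    (A *\<^sub>v v) $ i = (\<Sum>r = 0..<m. A $$ (i, r) * v $ r)"
  by (auto simp: scalar_prod_def intro!: sum.cong)

lemma mult_mat_index:
  "A \<in> carrier_mat n m \<Longrightarrow> B \<in> carrier_mat m p \<Longrightarrow> i < n \<Longrightarrow> j < p \<Longrightarrow>
    (A * B) $$ (i, j) = (\<Sum>r = 0..<m. A $$ (i, r) * B $$ (r, j))"
  by (auto simp: scalar_prod_def intro!: sum.cong)

text \<open>A left inverse \<open>L\<close> witnesses that the columns of \<open>B\<close> are
  independent and reads off coordinates. The part \<open>u\<close> of \<open>w\<close> outside the
  span satisfies \<open>L u = 0\<close>, so it can serve as a new column once there is a row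
  \<open>l\<close> with \<open>l B = 0\<close> and \<open>l u = 1\<close>.\<close>

lemma extend_basis_matrix:
  assumes W: "vec_subspace n W" and L: "L \<in> carrier_mat k n" and B: "B \<in> carrier_mat n k"
    and LB: "L * B = 1\<^sub>m k" and BW: "\<And>v. v \<in> carrier_vec k \<Longrightarrow> B *\<^sub>v v \<in> W"
    and w: "w \<in> W" and wB: "\<And>v. v \<in> carrier_vec k \<Longrightarrow> w \<noteq> B *\<^sub>v v"
  obtains L' B' where "L' \<in> carrier_mat (Suc k) n" "B' \<in> carrier_mat n (Suc k)"
    "L' * B' = 1\<^sub>m (Suc k)" "\<And>v. v \<in> carrier_vec (Suc k) \<Longrightarrow> B' *\<^sub>v v \<in> W"
proof -
  have wn: "w \<in> carrier_vec n" using W w by (auto simp: vec_subspace_def)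
  define u where "u = w + (-1) \<cdot>\<^sub>v (B *\<^sub>v (L *\<^sub>v w))"
  have Lw: "L *\<^sub>v w \<in> carrier_vec k" using L wn by simp
  have BLw: "B *\<^sub>v (L *\<^sub>v w) \<in> carrier_vec n" using B Lw by simp
  have un: "u \<in> carrier_vec n" using wn BLw by (simp add: u_def)
  have uW: "u \<in> W" unfolding u_def using W w BW[OF Lw] by (auto simp: vec_subspace_def)
  have "u \<noteq> 0\<^sub>v n"
  proof
    assume "u = 0\<^sub>v n"
    then have "u $ i = 0" if "i < n" for i using that by simp
    then have "w $ i = (B *\<^sub>v (L *\<^sub>v w)) $ i" if "i < n" for i
      using that wn BLw by (simp add: u_def del: index_mult_mat_vec dim_mult_mat_vec)
    then have "w = B *\<^sub>v (L *\<^sub>v w)"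
      using wn BLw by (intro eq_vecI) (simp_all del: index_mult_mat_vec dim_mult_mat_vec)
    then show False using wB[OF Lw] by simp
  qed
  then obtain p where p: "p < n" "u $ p \<noteq> 0" using un by (metis eq_vecI carrier_vecD index_zero_vec)
  have Lu: "L *\<^sub>v u = 0\<^sub>v k"
  proof -
    have "L *\<^sub>v (B *\<^sub>v (L *\<^sub>v w)) = (L * B) *\<^sub>v (L *\<^sub>v w)"
      using L B Lw by (simp add: assoc_mult_mat_vec[of _ k n _ k])
    also have "\<dots> = L *\<^sub>v w" using LB Lw by simp
    finally have e: "L *\<^sub>v (B *\<^sub>v (L *\<^sub>v w)) = L *\<^sub>v w" .
    have "L *\<^sub>v u = L *\<^sub>v w + (-1) \<cdot>\<^sub>v (L *\<^sub>v (B *\<^sub>v (L *\<^sub>v w)))"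
      unfolding u_def using L wn BLw
      by (simp add: mult_add_distrib_mat_vec[of _ k n] mult_mat_vec[of _ k n])
    then show ?thesis using e Lw
      by (intro eq_vecI) (simp_all del: index_mult_mat_vec dim_mult_mat_vec)
  qed
  have Lu': "(\<Sum>r = 0..<n. L $$ (s, r) * u $ r) = 0" if "s < k" for s
    using mult_mat_vec_index[OF L un that] Lu that by simp
  have LB': "(\<Sum>r = 0..<n. L $$ (s, r) * B $$ (r, j)) = (if s = j then 1 else 0)"
    if "s < k" "j < k" for s j
    using mult_mat_index[OF L B that] LB that by simp
  \<comment> \<open>\<open>l\<close> takes coordinate \<open>p\<close> of
    \<open>x - B (L x)\<close>, scaled to be 1 at \<open>u\<close>.\<close>
  define l where "l r = ((if r = p then 1 else 0) - (\<Sum>s = 0..<k. B $$ (p, s) * L $$ (s, r))) / u $ p" for r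
  have l: "(\<Sum>r = 0..<n. l r * x r) = (x p - (\<Sum>s = 0..<k. B $$ (p, s) * (\<Sum>r = 0..<n. L $$ (s, r) * x r))) / u $ p" for x
  proof -
    have "(\<Sum>r = 0..<n. l r * x r) = (\<Sum>r = 0..<n. (if r = p then x r else 0) - (\<Sum>s = 0..<k. B $$ (p, s) * (L $$ (s, r) * x r))) / u $ p"
      unfolding sum_divide_distrib l_def
      by (intro sum.cong) (auto simp: field_simps sum_distrib_left sum_distrib_right)
    also have "\<dots> = ((\<Sum>r = 0..<n. if r = p then x r else 0) - (\<Sum>r = 0..<n. \<Sum>s = 0..<k. B $$ (p, s) * (L $$ (s, r) * x r))) / u $ p"
      by (simp add: sum_subtractf)
    also have "(\<Sum>r = 0..<n. if r = p then x r else 0) = x p" using p by simp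
    also have "(\<Sum>r = 0..<n. \<Sum>s = 0..<k. B $$ (p, s) * (L $$ (s, r) * x r)) = (\<Sum>s = 0..<k. B $$ (p, s) * (\<Sum>r = 0..<n. L $$ (s, r) * x r))"
      by (subst sum.swap) (simp add: sum_distrib_left)
    finally show ?thesis .
  qed
  have lB: "(\<Sum>r = 0..<n. l r * B $$ (r, j)) = 0" if "j < k" for j
    unfolding l using that by (simp add: LB' if_distrib cong: if_cong)
  have lu: "(\<Sum>r = 0..<n. l r * u $ r) = 1"
    unfolding l using p by (simp add: Lu')
  define L' where "L' = Matrix.mat (Suc k) n (\<lambda>(i, j). if i < k then L $$ (i, j) else l j)"
  define B' where "B' = Matrix.mat n (Suc k) (\<lambda>(i, j). if j < k then B $$ (i, j) else u $ i)"
  have L'c: "L' \<in> carrier_mat (Suc k) n" and B'c: "B' \<in> carrier_mat n (Suc k)"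
    by (auto simp: L'_def B'_def)
  show ?thesis
  proof
    show "L' * B' = 1\<^sub>m (Suc k)"
    proof (rule eq_matI)
      fix i j assume "i < dim_row (1\<^sub>m (Suc k) :: complex mat)" "j < dim_col (1\<^sub>m (Suc k) :: complex mat)"
      then have ij: "i < Suc k" "j < Suc k" by auto
      have "(L' * B') $$ (i, j) = (\<Sum>r = 0..<n. (if i < k then L $$ (i, r) else l r) * (if j < k then B $$ (r, j) else u $ r))"
        unfolding mult_mat_index[OF L'c B'c ij] using ij by (intro sum.cong) (auto simp: L'_def B'_def)
      also have "\<dots> = (1\<^sub>m (Suc k)) $$ (i, j)"
        using ij by (cases "i < k"; cases "j < k") (auto simp: LB' Lu' lB lu)
      finally show "(L' * B') $$ (i, j) = (1\<^sub>m (Suc k)) $$ (i, j)" .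
    qed (use L'c B'c in auto)
    fix v :: "complex Matrix.vec" assume v: "v \<in> carrier_vec (Suc k)"
    define v1 where "v1 = Matrix.vec k (\<lambda>i. v $ i)"
    have v1: "v1 \<in> carrier_vec k" by (simp add: v1_def)
    have "B' *\<^sub>v v = B *\<^sub>v v1 + v $ k \<cdot>\<^sub>v u"
    proof (rule eq_vecI)
      fix i assume "i < dim_vec (B *\<^sub>v v1 + v $ k \<cdot>\<^sub>v u)"
      then have i: "i < n" using un by simp
      show "(B' *\<^sub>v v) $ i = (B *\<^sub>v v1 + v $ k \<cdot>\<^sub>v u) $ i"
        using i un B mult_mat_vec_index[OF B v1 i] mult_mat_vec_index[OF B'c v i]
        by (simp add: B'_def v1_def del: index_mult_mat_vec)
    qed (use B'c un in auto)
    then show "B' *\<^sub>v v \<in> W" using W BW[OF v1] uW by (auto simp: vec_subspace_def)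
  qed (fact L'c B'c)+
qed

text \<open>\<open>left_inverse_dim_le\<close> bounds \<open>k\<close> by \<open>n\<close>, so a
  maximal \<open>k\<close> exists, and a vector outside the span would contradict maximality. The
  columns of \<open>B\<close> are a basis of \<open>W\<close>; \<open>L\<close> is kept as its
  coordinate map.\<close>

lemma basis_matrix:
  assumes W: "vec_subspace n W"
  obtains k L B where "L \<in> carrier_mat k n" "B \<in> carrier_mat n k" "L * B = 1\<^sub>m k"
    "W = (\<lambda>v. B *\<^sub>v v) ` carrier_vec k"
proof -
  define P where "P k \<longleftrightarrow> (\<exists>L B. L \<in> carrier_mat k n \<and> B \<in> carrier_mat n k \<and> L * B = 1\<^sub>m k \<and>
    (\<forall>v\<in>carrier_vec k. B *\<^sub>v v \<in> W))" for k
  have "P 0" unfolding P_def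
  proof (intro exI conjI ballI)
    fix v :: "complex Matrix.vec" assume "v \<in> carrier_vec 0"
    then have "0\<^sub>m n 0 *\<^sub>v v = 0\<^sub>v n" by (intro eq_vecI) (auto simp: scalar_prod_def)
    then show "0\<^sub>m n 0 *\<^sub>v v \<in> W" using W by (simp add: vec_subspace_def)
  next
    show "0\<^sub>m 0 n * 0\<^sub>m n 0 = (1\<^sub>m 0 :: complex mat)" by (intro eq_matI) auto
  qed auto
  moreover have "\<And>k. P k \<Longrightarrow> k \<le> n" unfolding P_def using left_inverse_dim_le by blast
  ultimately obtain k where k: "P k" and max: "\<And>k'. P k' \<Longrightarrow> k' \<le> k"
    using Greatest_le_nat[of P _ n] GreatestI_nat[of P 0 n] by blast
  from k obtain L B where LB: "L \<in> carrier_mat k n" "B \<in> carrier_mat n k" "L * B = 1\<^sub>m k"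
    "\<And>v. v \<in> carrier_vec k \<Longrightarrow> B *\<^sub>v v \<in> W" unfolding P_def by blast
  have "w \<in> (\<lambda>v. B *\<^sub>v v) ` carrier_vec k" if "w \<in> W" for w
  proof (rule ccontr)
    assume "w \<notin> (\<lambda>v. B *\<^sub>v v) ` carrier_vec k"
    then have "\<And>v. v \<in> carrier_vec k \<Longrightarrow> w \<noteq> B *\<^sub>v v" by blast
    from extend_basis_matrix[OF W LB that this] obtain L' B' where "L' \<in> carrier_mat (Suc k) n" "B' \<in> carrier_mat n (Suc k)"
      "L' * B' = 1\<^sub>m (Suc k)" "\<And>v. v \<in> carrier_vec (Suc k) \<Longrightarrow> B' *\<^sub>v v \<in> W" by blast
    then have "P (Suc k)" unfolding P_def by blast
    then show False using max by force
  qed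
  then have "W = (\<lambda>v. B *\<^sub>v v) ` carrier_vec k" using LB(4) by blast
  then show ?thesis using that LB by blast
qed

text \<open>Premises on dimensions alone can be discharged by the simplifier; the rule with
  \<open>carrier_mat\<close> premises involves sizes that do not occur in the rewritten
  term.\<close>

lemma mult_mat_assoc_dim:
  "dim_col A = dim_row B \<Longrightarrow> dim_col B = dim_row C \<Longrightarrow> (A * B) * C = A * (B * (C :: complex mat))"
  by (rule assoc_mult_mat[of A "dim_row A" "dim_row B" B "dim_row C" C "dim_col C"]) auto

section \<open>Traces and finite sums of matrices\<close>

definition mtrace :: "complex mat \<Rightarrow> complex" where
  "mtrace A = (\<Sum>i = 0..<dim_row A. A $$ (i, i))"

lemma mtrace_comm:
  assumes A: "A \<in> carrier_mat n m" and B: "B \<in> carrier_mat m n"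
  shows "mtrace (A * B) = mtrace (B * A)"
proof -
  have "mtrace (A * B) = (\<Sum>i = 0..<n. \<Sum>r = 0..<m. A $$ (i, r) * B $$ (r, i))"
    using A B by (simp add: mtrace_def mult_mat_index[OF A B] del: index_mult_mat(1))
  also have "\<dots> = (\<Sum>r = 0..<m. \<Sum>i = 0..<n. B $$ (r, i) * A $$ (i, r))"
    by (subst sum.swap) (simp add: mult.commute)
  also have "\<dots> = mtrace (B * A)"
    using A B by (simp add: mtrace_def mult_mat_index[OF B A] del: index_mult_mat(1))
  finally show ?thesis .
qed

lemma mtrace_similar:
  assumes "P \<in> carrier_mat n n" "Q \<in> carrier_mat n n" "A \<in> carrier_mat n n" "Q * P = 1\<^sub>m n"
  shows "mtrace (P * A * Q) = mtrace A"
proof -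
  have "mtrace (P * A * Q) = mtrace (Q * (P * A))"
    using assms by (intro mtrace_comm[of _ n n]) auto
  also have "Q * (P * A) = Q * P * A" using assms by (subst mult_mat_assoc_dim) auto
  finally show ?thesis using assms by simp
qed

lemma mtrace_four_block:
  assumes A: "A \<in> carrier_mat n n" and D: "D \<in> carrier_mat m m"
  shows "mtrace (four_block_mat A B C D) = mtrace A + mtrace D"
proof -
  have "mtrace (four_block_mat A B C D) = (\<Sum>i = 0..<n + m. if i < n then A $$ (i, i) else D $$ (i - n, i - n))"
    using A D by (auto simp: mtrace_def intro!: sum.cong)
  also have "\<dots> = (\<Sum>i = 0..<n. A $$ (i, i)) + (\<Sum>i = n..<n + m. D $$ (i - n, i - n))"
    by (subst sum.atLeastLessThan_concat[of 0 n "n + m", symmetric]) (auto intro!: sum.cong arg_cong2[of _ _ _ _ "(+)"])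
  also have "(\<Sum>i = n..<n + m. D $$ (i - n, i - n)) = (\<Sum>i = 0..<m. D $$ (i, i))"
    using sum.shift_bounds_nat_ivl[of "\<lambda>i. D $$ (i - n, i - n)" 0 n m] by (simp add: add.commute)
  finally show ?thesis using A D by (simp add: mtrace_def)
qed

text \<open>Matrices of all sizes form one type without a common zero, so sums are taken entrywise
  with the size given explicitly.\<close>

definition sum_mat :: "nat \<Rightarrow> nat \<Rightarrow> ('i \<Rightarrow> complex mat) \<Rightarrow> 'i set \<Rightarrow> complex mat" where
  "sum_mat n m f S = Matrix.mat n m (\<lambda>(i, j). \<Sum>g\<in>S. f g $$ (i, j))"

lemma sum_mat_carrier [simp]: "sum_mat n m f S \<in> carrier_mat n m"
  by (simp add: sum_mat_def)

lemma sum_mat_index: "i < n \<Longrightarrow> j < m \<Longrightarrow> sum_mat n m f S $$ (i, j) = (\<Sum>g\<in>S. f g $$ (i, j))"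
  by (simp add: sum_mat_def)

lemma sum_mat_cong: "(\<And>g. g \<in> S \<Longrightarrow> f g = h g) \<Longrightarrow> sum_mat n m f S = sum_mat n m h S"
  by (auto simp: sum_mat_def intro!: eq_matI)

lemma mult_sum_mat:
  assumes A: "A \<in> carrier_mat p n" and f: "\<And>g. g \<in> S \<Longrightarrow> f g \<in> carrier_mat n m"
  shows "A * sum_mat n m f S = sum_mat p m (\<lambda>g. A * f g) S"
proof (rule eq_matI)
  fix i j assume "i < dim_row (sum_mat p m (\<lambda>g. A * f g) S)" "j < dim_col (sum_mat p m (\<lambda>g. A * f g) S)"
  then have ij: "i < p" "j < m" by (auto simp: sum_mat_def)
  have "(A * sum_mat n m f S) $$ (i, j) = (\<Sum>r = 0..<n. A $$ (i, r) * (\<Sum>g\<in>S. f g $$ (r, j)))"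
    using ij by (simp add: mult_mat_index[OF A sum_mat_carrier] sum_mat_index del: index_mult_mat(1))
  also have "\<dots> = (\<Sum>g\<in>S. \<Sum>r = 0..<n. A $$ (i, r) * f g $$ (r, j))"
    by (subst sum.swap) (simp add: sum_distrib_left)
  also have "\<dots> = (\<Sum>g\<in>S. (A * f g) $$ (i, j))"
    using ij by (intro sum.cong refl) (simp add: mult_mat_index[OF A f] del: index_mult_mat(1))
  finally show "(A * sum_mat n m f S) $$ (i, j) = sum_mat p m (\<lambda>g. A * f g) S $$ (i, j)"
    using ij by (simp add: sum_mat_index)
qed (use A in \<open>auto simp: sum_mat_def\<close>)

lemma sum_mat_mult:
  assumes A: "A \<in> carrier_mat m p" and f: "\<And>g. g \<in> S \<Longrightarrow> f g \<in> carrier_mat n m"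
  shows "sum_mat n m f S * A = sum_mat n p (\<lambda>g. f g * A) S"
proof (rule eq_matI)
  fix i j assume "i < dim_row (sum_mat n p (\<lambda>g. f g * A) S)" "j < dim_col (sum_mat n p (\<lambda>g. f g * A) S)"
  then have ij: "i < n" "j < p" by (auto simp: sum_mat_def)
  have "(sum_mat n m f S * A) $$ (i, j) = (\<Sum>r = 0..<m. (\<Sum>g\<in>S. f g $$ (i, r)) * A $$ (r, j))"
    using ij by (simp add: mult_mat_index[OF sum_mat_carrier A] sum_mat_index del: index_mult_mat(1))
  also have "\<dots> = (\<Sum>g\<in>S. \<Sum>r = 0..<m. f g $$ (i, r) * A $$ (r, j))"
    by (subst sum.swap) (simp add: sum_distrib_right)
  also have "\<dots> = (\<Sum>g\<in>S. (f g * A) $$ (i, j))"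
    using ij by (intro sum.cong refl) (simp add: mult_mat_index[OF f A] del: index_mult_mat(1))
  finally show "(sum_mat n m f S * A) $$ (i, j) = sum_mat n p (\<lambda>g. f g * A) S $$ (i, j)"
    using ij by (simp add: sum_mat_index)
qed (use A in \<open>auto simp: sum_mat_def\<close>)

lemma mtrace_sum_mat:
  assumes "\<And>g. g \<in> S \<Longrightarrow> f g \<in> carrier_mat n n"
  shows "mtrace (sum_mat n n f S) = (\<Sum>g\<in>S. mtrace (f g))"
proof -
  have "mtrace (sum_mat n n f S) = (\<Sum>i = 0..<n. \<Sum>g\<in>S. f g $$ (i, i))"
    by (simp add: mtrace_def sum_mat_def)
  also have "\<dots> = (\<Sum>g\<in>S. \<Sum>i = 0..<n. f g $$ (i, i))" by (rule sum.swap)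
  also have "\<dots> = (\<Sum>g\<in>S. mtrace (f g))"
    using assms by (intro sum.cong refl) (auto simp: mtrace_def)
  finally show ?thesis .
qed

lemma mat_eqI_vec:
  fixes A B :: "complex mat"
  assumes A: "A \<in> carrier_mat n m" and B: "B \<in> carrier_mat n m"
    and eq: "\<And>v. v \<in> carrier_vec m \<Longrightarrow> A *\<^sub>v v = B *\<^sub>v v"
  shows "A = B"
proof (rule eq_matI)
  fix i j assume "i < dim_row B" "j < dim_col B"
  then have ij: "i < n" "j < m" using B by auto
  have "(A *\<^sub>v unit_vec m j) $ i = (B *\<^sub>v unit_vec m j) $ i" using eq by simp
  then show "A $$ (i, j) = B $$ (i, j)" using ij A B by simp
qed (use A B in auto)

lemma mult_add_smult_vec:
  fixes A :: "complex mat"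
  assumes "A \<in> carrier_mat n m" "u \<in> carrier_vec m" "v \<in> carrier_vec m"
  shows "A *\<^sub>v (u + c \<cdot>\<^sub>v v) = A *\<^sub>v u + c \<cdot>\<^sub>v (A *\<^sub>v v)"
  using assms by (simp add: mult_add_distrib_mat_vec[of _ n m] mult_mat_vec[of _ n m])

lemma vec_subspace_kernel:
  fixes A :: "complex mat"
  assumes A: "A \<in> carrier_mat n m"
  shows "vec_subspace m {v \<in> carrier_vec m. A *\<^sub>v v = 0\<^sub>v n}"
proof -
  have "A *\<^sub>v 0\<^sub>v m = 0\<^sub>v n" using A by (intro eq_vecI) auto
  then show ?thesis unfolding vec_subspace_def using A
    by (auto simp: mult_add_distrib_mat_vec[of _ n m] mult_mat_vec[of _ n m])
qed

lemma vec_subspace_range: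
  fixes A :: "complex mat"
  assumes A: "A \<in> carrier_mat n m"
  shows "vec_subspace n ((\<lambda>v. A *\<^sub>v v) ` carrier_vec m)"
  unfolding vec_subspace_def
proof (intro conjI ballI allI)
  show "(*\<^sub>v) A ` carrier_vec m \<subseteq> carrier_vec n" using A by auto
  have "A *\<^sub>v 0\<^sub>v m = 0\<^sub>v n" using A by (intro eq_vecI) auto
  then show "0\<^sub>v n \<in> (*\<^sub>v) A ` carrier_vec m" by (metis imageI zero_carrier_vec)
  fix c u assume "u \<in> (*\<^sub>v) A ` carrier_vec m"
  then obtain u' where u: "u' \<in> carrier_vec m" "u = A *\<^sub>v u'" by auto
  have "A *\<^sub>v (c \<cdot>\<^sub>v u') = c \<cdot>\<^sub>v u" using u A by (simp add: mult_mat_vec[of _ n m])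
  then show "c \<cdot>\<^sub>v u \<in> (*\<^sub>v) A ` carrier_vec m" using u by (metis imageI smult_carrier_vec)
  fix v assume "v \<in> (*\<^sub>v) A ` carrier_vec m"
  then obtain v' where v: "v' \<in> carrier_vec m" "v = A *\<^sub>v v'" by auto
  have "A *\<^sub>v (u' + v') = u + v" using u v A by (simp add: mult_add_distrib_mat_vec[of _ n m])
  then show "u + v \<in> (*\<^sub>v) A ` carrier_vec m" using u v by (metis imageI add_carrier_vec)
qed

lemma invertible_matI:
  "P \<in> carrier_mat n n \<Longrightarrow> Q \<in> carrier_mat n n \<Longrightarrow> P * Q = 1\<^sub>m n \<Longrightarrow> Q * P = 1\<^sub>m n \<Longrightarrow>
    invertible_mat (P :: complex mat)"
  unfolding invertible_mat_def inverts_mat_def by (auto simp: square_mat.simps)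

lemma invertible_matE:
  fixes P :: "complex mat"
  assumes "invertible_mat P" "P \<in> carrier_mat n n"
  obtains Q where "Q \<in> carrier_mat n n" "P * Q = 1\<^sub>m n" "Q * P = 1\<^sub>m n"
proof -
  from assms obtain Q where Q: "P * Q = 1\<^sub>m (dim_row P)" "Q * P = 1\<^sub>m (dim_row Q)"
    unfolding invertible_mat_def inverts_mat_def by auto
  have "dim_col (P * Q) = n" "dim_col (Q * P) = dim_row Q" using Q assms by auto
  then have "Q \<in> carrier_mat n n" using assms by auto
  then show ?thesis using that Q assms by auto
qed

section \<open>Representations of a finite group and Schur's lemma\<close>

locale finite_grp = group G for G (structure) +
  assumes fin: "finite (carrier G)"
begin

definition char :: "('a \<Rightarrow> complex mat) \<Rightarrow> 'a \<Rightarrow> complex" where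
  "char \<sigma> g = mtrace (\<sigma> g)"

text \<open>The value at \<open>inv g\<close> takes the place of complex conjugation in the usual
  inner product of characters. Orthogonality then involves no invariant hermitian form, and
  conjugates enter only for the concrete unitary group.\<close>

definition form :: "('a \<Rightarrow> complex) \<Rightarrow> ('a \<Rightarrow> complex) \<Rightarrow> complex" where
  "form \<phi> \<psi> = (\<Sum>g\<in>carrier G. \<phi> g * \<psi> (inv g)) / of_nat (card (carrier G))"

lemma card_pos: "card (carrier G) > 0"
  using fin one_closed card_gt_0_iff by blast

lemma sum_inv: "(\<Sum>g\<in>carrier G. f (inv g)) = (\<Sum>g\<in>carrier G. f g)"
  by (rule sum.reindex_bij_witness[of _ "\<lambda>g. inv g" "\<lambda>g. inv g"]) auto

lemma sum_lmult: "h \<in> carrier G \<Longrightarrow> (\<Sum>g\<in>carrier G. f (h \<otimes> g)) = (\<Sum>g\<in>carrier G. f g)"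
  by (rule sum.reindex_bij_witness[of _ "\<lambda>g. inv h \<otimes> g" "\<lambda>g. h \<otimes> g"]) (auto simp: m_assoc[symmetric])

lemma sum_mat_lmult:
  assumes h: "h \<in> carrier G"
  shows "sum_mat n m (\<lambda>g. f (h \<otimes> g)) (carrier G) = sum_mat n m f (carrier G)"
  unfolding sum_mat_def using sum_lmult[OF h, of "\<lambda>g. f g $$ ij" for ij]
  by (intro cong_mat refl) (simp only: split_conv)

lemma form_sym: "form \<phi> \<psi> = form \<psi> \<phi>"
proof -
  have "(\<Sum>g\<in>carrier G. \<phi> g * \<psi> (inv g)) = (\<Sum>g\<in>carrier G. \<phi> (inv g) * \<psi> (inv (inv g)))"
    by (rule sum_inv[of "\<lambda>g. \<phi> g * \<psi> (inv g)", symmetric])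
  also have "\<dots> = (\<Sum>g\<in>carrier G. \<psi> g * \<phi> (inv g))"
    by (intro sum.cong refl) (simp add: mult.commute)
  finally show ?thesis by (simp add: form_def)
qed

lemma form_cong:
  "(\<And>g. g \<in> carrier G \<Longrightarrow> \<phi> g = \<phi>' g) \<Longrightarrow> (\<And>g. g \<in> carrier G \<Longrightarrow> \<psi> g = \<psi>' g) \<Longrightarrow>
    form \<phi> \<psi> = form \<phi>' \<psi>'"
  by (simp add: form_def cong: sum.cong)

lemma form_sum_right: "form \<phi> (\<lambda>g. \<Sum>i\<in>I. c i * \<psi> i g) = (\<Sum>i\<in>I. c i * form \<phi> (\<psi> i))"
proof -
  have "(\<Sum>g\<in>carrier G. \<phi> g * (\<Sum>i\<in>I. c i * \<psi> i (inv g))) = (\<Sum>i\<in>I. \<Sum>g\<in>carrier G. c i * (\<phi> g * \<psi> i (inv g)))"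
    by (subst sum.swap) (simp add: sum_distrib_left mult.left_commute)
  then show ?thesis by (simp add: form_def sum_divide_distrib[symmetric] sum_distrib_left[symmetric])
qed

lemma rep_carrier: "is_rep G \<sigma> \<Longrightarrow> g \<in> carrier G \<Longrightarrow> \<sigma> g \<in> carrier_mat (rep_dim G \<sigma>) (rep_dim G \<sigma>)"
  by (simp add: is_rep_def)

lemma rep_dims:
  "is_rep G \<sigma> \<Longrightarrow> g \<in> carrier G \<Longrightarrow> dim_row (\<sigma> g) = rep_dim G \<sigma>"
  "is_rep G \<sigma> \<Longrightarrow> g \<in> carrier G \<Longrightarrow> dim_col (\<sigma> g) = rep_dim G \<sigma>"
  using rep_carrier by auto

lemma rep_hom: "is_rep G \<sigma> \<Longrightarrow> g \<in> carrier G \<Longrightarrow> h \<in> carrier G \<Longrightarrow> \<sigma> (g \<otimes> h) = \<sigma> g * \<sigma> h"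
  by (simp add: is_rep_def)

lemma rep_one: "is_rep G \<sigma> \<Longrightarrow> \<sigma> \<one> = 1\<^sub>m (rep_dim G \<sigma>)"
  by (simp add: is_rep_def)

lemma rep_inv: "is_rep G \<sigma> \<Longrightarrow> g \<in> carrier G \<Longrightarrow> \<sigma> (inv g) * \<sigma> g = 1\<^sub>m (rep_dim G \<sigma>)"
  using rep_hom[of \<sigma> "inv g" g] rep_one[of \<sigma>] by simp

lemma is_repI:
  assumes "\<And>g. g \<in> carrier G \<Longrightarrow> \<sigma> g \<in> carrier_mat n n" "\<sigma> \<one> = 1\<^sub>m n"
    "\<And>g h. g \<in> carrier G \<Longrightarrow> h \<in> carrier G \<Longrightarrow> \<sigma> (g \<otimes> h) = \<sigma> g * \<sigma> h"
  shows "is_rep G \<sigma>" "rep_dim G \<sigma> = n"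
  using assms by (auto simp: is_rep_def rep_dim_def)

definition average :: "('a \<Rightarrow> complex mat) \<Rightarrow> ('a \<Rightarrow> complex mat) \<Rightarrow> complex mat \<Rightarrow> complex mat" where
  "average \<sigma> \<tau> X = sum_mat (rep_dim G \<sigma>) (rep_dim G \<tau>) (\<lambda>g. \<sigma> g * X * \<tau> (inv g)) (carrier G)"

lemma average_carrier: "average \<sigma> \<tau> X \<in> carrier_mat (rep_dim G \<sigma>) (rep_dim G \<tau>)"
  by (simp add: average_def)

text \<open>Substituting \<open>h \<otimes> g\<close> for \<open>g\<close> absorbs \<sigma>(h) on
  the left of the sum and releases \<tau>(h) on the right.\<close>

lemma average_intertwines:
  assumes \<sigma>: "is_rep G \<sigma>" and \<tau>: "is_rep G \<tau>" and h: "h \<in> carrier G"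
    and X: "X \<in> carrier_mat (rep_dim G \<sigma>) (rep_dim G \<tau>)"
  shows "\<sigma> h * average \<sigma> \<tau> X = average \<sigma> \<tau> X * \<tau> h"
proof -
  let ?n = "rep_dim G \<sigma>" and ?m = "rep_dim G \<tau>"
  note d = rep_dims[OF \<sigma>] rep_dims[OF \<tau>] carrier_matD[OF X] h
  have "\<sigma> h * average \<sigma> \<tau> X = sum_mat ?n ?m (\<lambda>g. \<sigma> h * (\<sigma> g * X * \<tau> (inv g))) (carrier G)"
    unfolding average_def
    by (subst mult_sum_mat) (auto intro!: carrier_matI simp: d)
  also have "\<dots> = sum_mat ?n ?m (\<lambda>g. \<sigma> (h \<otimes> g) * X * \<tau> (inv (h \<otimes> g) \<otimes> h)) (carrier G)"
  proof (intro sum_mat_cong)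
    fix g assume g: "g \<in> carrier G"
    have "inv (h \<otimes> g) \<otimes> h = inv g" using g h by (simp add: inv_mult_group m_assoc)
    moreover have "\<sigma> h * (\<sigma> g * X * \<tau> (inv g)) = \<sigma> h * \<sigma> g * X * \<tau> (inv g)"
      using g by (simp add: mult_mat_assoc_dim d)
    ultimately show "\<sigma> h * (\<sigma> g * X * \<tau> (inv g)) = \<sigma> (h \<otimes> g) * X * \<tau> (inv (h \<otimes> g) \<otimes> h)"
      using rep_hom[OF \<sigma> h g] by (simp only:)
  qed
  also have "\<dots> = sum_mat ?n ?m (\<lambda>g. \<sigma> g * X * \<tau> (inv g \<otimes> h)) (carrier G)"
    by (rule sum_mat_lmult[OF h, of ?n ?m "\<lambda>g. \<sigma> g * X * \<tau> (inv g \<otimes> h)"])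
  also have "\<dots> = sum_mat ?n ?m (\<lambda>g. \<sigma> g * X * \<tau> (inv g) * \<tau> h) (carrier G)"
  proof (intro sum_mat_cong)
    fix g assume g: "g \<in> carrier G"
    show "\<sigma> g * X * \<tau> (inv g \<otimes> h) = \<sigma> g * X * \<tau> (inv g) * \<tau> h"
      using g h by (simp add: rep_hom[OF \<tau>] mult_mat_assoc_dim d)
  qed
  also have "\<dots> = average \<sigma> \<tau> X * \<tau> h"
    unfolding average_def
    by (subst sum_mat_mult) (auto intro!: carrier_matI simp: d)
  finally show ?thesis .
qed

lemma irreducible_repD:
  assumes "irreducible_rep G \<sigma>"
  shows "is_rep G \<sigma>" "rep_dim G \<sigma> > 0"
    "\<And>W. vec_subspace (rep_dim G \<sigma>) W \<Longrightarrow> (\<And>g w. g \<in> carrier G \<Longrightarrow> w \<in> W \<Longrightarrow> \<sigma> g *\<^sub>v w \<in> W) \<Longrightarrow>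
      W = {0\<^sub>v (rep_dim G \<sigma>)} \<or> W = carrier_vec (rep_dim G \<sigma>)"
  using assms unfolding irreducible_rep_def vec_subspace_iff by blast+

text \<open>Kernel and image of \<open>X\<close> are invariant subspaces, so irreducibility makes
  \<open>X\<close> injective and onto; \<open>Y\<close> is assembled from preimages of the unit
  vectors. Equality of the two dimensions is a later consequence of the two-sided inverse.\<close>

lemma schur_invertible:
  assumes \<sigma>: "irreducible_rep G \<sigma>" and \<tau>: "irreducible_rep G \<tau>"
    and X: "X \<in> carrier_mat (rep_dim G \<sigma>) (rep_dim G \<tau>)"
    and comm: "\<And>h. h \<in> carrier G \<Longrightarrow> \<sigma> h * X = X * \<tau> h"
    and nz: "X \<noteq> 0\<^sub>m (rep_dim G \<sigma>) (rep_dim G \<tau>)"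
  shows "\<exists>Y \<in> carrier_mat (rep_dim G \<tau>) (rep_dim G \<sigma>).
    X * Y = 1\<^sub>m (rep_dim G \<sigma>) \<and> Y * X = 1\<^sub>m (rep_dim G \<tau>)"
proof -
  let ?n = "rep_dim G \<sigma>" and ?m = "rep_dim G \<tau>"
  note S = irreducible_repD[OF \<sigma>] and T = irreducible_repD[OF \<tau>]
  have Xv: "\<sigma> g *\<^sub>v (X *\<^sub>v v) = X *\<^sub>v (\<tau> g *\<^sub>v v)" if "g \<in> carrier G" "v \<in> carrier_vec ?m" for g v
    using assoc_mult_mat_vec[OF rep_carrier[OF S(1) that(1)] X that(2)]
      assoc_mult_mat_vec[OF X rep_carrier[OF T(1) that(1)] that(2)] comm[OF that(1)] by simp
  define K where "K = {v \<in> carrier_vec ?m. X *\<^sub>v v = 0\<^sub>v ?n}"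
  have "K = {0\<^sub>v ?m} \<or> K = carrier_vec ?m"
  proof (rule T(3))
    show "vec_subspace ?m K" unfolding K_def by (rule vec_subspace_kernel[OF X])
    fix g w assume g: "g \<in> carrier G" and "w \<in> K"
    then have w: "w \<in> carrier_vec ?m" "X *\<^sub>v w = 0\<^sub>v ?n" by (auto simp: K_def)
    have "X *\<^sub>v (\<tau> g *\<^sub>v w) = \<sigma> g *\<^sub>v 0\<^sub>v ?n" using Xv[OF g w(1)] w by simp
    also have "\<dots> = 0\<^sub>v ?n" using rep_carrier[OF S(1) g] by (intro eq_vecI) auto
    finally show "\<tau> g *\<^sub>v w \<in> K" using rep_carrier[OF T(1) g] w by (auto simp: K_def)
  qed
  moreover have "K \<noteq> carrier_vec ?m"
  proof
    assume "K = carrier_vec ?m"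
    have "X *\<^sub>v v = 0\<^sub>m ?n ?m *\<^sub>v v" if v: "v \<in> carrier_vec ?m" for v
    proof -
      have "v \<in> K" using v \<open>K = carrier_vec ?m\<close> by simp
      then show ?thesis using v by (auto simp: K_def)
    qed
    then have "X = 0\<^sub>m ?n ?m" using X by (intro mat_eqI_vec[of _ ?n ?m]) auto
    with nz show False by simp
  qed
  ultimately have K: "K = {0\<^sub>v ?m}" by simp
  define I where "I = (\<lambda>v. X *\<^sub>v v) ` carrier_vec ?m"
  have "I = {0\<^sub>v ?n} \<or> I = carrier_vec ?n"
  proof (rule S(3))
    show "vec_subspace ?n I" unfolding I_def by (rule vec_subspace_range[OF X])
    fix g w assume g: "g \<in> carrier G" and "w \<in> I"
    then obtain v where v: "v \<in> carrier_vec ?m" "w = X *\<^sub>v v" by (auto simp: I_def)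
    then have "\<sigma> g *\<^sub>v w = X *\<^sub>v (\<tau> g *\<^sub>v v)" using Xv[OF g] by simp
    moreover have "\<tau> g *\<^sub>v v \<in> carrier_vec ?m" using rep_carrier[OF T(1) g] v by simp
    ultimately show "\<sigma> g *\<^sub>v w \<in> I" by (auto simp: I_def)
  qed
  moreover have "I \<noteq> {0\<^sub>v ?n}"
  proof
    assume I: "I = {0\<^sub>v ?n}"
    have "X *\<^sub>v v = 0\<^sub>m ?n ?m *\<^sub>v v" if v: "v \<in> carrier_vec ?m" for v
    proof -
      have "X *\<^sub>v v \<in> I" using v by (simp add: I_def)
      then show ?thesis using I v by auto
    qed
    then have "X = 0\<^sub>m ?n ?m" using X by (intro mat_eqI_vec[of _ ?n ?m]) auto
    with nz show False by simp
  qed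
  ultimately have I: "I = carrier_vec ?n" by simp
  have "\<exists>v. v \<in> carrier_vec ?m \<and> X *\<^sub>v v = unit_vec ?n i" if "i < ?n" for i
  proof -
    have "unit_vec ?n i \<in> I" using I by simp
    then show ?thesis unfolding I_def by (metis imageE)
  qed
  then obtain y where y: "\<And>i. i < ?n \<Longrightarrow> y i \<in> carrier_vec ?m" "\<And>i. i < ?n \<Longrightarrow> X *\<^sub>v y i = unit_vec ?n i"
    by metis
  define Y where "Y = Matrix.mat ?m ?n (\<lambda>(r, i). y i $ r)"
  have Y: "Y \<in> carrier_mat ?m ?n" by (simp add: Y_def)
  have XY: "X * Y = 1\<^sub>m ?n"
  proof (rule eq_matI)
    fix i j assume "i < dim_row (1\<^sub>m ?n :: complex mat)" "j < dim_col (1\<^sub>m ?n :: complex mat)"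
    then have ij: "i < ?n" "j < ?n" by auto
    have "(X * Y) $$ (i, j) = (X *\<^sub>v y j) $ i"
      unfolding mult_mat_index[OF X Y ij] mult_mat_vec_index[OF X y(1)[OF ij(2)] ij(1)]
      using ij by (intro sum.cong) (auto simp: Y_def)
    then show "(X * Y) $$ (i, j) = (1\<^sub>m ?n) $$ (i, j)" using ij y by auto
  qed (use X Y in auto)
  have "Y * X = 1\<^sub>m ?m"
  proof (rule mat_eqI_vec)
    fix v :: "complex Matrix.vec" assume v: "v \<in> carrier_vec ?m"
    have Xv: "X *\<^sub>v v \<in> carrier_vec ?n" using X v by simp
    have YXv: "Y *\<^sub>v (X *\<^sub>v v) \<in> carrier_vec ?m" using Xv Y by simp
    have "X *\<^sub>v (Y *\<^sub>v (X *\<^sub>v v)) = X *\<^sub>v v"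
      using assoc_mult_mat_vec[OF X Y Xv] XY Xv by simp
    then have "X *\<^sub>v (Y *\<^sub>v (X *\<^sub>v v) + (-1) \<cdot>\<^sub>v v) = 0\<^sub>v ?n"
      unfolding mult_add_smult_vec[OF X YXv v] using Xv X
      by (intro eq_vecI) (simp_all del: index_mult_mat_vec dim_mult_mat_vec)
    then have "Y *\<^sub>v (X *\<^sub>v v) + (-1) \<cdot>\<^sub>v v \<in> K" using YXv v by (simp add: K_def)
    then have z: "Y *\<^sub>v (X *\<^sub>v v) + (-1) \<cdot>\<^sub>v v = 0\<^sub>v ?m" using K by simp
    have "Y *\<^sub>v (X *\<^sub>v v) = v"
    proof (rule eq_vecI)
      fix i assume i: "i < dim_vec v"
      then show "(Y *\<^sub>v (X *\<^sub>v v)) $ i = v $ i"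
        using v YXv arg_cong[OF z, of "\<lambda>u. u $ i"] by (simp del: index_mult_mat_vec dim_mult_mat_vec)
    qed (use v Y in simp)
    then show "Y * X *\<^sub>v v = 1\<^sub>m ?m *\<^sub>v v" using X Y v by simp
  qed (use X Y in auto)
  with XY Y show ?thesis by blast
qed

end

section \<open>Isomorphism of representations and orthogonality of characters\<close>

context finite_grp
begin

lemma rep_isoI:
  assumes "is_rep G \<sigma>" "P \<in> carrier_mat (rep_dim G \<sigma>) (rep_dim G \<sigma>)" "Q \<in> carrier_mat (rep_dim G \<sigma>) (rep_dim G \<sigma>)"
    "rep_dim G \<tau> = rep_dim G \<sigma>"
    "P * Q = 1\<^sub>m (rep_dim G \<sigma>)" "Q * P = 1\<^sub>m (rep_dim G \<sigma>)"
    "\<And>g. g \<in> carrier G \<Longrightarrow> P * \<sigma> g = \<tau> g * P"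
  shows "rep_iso G \<sigma> \<tau>"
  using assms invertible_matI[OF assms(2,3,5,6)] unfolding rep_iso_def by auto

lemma rep_isoE:
  assumes "rep_iso G \<sigma> \<tau>"
  obtains P Q where "rep_dim G \<tau> = rep_dim G \<sigma>"
    "P \<in> carrier_mat (rep_dim G \<sigma>) (rep_dim G \<sigma>)" "Q \<in> carrier_mat (rep_dim G \<sigma>) (rep_dim G \<sigma>)"
    "P * Q = 1\<^sub>m (rep_dim G \<sigma>)" "Q * P = 1\<^sub>m (rep_dim G \<sigma>)"
    "\<And>g. g \<in> carrier G \<Longrightarrow> P * \<sigma> g = \<tau> g * P"
proof -
  from assms obtain P where P: "rep_dim G \<tau> = rep_dim G \<sigma>" "P \<in> carrier_mat (rep_dim G \<sigma>) (rep_dim G \<sigma>)"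
    "invertible_mat P" "\<And>g. g \<in> carrier G \<Longrightarrow> P * \<sigma> g = \<tau> g * P"
    unfolding rep_iso_def by auto
  then show ?thesis using that invertible_matE[OF P(3,2)] by metis
qed

lemma rep_iso_refl: assumes \<sigma>: "is_rep G \<sigma>" shows "rep_iso G \<sigma> \<sigma>"
  by (rule rep_isoI[OF \<sigma>, of "1\<^sub>m (rep_dim G \<sigma>)" "1\<^sub>m (rep_dim G \<sigma>)"])
     (auto simp: left_mult_one_mat[OF rep_carrier[OF \<sigma>]] right_mult_one_mat[OF rep_carrier[OF \<sigma>]])

lemma intertwined_conj:
  fixes A B P Q :: "complex mat"
  assumes A: "A \<in> carrier_mat n n" and B: "B \<in> carrier_mat n n" and P: "P \<in> carrier_mat n n"
    and Q: "Q \<in> carrier_mat n n" and PQ: "P * Q = 1\<^sub>m n" and eq: "P * A = B * P"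
  shows "B = P * A * Q"
proof -
  have "P * A * Q = B * (P * Q)"
    unfolding eq using P Q B by (intro assoc_mult_mat) auto
  then show ?thesis using PQ B by simp
qed

lemma rep_iso_sym:
  assumes \<sigma>: "is_rep G \<sigma>" and \<tau>: "is_rep G \<tau>" and iso: "rep_iso G \<sigma> \<tau>"
  shows "rep_iso G \<tau> \<sigma>"
proof -
  from rep_isoE[OF iso] obtain P Q where PQ: "rep_dim G \<tau> = rep_dim G \<sigma>"
    "P \<in> carrier_mat (rep_dim G \<sigma>) (rep_dim G \<sigma>)" "Q \<in> carrier_mat (rep_dim G \<sigma>) (rep_dim G \<sigma>)"
    "P * Q = 1\<^sub>m (rep_dim G \<sigma>)" "Q * P = 1\<^sub>m (rep_dim G \<sigma>)"
    "\<And>g. g \<in> carrier G \<Longrightarrow> P * \<sigma> g = \<tau> g * P" by metis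
  show ?thesis
  proof (rule rep_isoI[OF \<tau>, of Q P])
    fix g assume g: "g \<in> carrier G"
    note s = rep_carrier[OF \<sigma> g] and t = rep_carrier[OF \<tau> g, unfolded PQ(1)]
    have "Q * \<tau> g = Q * (P * \<sigma> g * Q)"
      using intertwined_conj[OF s t PQ(2,3,4) PQ(6)[OF g]] by (simp only:)
    also have "\<dots> = (Q * P) * (\<sigma> g * Q)"
      using carrier_matD[OF s] carrier_matD[OF PQ(2)] carrier_matD[OF PQ(3)] by (simp add: mult_mat_assoc_dim)
    also have "\<dots> = \<sigma> g * Q" using s PQ by simp
    finally show "Q * \<tau> g = \<sigma> g * Q" .
  qed (use PQ in auto)
qed

lemma rep_iso_trans:
  assumes \<sigma>: "is_rep G \<sigma>" and \<tau>: "is_rep G \<tau>" and \<pi>: "is_rep G \<pi>"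
    and "rep_iso G \<sigma> \<tau>" "rep_iso G \<tau> \<pi>"
  shows "rep_iso G \<sigma> \<pi>"
proof -
  let ?n = "rep_dim G \<sigma>"
  from rep_isoE[OF assms(4)] obtain P Q where PQ: "rep_dim G \<tau> = ?n"
    "P \<in> carrier_mat ?n ?n" "Q \<in> carrier_mat ?n ?n" "P * Q = 1\<^sub>m ?n" "Q * P = 1\<^sub>m ?n"
    "\<And>g. g \<in> carrier G \<Longrightarrow> P * \<sigma> g = \<tau> g * P" by metis
  from rep_isoE[OF assms(5)] obtain R S where RS: "rep_dim G \<pi> = ?n"
    "R \<in> carrier_mat ?n ?n" "S \<in> carrier_mat ?n ?n" "R * S = 1\<^sub>m ?n" "S * R = 1\<^sub>m ?n"
    "\<And>g. g \<in> carrier G \<Longrightarrow> R * \<tau> g = \<pi> g * R" unfolding PQ(1) by metis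
  note d = carrier_matD[OF PQ(2)] carrier_matD[OF PQ(3)] carrier_matD[OF RS(2)] carrier_matD[OF RS(3)]
  show ?thesis
  proof (rule rep_isoI[OF \<sigma>, of "R * P" "Q * S"])
    have "R * P * (Q * S) = R * ((P * Q) * S)" using d by (simp add: mult_mat_assoc_dim)
    then show "R * P * (Q * S) = 1\<^sub>m ?n" using PQ RS by simp
    have "Q * S * (R * P) = Q * ((S * R) * P)" using d by (simp add: mult_mat_assoc_dim)
    then show "Q * S * (R * P) = 1\<^sub>m ?n" using PQ RS by simp
    fix g assume g: "g \<in> carrier G"
    note dg = rep_dims[OF \<sigma> g] rep_dims[OF \<tau> g] rep_dims[OF \<pi> g]
    have "R * P * \<sigma> g = R * (\<tau> g * P)" using d dg PQ(6)[OF g] by (simp add: mult_mat_assoc_dim)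
    also have "\<dots> = (R * \<tau> g) * P" using d dg PQ(1) by (simp add: mult_mat_assoc_dim)
    also have "\<dots> = \<pi> g * R * P" using RS(6)[OF g] by (simp only:)
    also have "\<dots> = \<pi> g * (R * P)" using d dg RS(1) by (simp add: mult_mat_assoc_dim)
    finally show "R * P * \<sigma> g = \<pi> g * (R * P)" .
  qed (use PQ RS in auto)
qed

lemma char_iso:
  assumes \<sigma>: "is_rep G \<sigma>" and \<tau>: "is_rep G \<tau>" and iso: "rep_iso G \<sigma> \<tau>" and g: "g \<in> carrier G"
  shows "char \<sigma> g = char \<tau> g"
proof -
  from rep_isoE[OF iso] obtain P Q where PQ: "rep_dim G \<tau> = rep_dim G \<sigma>"
    "P \<in> carrier_mat (rep_dim G \<sigma>) (rep_dim G \<sigma>)" "Q \<in> carrier_mat (rep_dim G \<sigma>) (rep_dim G \<sigma>)"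
    "P * Q = 1\<^sub>m (rep_dim G \<sigma>)" "Q * P = 1\<^sub>m (rep_dim G \<sigma>)"
    "\<And>g. g \<in> carrier G \<Longrightarrow> P * \<sigma> g = \<tau> g * P" by metis
  note s = rep_carrier[OF \<sigma> g] and t = rep_carrier[OF \<tau> g, unfolded PQ(1)]
  have "\<tau> g = P * \<sigma> g * Q" by (rule intertwined_conj[OF s t PQ(2,3,4) PQ(6)[OF g]])
  then show ?thesis unfolding char_def using mtrace_similar[OF PQ(2,3) s PQ(5)] by simp
qed

definition elem_mat :: "nat \<Rightarrow> nat \<Rightarrow> nat \<Rightarrow> nat \<Rightarrow> complex mat" where
  "elem_mat n m k l = Matrix.mat n m (\<lambda>(i, j). if i = k \<and> j = l then 1 else 0)"

lemma elem_mat_sandwich: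
  assumes A: "A \<in> carrier_mat n n" and B: "B \<in> carrier_mat m m" and k: "k < n" "l < m"
  shows "(A * elem_mat n m k l * B) $$ (k, l) = A $$ (k, k) * B $$ (l, l)"
proof -
  have E: "elem_mat n m k l \<in> carrier_mat n m" by (simp add: elem_mat_def)
  have AE: "(A * elem_mat n m k l) $$ (k, r) = (if r = l then A $$ (k, k) else 0)" if "r < m" for r
  proof -
    have "(A * elem_mat n m k l) $$ (k, r) = (\<Sum>s = 0..<n. if s = k then (if r = l then A $$ (k, k) else 0) else 0)"
      unfolding mult_mat_index[OF A E k(1) that] using that by (intro sum.cong) (auto simp: elem_mat_def)
    then show ?thesis using k by simp
  qed
  have "(A * elem_mat n m k l * B) $$ (k, l) = (\<Sum>r = 0..<m. if r = l then A $$ (k, k) * B $$ (l, l) else 0)"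
    unfolding mult_mat_index[OF mult_carrier_mat[OF A E] B k] by (intro sum.cong) (auto simp: AE)
  then show ?thesis using k by simp
qed

lemma average_elem_mat:
  assumes \<sigma>: "is_rep G \<sigma>" and \<tau>: "is_rep G \<tau>" and k: "k < rep_dim G \<sigma>" and l: "l < rep_dim G \<tau>"
  shows "average \<sigma> \<tau> (elem_mat (rep_dim G \<sigma>) (rep_dim G \<tau>) k l) $$ (k, l) =
    (\<Sum>g\<in>carrier G. \<sigma> g $$ (k, k) * \<tau> (inv g) $$ (l, l))"
  unfolding average_def sum_mat_index[OF k l]
  by (intro sum.cong refl elem_mat_sandwich rep_carrier[OF \<sigma>] rep_carrier[OF \<tau>] k l) auto

text \<open>A product of two traces is a sum of products of diagonal entries, and each such product
  is one entry of a matrix unit multiplied from both sides. Both orthogonality relations thereby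
  reduce to Schur's lemma for averages of matrix units.\<close>

lemma sum_char_average:
  assumes \<sigma>: "is_rep G \<sigma>" and \<tau>: "is_rep G \<tau>"
  shows "(\<Sum>g\<in>carrier G. char \<sigma> g * char \<tau> (inv g)) =
    (\<Sum>k = 0..<rep_dim G \<sigma>. \<Sum>l = 0..<rep_dim G \<tau>.
       average \<sigma> \<tau> (elem_mat (rep_dim G \<sigma>) (rep_dim G \<tau>) k l) $$ (k, l))"
proof -
  have "(\<Sum>g\<in>carrier G. char \<sigma> g * char \<tau> (inv g)) =
    (\<Sum>g\<in>carrier G. \<Sum>k = 0..<rep_dim G \<sigma>. \<Sum>l = 0..<rep_dim G \<tau>. \<sigma> g $$ (k, k) * \<tau> (inv g) $$ (l, l))"
    by (intro sum.cong refl) (simp add: char_def mtrace_def rep_dims[OF \<sigma>] rep_dims[OF \<tau>] sum_product)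
  also have "\<dots> = (\<Sum>k = 0..<rep_dim G \<sigma>. \<Sum>l = 0..<rep_dim G \<tau>. \<Sum>g\<in>carrier G. \<sigma> g $$ (k, k) * \<tau> (inv g) $$ (l, l))"
    by (subst sum.swap, intro sum.cong refl sum.swap)
  also have "\<dots> = (\<Sum>k = 0..<rep_dim G \<sigma>. \<Sum>l = 0..<rep_dim G \<tau>.
       average \<sigma> \<tau> (elem_mat (rep_dim G \<sigma>) (rep_dim G \<tau>) k l) $$ (k, l))"
    by (intro sum.cong refl average_elem_mat[OF \<sigma> \<tau>, symmetric]) auto
  finally show ?thesis .
qed

text \<open>A nonzero average would be an invertible intertwiner by Schur's lemma, hence an
  isomorphism; so all averages between the two representations vanish.\<close>

lemma form_char_distinct:
  assumes \<sigma>: "irreducible_rep G \<sigma>" and \<tau>: "irreducible_rep G \<tau>" and ni: "\<not> rep_iso G \<sigma> \<tau>"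
  shows "form (char \<sigma>) (char \<tau>) = 0"
proof -
  note S = irreducible_repD[OF \<sigma>] and T = irreducible_repD[OF \<tau>]
  let ?n = "rep_dim G \<sigma>" and ?m = "rep_dim G \<tau>"
  have z: "average \<sigma> \<tau> X = 0\<^sub>m ?n ?m" if X: "X \<in> carrier_mat ?n ?m" for X
  proof (rule ccontr)
    assume nz: "average \<sigma> \<tau> X \<noteq> 0\<^sub>m ?n ?m"
    let ?A = "average \<sigma> \<tau> X"
    have A: "?A \<in> carrier_mat ?n ?m" by (rule average_carrier)
    from schur_invertible[OF \<sigma> \<tau> A average_intertwines[OF S(1) T(1) _ X] nz]
    obtain Y where Y: "Y \<in> carrier_mat ?m ?n" "?A * Y = 1\<^sub>m ?n" "Y * ?A = 1\<^sub>m ?m" by blast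
    have nm: "?n = ?m" by (rule two_sided_inverse_square[OF A Y])
    have "rep_iso G \<tau> \<sigma>"
      by (rule rep_isoI[OF T(1), of ?A Y]) (use A Y nm average_intertwines[OF S(1) T(1) _ X] in auto)
    then show False using ni rep_iso_sym[OF T(1) S(1)] by simp
  qed
  have E: "elem_mat ?n ?m k l \<in> carrier_mat ?n ?m" for k l by (simp add: elem_mat_def)
  show ?thesis unfolding form_def sum_char_average[OF S(1) T(1)] by (simp add: z[OF E])
qed

text \<open>Over the complex numbers the average has an eigenvalue \<open>c\<close>. Subtracting
  \<open>c\<close> leaves a singular intertwiner, which is zero by Schur's lemma, and comparing
  traces determines \<open>c\<close>.\<close>

lemma average_scalar:
  assumes \<sigma>: "irreducible_rep G \<sigma>" and X: "X \<in> carrier_mat (rep_dim G \<sigma>) (rep_dim G \<sigma>)"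
  shows "average \<sigma> \<sigma> X = (of_nat (card (carrier G)) * mtrace X / of_nat (rep_dim G \<sigma>)) \<cdot>\<^sub>m 1\<^sub>m (rep_dim G \<sigma>)"
proof -
  note S = irreducible_repD[OF \<sigma>]
  let ?n = "rep_dim G \<sigma>"
  let ?A = "average \<sigma> \<sigma> X"
  have A: "?A \<in> carrier_mat ?n ?n" by (rule average_carrier)
  obtain c where "c \<in> spectrum ?A" using spectrum_non_empty[OF A S(2)] by auto
  then obtain v where v: "v \<in> carrier_vec ?n" "v \<noteq> 0\<^sub>v ?n" "?A *\<^sub>v v = c \<cdot>\<^sub>v v"
    using A unfolding spectrum_def eigenvalue_def eigenvector_def by auto
  let ?B = "?A + (-c) \<cdot>\<^sub>m 1\<^sub>m ?n"
  have B: "?B \<in> carrier_mat ?n ?n" using A by simp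
  have Bv: "?B *\<^sub>v v = 0\<^sub>v ?n"
  proof -
    have "?B *\<^sub>v v = ?A *\<^sub>v v + ((-c) \<cdot>\<^sub>m 1\<^sub>m ?n) *\<^sub>v v" using A v by (intro add_mult_distrib_mat_vec) auto
    also have "((-c) \<cdot>\<^sub>m 1\<^sub>m ?n) *\<^sub>v v = (-c) \<cdot>\<^sub>v v"
      using v by (intro eq_vecI) (auto simp: smult_scalar_prod_distrib)
    finally show ?thesis unfolding v(3) using v by (intro eq_vecI) auto
  qed
  have comm: "\<sigma> h * ?B = ?B * \<sigma> h" if h: "h \<in> carrier G" for h
  proof -
    note s = rep_carrier[OF S(1) h]
    have "\<sigma> h * ?B = \<sigma> h * ?A + (-c) \<cdot>\<^sub>m \<sigma> h"
      using s A by (simp add: mult_add_distrib_mat[OF s A] mult_smult_distrib[OF s one_carrier_mat])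
    moreover have "?B * \<sigma> h = ?A * \<sigma> h + (-c) \<cdot>\<^sub>m \<sigma> h"
      using s A by (simp add: add_mult_distrib_mat[OF A _ s] mult_smult_assoc_mat[of _ ?n ?n _ ?n])
    ultimately show ?thesis using average_intertwines[OF S(1) S(1) h X] by simp
  qed
  have Bz: "?B = 0\<^sub>m ?n ?n"
  proof (rule ccontr)
    assume "?B \<noteq> 0\<^sub>m ?n ?n"
    from schur_invertible[OF \<sigma> \<sigma> B comm this] obtain Y where
      Y: "Y \<in> carrier_mat ?n ?n" "Y * ?B = 1\<^sub>m ?n" by blast
    have "v = (Y * ?B) *\<^sub>v v" using Y(2) v by simp
    also have "\<dots> = Y *\<^sub>v (?B *\<^sub>v v)" by (rule assoc_mult_mat_vec[OF Y(1) B v(1)])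
    also have "\<dots> = 0\<^sub>v ?n" unfolding Bv using Y(1) by (intro eq_vecI) auto
    finally show False using v by simp
  qed
  have "?A $$ (i, j) = (if i = j then c else 0)" if ij: "i < ?n" "j < ?n" for i j
  proof -
    have "?B $$ (i, j) = 0" unfolding Bz using ij by simp
    then show ?thesis using ij A by (auto split: if_splits)
  qed
  then have Ac: "?A = c \<cdot>\<^sub>m 1\<^sub>m ?n" using A by (intro eq_matI) auto
  have "mtrace ?A = (\<Sum>g\<in>carrier G. mtrace (\<sigma> g * X * \<sigma> (inv g)))"
    unfolding average_def using rep_carrier[OF S(1)] X
    by (intro mtrace_sum_mat mult_carrier_mat[of _ ?n ?n]) auto
  also have "\<dots> = (\<Sum>g\<in>carrier G. mtrace X)"
    using rep_carrier[OF S(1)] X rep_inv[OF S(1)] by (intro sum.cong refl mtrace_similar[of _ ?n]) auto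
  also have "\<dots> = of_nat (card (carrier G)) * mtrace X" by simp
  finally have "of_nat ?n * c = of_nat (card (carrier G)) * mtrace X" by (simp add: Ac mtrace_def)
  then have "c = of_nat (card (carrier G)) * mtrace X / of_nat ?n" using S(2) by (simp add: field_simps)
  then show ?thesis using Ac by simp
qed

text \<open>A matrix unit has trace 1 on the diagonal and 0 off it, so each of the
  \<open>rep_dim G \<sigma>\<close> diagonal positions contributes the group order divided by
  \<open>rep_dim G \<sigma>\<close>.\<close>

lemma form_char_self:
  assumes \<sigma>: "irreducible_rep G \<sigma>"
  shows "form (char \<sigma>) (char \<sigma>) = 1"
proof -
  note S = irreducible_repD[OF \<sigma>]
  let ?n = "rep_dim G \<sigma>"
  have E: "elem_mat ?n ?n k l \<in> carrier_mat ?n ?n" for k l by (simp add: elem_mat_def)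
  have tr: "mtrace (elem_mat ?n ?n k l) = (if k = l then 1 else 0)" if "k < ?n" "l < ?n" for k l
  proof -
    have "mtrace (elem_mat ?n ?n k l) = (\<Sum>i = 0..<?n. if i = k then (if k = l then 1 else 0) else 0)"
      unfolding mtrace_def by (intro sum.cong) (auto simp: elem_mat_def)
    then show ?thesis using that by simp
  qed
  have "(\<Sum>k = 0..<?n. \<Sum>l = 0..<?n. average \<sigma> \<sigma> (elem_mat ?n ?n k l) $$ (k, l)) =
    (\<Sum>k = 0..<?n. \<Sum>l = 0..<?n. if l = k then of_nat (card (carrier G)) / of_nat ?n else 0)"
    by (intro sum.cong refl) (auto simp: average_scalar[OF \<sigma> E] tr)
  also have "\<dots> = of_nat (card (carrier G))" using S(2) by simp
  finally show ?thesis unfolding form_def sum_char_average[OF S(1) S(1)] using card_pos by simp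
qed

lemma form_char_irreducible:
  assumes \<sigma>: "irreducible_rep G \<sigma>" and \<tau>: "irreducible_rep G \<tau>"
  shows "form (char \<sigma>) (char \<tau>) = (if rep_iso G \<sigma> \<tau> then 1 else 0)"
proof (cases "rep_iso G \<sigma> \<tau>")
  case True
  then have "form (char \<sigma>) (char \<tau>) = form (char \<sigma>) (char \<sigma>)"
    using char_iso[OF irreducible_repD(1)[OF \<sigma>] irreducible_repD(1)[OF \<tau>] True] by (intro form_cong) auto
  then show ?thesis using True form_char_self[OF \<sigma>] by simp
qed (use form_char_distinct[OF \<sigma> \<tau>] in simp)

end

section \<open>Complete reducibility\<close>

lemma four_block_pad:
  "X \<in> carrier_mat a b \<Longrightarrow> four_block_mat X (0\<^sub>m a 0) (0\<^sub>m 0 b) (0\<^sub>m 0 0) = (X :: complex mat)"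
  by (intro eq_matI) auto

lemma mult_mat_vec_assoc_dim:
  "dim_col A = dim_row B \<Longrightarrow> dim_vec v = dim_col B \<Longrightarrow> (A * B) *\<^sub>v v = A *\<^sub>v (B *\<^sub>v (v :: complex Matrix.vec))"
  by (rule assoc_mult_mat_vec[of A "dim_row A" "dim_row B" B "dim_col B"]) (auto intro: carrier_vecI)

text \<open>The coordinate map \<open>L\<close> of a basis \<open>B\<close> of the range need not
  vanish on the kernel of \<open>F\<close>. \<open>L * F\<close> does, and it is still a left
  inverse of \<open>B\<close> because \<open>F * B = B\<close>.\<close>

lemma idempotent_factor:
  fixes F :: "complex mat"
  assumes F: "F \<in> carrier_mat n n" and FF: "F * F = F"
  obtains k L B where "L \<in> carrier_mat k n" "B \<in> carrier_mat n k" "L * B = 1\<^sub>m k" "B * L = F"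
proof -
  obtain k L B where L: "L \<in> carrier_mat k n" and B: "B \<in> carrier_mat n k" and LB: "L * B = 1\<^sub>m k"
    and R: "(\<lambda>v. F *\<^sub>v v) ` carrier_vec n = (\<lambda>v. B *\<^sub>v v) ` carrier_vec k"
    using basis_matrix[OF vec_subspace_range[OF F]] by metis
  have FB: "F * B = B"
  proof (rule mat_eqI_vec)
    fix v :: "complex Matrix.vec" assume v: "v \<in> carrier_vec k"
    then obtain u where u: "u \<in> carrier_vec n" "B *\<^sub>v v = F *\<^sub>v u" using R by blast
    have "F * B *\<^sub>v v = F *\<^sub>v (F *\<^sub>v u)" using F B v u by (simp add: assoc_mult_mat_vec[of F n n B k])
    also have "\<dots> = (F * F) *\<^sub>v u" by (rule assoc_mult_mat_vec[OF F F u(1), symmetric])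
    finally show "F * B *\<^sub>v v = B *\<^sub>v v" unfolding FF u(2) .
  qed (use F B in auto)
  have BLF: "B * (L * F) = F"
  proof (rule mat_eqI_vec)
    fix v :: "complex Matrix.vec" assume v: "v \<in> carrier_vec n"
    then obtain u where u: "u \<in> carrier_vec k" "F *\<^sub>v v = B *\<^sub>v u" using R by blast
    have "B * (L * F) *\<^sub>v v = B *\<^sub>v (L *\<^sub>v (F *\<^sub>v v))"
      using F B L v by (simp add: mult_mat_vec_assoc_dim)
    also have "\<dots> = B *\<^sub>v ((L * B) *\<^sub>v u)" unfolding u(2) using assoc_mult_mat_vec[OF L B u(1)] by simp
    finally show "B * (L * F) *\<^sub>v v = F *\<^sub>v v" unfolding LB u(2) using u(1) by simp
  qed (use F B L in auto)
  have "L * F * B = L * (F * B)" using L F B by simp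
  then have "L * F * B = 1\<^sub>m k" unfolding FB LB .
  then show ?thesis using that[of "L * F" k B] L F B BLF by simp
qed

context finite_grp
begin

text \<open>In a product of two compressed values \<open>B * L\<close> stands in the middle; it
  commutes past \<pi> and is absorbed by \<open>L * B = 1\<close>.\<close>

lemma compress_rep:
  assumes \<pi>: "is_rep G \<pi>" and L: "L \<in> carrier_mat k (rep_dim G \<pi>)" and B: "B \<in> carrier_mat (rep_dim G \<pi>) k"
    and LB: "L * B = 1\<^sub>m k" and comm: "\<And>g. g \<in> carrier G \<Longrightarrow> \<pi> g * (B * L) = (B * L) * \<pi> g"
  shows "is_rep G (\<lambda>g. L * \<pi> g * B)" "rep_dim G (\<lambda>g. L * \<pi> g * B) = k"
proof -
  let ?n = "rep_dim G \<pi>"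
  note d = carrier_matD[OF L] carrier_matD[OF B] rep_dims[OF \<pi>]
  have 1: "L * \<pi> g * B \<in> carrier_mat k k" if "g \<in> carrier G" for g
    using L B rep_carrier[OF \<pi> that] by simp
  have 2: "L * \<pi> \<one> * B = 1\<^sub>m k" using L B LB by (simp add: rep_one[OF \<pi>])
  have 3: "L * \<pi> (g \<otimes> h) * B = (L * \<pi> g * B) * (L * \<pi> h * B)" if g: "g \<in> carrier G" and h: "h \<in> carrier G" for g h
  proof -
    have "(L * \<pi> g * B) * (L * \<pi> h * B) = L * \<pi> g * (((B * L) * \<pi> h) * B)"
      using g h by (simp add: mult_mat_assoc_dim d)
    also have "\<dots> = L * \<pi> g * (\<pi> h * B * (L * B))"
      unfolding comm[OF h, symmetric] using g h by (simp add: mult_mat_assoc_dim d)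
    also have "\<dots> = L * (\<pi> g * \<pi> h) * B"
      unfolding LB using g h B by (simp add: mult_mat_assoc_dim d right_mult_one_mat')
    finally show ?thesis using rep_hom[OF \<pi> g h] by simp
  qed
  show "is_rep G (\<lambda>g. L * \<pi> g * B)" "rep_dim G (\<lambda>g. L * \<pi> g * B) = k"
    using is_repI[of "\<lambda>g. L * \<pi> g * B" k] 1 2 3 by auto
qed

definition dsum :: "('a \<Rightarrow> complex mat) \<Rightarrow> ('a \<Rightarrow> complex mat) \<Rightarrow> 'a \<Rightarrow> complex mat" where
  "dsum \<sigma> \<tau> g = four_block_mat (\<sigma> g) (0\<^sub>m (rep_dim G \<sigma>) (rep_dim G \<tau>)) (0\<^sub>m (rep_dim G \<tau>) (rep_dim G \<sigma>)) (\<tau> g)"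

lemma dsum_rep:
  assumes \<sigma>: "is_rep G \<sigma>" and \<tau>: "is_rep G \<tau>"
  shows "is_rep G (dsum \<sigma> \<tau>)" "rep_dim G (dsum \<sigma> \<tau>) = rep_dim G \<sigma> + rep_dim G \<tau>"
proof -
  have 1: "dsum \<sigma> \<tau> g \<in> carrier_mat (rep_dim G \<sigma> + rep_dim G \<tau>) (rep_dim G \<sigma> + rep_dim G \<tau>)"
    if "g \<in> carrier G" for g
    unfolding dsum_def using rep_carrier[OF \<sigma> that] rep_carrier[OF \<tau> that] by (rule four_block_carrier_mat)
  have 2: "dsum \<sigma> \<tau> \<one> = 1\<^sub>m (rep_dim G \<sigma> + rep_dim G \<tau>)"
    by (simp add: dsum_def rep_one[OF \<sigma>] rep_one[OF \<tau>])
  have 3: "dsum \<sigma> \<tau> (g \<otimes> h) = dsum \<sigma> \<tau> g * dsum \<sigma> \<tau> h" if g: "g \<in> carrier G" and h: "h \<in> carrier G" for g h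
    unfolding dsum_def rep_hom[OF \<sigma> g h] rep_hom[OF \<tau> g h]
    using rep_carrier[OF \<sigma> g] rep_carrier[OF \<tau> g] rep_carrier[OF \<sigma> h] rep_carrier[OF \<tau> h]
    by (subst mult_four_block_mat[of _ "rep_dim G \<sigma>" "rep_dim G \<sigma>" _ "rep_dim G \<tau>" _ "rep_dim G \<tau>" _ _ "rep_dim G \<sigma>" _ "rep_dim G \<tau>"]) auto
  show "is_rep G (dsum \<sigma> \<tau>)" "rep_dim G (dsum \<sigma> \<tau>) = rep_dim G \<sigma> + rep_dim G \<tau>"
    using is_repI[of "dsum \<sigma> \<tau>"] 1 2 3 by auto
qed

lemma char_dsum:
  assumes "is_rep G \<sigma>" "is_rep G \<tau>" "g \<in> carrier G"
  shows "char (dsum \<sigma> \<tau>) g = char \<sigma> g + char \<tau> g"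
  unfolding char_def dsum_def by (rule mtrace_four_block) (use assms rep_carrier in auto)

lemma dsum_iso:
  assumes r: "is_rep G \<sigma>" "is_rep G \<tau>" "is_rep G \<sigma>'" "is_rep G \<tau>'"
    and "rep_iso G \<sigma> \<sigma>'" "rep_iso G \<tau> \<tau>'"
  shows "rep_iso G (dsum \<sigma> \<tau>) (dsum \<sigma>' \<tau>')"
proof -
  let ?n = "rep_dim G \<sigma>" and ?m = "rep_dim G \<tau>"
  from rep_isoE[OF assms(5)] obtain P Q where PQ: "rep_dim G \<sigma>' = ?n"
    "P \<in> carrier_mat ?n ?n" "Q \<in> carrier_mat ?n ?n" "P * Q = 1\<^sub>m ?n" "Q * P = 1\<^sub>m ?n"
    "\<And>g. g \<in> carrier G \<Longrightarrow> P * \<sigma> g = \<sigma>' g * P" by metis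
  from rep_isoE[OF assms(6)] obtain R S where RS: "rep_dim G \<tau>' = ?m"
    "R \<in> carrier_mat ?m ?m" "S \<in> carrier_mat ?m ?m" "R * S = 1\<^sub>m ?m" "S * R = 1\<^sub>m ?m"
    "\<And>g. g \<in> carrier G \<Longrightarrow> R * \<tau> g = \<tau>' g * R" by metis
  have m: "four_block_mat A (0\<^sub>m ?n ?m) (0\<^sub>m ?m ?n) B * four_block_mat C (0\<^sub>m ?n ?m) (0\<^sub>m ?m ?n) D =
    four_block_mat (A * C) (0\<^sub>m ?n ?m) (0\<^sub>m ?m ?n) (B * D)"
    if "A \<in> carrier_mat ?n ?n" "B \<in> carrier_mat ?m ?m" "C \<in> carrier_mat ?n ?n" "D \<in> carrier_mat ?m ?m" for A B C D :: "complex mat"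
    using that by (subst mult_four_block_mat[of _ ?n ?n _ ?m _ ?m _ _ ?n _ ?m]) auto
  let ?P = "four_block_mat P (0\<^sub>m ?n ?m) (0\<^sub>m ?m ?n) R" and ?Q = "four_block_mat Q (0\<^sub>m ?n ?m) (0\<^sub>m ?m ?n) S"
  show ?thesis
  proof (rule rep_isoI[OF dsum_rep(1)[OF r(1,2)], of ?P ?Q], unfold dsum_rep(2)[OF r(1,2)] dsum_rep(2)[OF r(3,4)])
    show "?P * ?Q = 1\<^sub>m (?n + ?m)" "?Q * ?P = 1\<^sub>m (?n + ?m)"
      using PQ RS by (simp_all add: m)
    fix g assume g: "g \<in> carrier G"
    note c = rep_carrier[OF r(1) g] rep_carrier[OF r(2) g] rep_carrier[OF r(3) g, unfolded PQ(1)] rep_carrier[OF r(4) g, unfolded RS(1)]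
    show "?P * dsum \<sigma> \<tau> g = dsum \<sigma>' \<tau>' g * ?P"
      unfolding dsum_def PQ(1) RS(1) m[OF PQ(2) RS(2) c(1,2)] m[OF c(3,4) PQ(2) RS(2)] PQ(6)[OF g] RS(6)[OF g] ..
  qed (use PQ RS in auto)
qed

text \<open>With factorizations of \<open>E\<close> and of \<open>1 - E\<close>, stacking the two
  coordinate maps and juxtaposing the two bases gives mutually inverse changes of basis. The last
  two conclusions ensure that both parts are proper when \<open>E\<close> is neither 0 nor
  1.\<close>

lemma split_by_idempotent:
  assumes \<pi>: "is_rep G \<pi>" and E: "E \<in> carrier_mat (rep_dim G \<pi>) (rep_dim G \<pi>)" and EE: "E * E = E"
    and comm: "\<And>g. g \<in> carrier G \<Longrightarrow> \<pi> g * E = E * \<pi> g"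
  obtains \<sigma> \<tau> where "is_rep G \<sigma>" "is_rep G \<tau>" "rep_dim G \<sigma> + rep_dim G \<tau> = rep_dim G \<pi>"
    "rep_iso G \<pi> (dsum \<sigma> \<tau>)" "rep_dim G \<sigma> = 0 \<Longrightarrow> E = 0\<^sub>m (rep_dim G \<pi>) (rep_dim G \<pi>)"
    "rep_dim G \<tau> = 0 \<Longrightarrow> E = 1\<^sub>m (rep_dim G \<pi>)"
proof -
  let ?n = "rep_dim G \<pi>"
  define F where "F = 1\<^sub>m ?n - E"
  have F: "F \<in> carrier_mat ?n ?n" unfolding F_def using E by (intro carrier_matI) auto
  have EF: "E * F = 0\<^sub>m ?n ?n" and FE: "F * E = 0\<^sub>m ?n ?n"
    unfolding F_def using E EE
    by (simp_all add: mult_minus_distrib_mat[OF E one_carrier_mat E] minus_mult_distrib_mat[OF one_carrier_mat E E] minus_r_inv_mat[OF E])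
  have FF: "F * F = F"
  proof -
    have "F * F = (1\<^sub>m ?n - E) * F" by (simp add: F_def)
    also have "\<dots> = F - E * F" using F E by (simp add: minus_mult_distrib_mat[OF one_carrier_mat E F])
    also have "\<dots> = F" unfolding EF using F by (intro eq_matI) auto
    finally show ?thesis .
  qed
  have sum: "E + F = 1\<^sub>m ?n" unfolding F_def using E by (intro eq_matI) auto
  have commF: "\<pi> g * F = F * \<pi> g" if g: "g \<in> carrier G" for g
  proof -
    note p = rep_carrier[OF \<pi> g]
    show ?thesis unfolding F_def using p E comm[OF g]
      by (simp add: mult_minus_distrib_mat[OF p one_carrier_mat E] minus_mult_distrib_mat[OF one_carrier_mat E p])
  qed
  obtain k L B where L: "L \<in> carrier_mat k ?n" and B: "B \<in> carrier_mat ?n k" and LB: "L * B = 1\<^sub>m k" and BL: "B * L = E"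
    using idempotent_factor[OF E EE] by metis
  obtain m M C where M: "M \<in> carrier_mat m ?n" and C: "C \<in> carrier_mat ?n m" and MC: "M * C = 1\<^sub>m m" and CM: "C * M = F"
    using idempotent_factor[OF F FF] by metis
  note d = carrier_matD[OF L] carrier_matD[OF B] carrier_matD[OF M] carrier_matD[OF C]
  have LE: "L * E = L"
  proof -
    have "L * E = (L * B) * L" unfolding BL[symmetric] by (simp add: mult_mat_assoc_dim d)
    then show ?thesis unfolding LB using L by simp
  qed
  have MF: "M * F = M"
  proof -
    have "M * F = (M * C) * M" unfolding CM[symmetric] by (simp add: mult_mat_assoc_dim d)
    then show ?thesis unfolding MC using M by simp
  qed
  have FC: "F * C = C"
  proof -
    have "F * C = C * (M * C)" unfolding CM[symmetric] by (simp add: mult_mat_assoc_dim d)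
    then show ?thesis unfolding MC using C by simp
  qed
  have EB: "E * B = B"
  proof -
    have "E * B = B * (L * B)" unfolding BL[symmetric] by (simp add: mult_mat_assoc_dim d)
    then show ?thesis unfolding LB using B by simp
  qed
  have LC: "L * C = 0\<^sub>m k m"
  proof -
    have "L * C = L * E * (F * C)" unfolding LE FC ..
    also have "\<dots> = L * ((E * F) * C)" using carrier_matD[OF E] carrier_matD[OF F] by (simp add: mult_mat_assoc_dim d)
    finally show ?thesis unfolding EF using L C by simp
  qed
  have MB: "M * B = 0\<^sub>m m k"
  proof -
    have "M * B = M * F * (E * B)" unfolding MF EB ..
    also have "\<dots> = M * ((F * E) * B)" using carrier_matD[OF E] carrier_matD[OF F] by (simp add: mult_mat_assoc_dim d)
    finally show ?thesis unfolding FE using M B by simp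
  qed
  \<comment> \<open>The empty blocks make \<open>P\<close> the matrix \<open>L\<close> above
    \<open>M\<close> and \<open>Q\<close> the matrix \<open>B\<close> beside \<open>C\<close>, so
    that block multiplication applies.\<close>
  define P where "P = four_block_mat L (0\<^sub>m k 0) M (0\<^sub>m m 0)"
  define Q where "Q = four_block_mat B C (0\<^sub>m 0 k) (0\<^sub>m 0 m)"
  have P: "P \<in> carrier_mat (k + m) ?n" using L M by (intro carrier_matI) (auto simp: P_def)
  have Q: "Q \<in> carrier_mat ?n (k + m)" using B C by (intro carrier_matI) (auto simp: Q_def)
  have PQ: "P * Q = 1\<^sub>m (k + m)"
    unfolding P_def Q_def using L M B C LB MC LC MB
    by (subst mult_four_block_mat[of _ k ?n _ 0 _ m _ _ k _ m]) auto
  have QP: "Q * P = 1\<^sub>m ?n"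
  proof -
    have "Q * P = four_block_mat (E + F) (0\<^sub>m ?n 0) (0\<^sub>m 0 ?n) (0\<^sub>m 0 0)"
      unfolding P_def Q_def using L M B C BL CM
      by (subst mult_four_block_mat[of _ ?n k _ m _ 0 _ _ ?n _ 0]) (auto intro!: eq_matI)
    then show ?thesis using sum four_block_pad[of "1\<^sub>m ?n" ?n ?n] by simp
  qed
  have km: "k + m = ?n" by (rule two_sided_inverse_square[OF P Q PQ QP])
  define \<sigma> where "\<sigma> = (\<lambda>g. L * \<pi> g * B)"
  define \<tau> where "\<tau> = (\<lambda>g. M * \<pi> g * C)"
  have \<sigma>: "is_rep G \<sigma>" "rep_dim G \<sigma> = k"
    unfolding \<sigma>_def using compress_rep[OF \<pi> L B LB] comm BL by auto
  have \<tau>: "is_rep G \<tau>" "rep_dim G \<tau> = m"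
    unfolding \<tau>_def using compress_rep[OF \<pi> M C MC] commF CM by auto
  show ?thesis
  proof
    show "rep_iso G \<pi> (dsum \<sigma> \<tau>)"
    proof (rule rep_isoI[OF \<pi>, of P Q])
      fix g assume g: "g \<in> carrier G"
      note p = rep_carrier[OF \<pi> g]
      note sc = rep_carrier[OF \<sigma>(1) g, unfolded \<sigma>(2)] and tc = rep_carrier[OF \<tau>(1) g, unfolded \<tau>(2)]
      have "\<sigma> g * L = L * (\<pi> g * (B * L))"
        unfolding \<sigma>_def using carrier_matD[OF p] by (simp add: mult_mat_assoc_dim d)
      also have "\<dots> = (L * E) * \<pi> g"
        unfolding BL comm[OF g] using carrier_matD[OF p] carrier_matD[OF E] by (simp add: mult_mat_assoc_dim d)
      finally have 1: "\<sigma> g * L = L * \<pi> g" unfolding LE .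
      have "\<tau> g * M = M * (\<pi> g * (C * M))"
        unfolding \<tau>_def using carrier_matD[OF p] by (simp add: mult_mat_assoc_dim d)
      also have "\<dots> = (M * F) * \<pi> g"
        unfolding CM commF[OF g] using carrier_matD[OF p] carrier_matD[OF F] by (simp add: mult_mat_assoc_dim d)
      finally have 2: "\<tau> g * M = M * \<pi> g" unfolding MF .
      have "P * \<pi> g = P * four_block_mat (\<pi> g) (0\<^sub>m ?n 0) (0\<^sub>m 0 ?n) (0\<^sub>m 0 0)"
        using four_block_pad[OF p] by simp
      also have "\<dots> = four_block_mat (L * \<pi> g) (0\<^sub>m k 0) (M * \<pi> g) (0\<^sub>m m 0)"
        unfolding P_def using L M p
        by (subst mult_four_block_mat[of _ k ?n _ 0 _ m _ _ ?n _ 0]) auto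
      also have "\<dots> = four_block_mat (\<sigma> g) (0\<^sub>m k m) (0\<^sub>m m k) (\<tau> g) * P"
        unfolding P_def using L M sc tc p 1 2
        by (subst mult_four_block_mat[of _ k k _ m _ m _ _ ?n _ 0]) auto
      finally show "P * \<pi> g = dsum \<sigma> \<tau> g * P" unfolding dsum_def \<sigma>(2) \<tau>(2) .
    qed (use P Q PQ QP km dsum_rep(2)[OF \<sigma>(1) \<tau>(1)] \<sigma>(2) \<tau>(2) in auto)
    show "is_rep G \<sigma>" "is_rep G \<tau>" "rep_dim G \<sigma> + rep_dim G \<tau> = ?n" using \<sigma> \<tau> km by auto
    show "E = 0\<^sub>m ?n ?n" if "rep_dim G \<sigma> = 0"
      unfolding BL[symmetric] using that \<sigma>(2) L B by (intro eq_matI) (auto simp: scalar_prod_def)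
    have "F = 0\<^sub>m ?n ?n" if "rep_dim G \<tau> = 0"
      unfolding CM[symmetric] using that \<tau>(2) M C by (intro eq_matI) (auto simp: scalar_prod_def)
    then show "E = 1\<^sub>m ?n" if "rep_dim G \<tau> = 0" using sum E that by simp
  qed
qed

text \<open>Maschke's averaging: any projection onto an invariant subspace averages to an equivariant one.\<close>

lemma invariant_subspace_split:
  assumes \<pi>: "is_rep G \<pi>" and W: "vec_subspace (rep_dim G \<pi>) W"
    and inv: "\<And>g w. g \<in> carrier G \<Longrightarrow> w \<in> W \<Longrightarrow> \<pi> g *\<^sub>v w \<in> W"
    and W0: "W \<noteq> {0\<^sub>v (rep_dim G \<pi>)}" and W1: "W \<noteq> carrier_vec (rep_dim G \<pi>)"
  obtains \<sigma> \<tau> where "is_rep G \<sigma>" "is_rep G \<tau>" "rep_dim G \<sigma> < rep_dim G \<pi>" "rep_dim G \<tau> < rep_dim G \<pi>"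
    "rep_iso G \<pi> (dsum \<sigma> \<tau>)"
proof -
  let ?n = "rep_dim G \<pi>"
  obtain k L B where L: "L \<in> carrier_mat k ?n" and B: "B \<in> carrier_mat ?n k" and LB: "L * B = 1\<^sub>m k"
    and WB: "W = (\<lambda>v. B *\<^sub>v v) ` carrier_vec k"
    using basis_matrix[OF W] by metis
  \<comment> \<open>\<open>B * L\<close> is the identity on \<open>W\<close>, and \<pi>(g) maps the
    columns of \<open>B\<close> into \<open>W\<close>.\<close>
  have pB: "B * (L * (\<pi> g * B)) = \<pi> g * B" if g: "g \<in> carrier G" for g
  proof (rule mat_eqI_vec)
    note p = rep_carrier[OF \<pi> g]
    fix v :: "complex Matrix.vec" assume v: "v \<in> carrier_vec k"
    have "\<pi> g *\<^sub>v (B *\<^sub>v v) \<in> W" using inv[OF g] WB v by blast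
    then obtain u where u: "u \<in> carrier_vec k" "\<pi> g *\<^sub>v (B *\<^sub>v v) = B *\<^sub>v u" using WB by blast
    have "B * (L * (\<pi> g * B)) *\<^sub>v v = B *\<^sub>v (L *\<^sub>v (\<pi> g *\<^sub>v (B *\<^sub>v v)))"
      using p B L v by (simp add: mult_mat_vec_assoc_dim)
    also have "\<dots> = B *\<^sub>v ((L * B) *\<^sub>v u)" unfolding u(2) using assoc_mult_mat_vec[OF L B u(1)] by simp
    finally show "B * (L * (\<pi> g * B)) *\<^sub>v v = \<pi> g * B *\<^sub>v v" unfolding LB using u p B v by simp
  qed (use rep_carrier[OF \<pi> g] L B in auto)
  note d = carrier_matD[OF L] carrier_matD[OF B] rep_dims[OF \<pi>]
  have BLc: "B * L \<in> carrier_mat ?n ?n" using L B by simp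
  let ?N = "of_nat (card (carrier G)) :: complex"
  define A where "A = average \<pi> \<pi> (B * L)"
  have A: "A \<in> carrier_mat ?n ?n" unfolding A_def by (rule average_carrier)
  have N: "?N \<noteq> 0" using card_pos by simp
  have tm: "\<pi> g * (B * L) * \<pi> (inv g) \<in> carrier_mat ?n ?n" if "g \<in> carrier G" for g
    using that by (intro carrier_matI) (simp_all add: d)
  have AB: "A * B = ?N \<cdot>\<^sub>m B"
  proof -
    have "A * B = sum_mat ?n k (\<lambda>g. \<pi> g * (B * L) * \<pi> (inv g) * B) (carrier G)"
      unfolding A_def average_def by (rule sum_mat_mult[OF B tm])
    also have "\<dots> = sum_mat ?n k (\<lambda>g. B) (carrier G)"
    proof (rule sum_mat_cong)
      fix g assume g: "g \<in> carrier G"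
      have "\<pi> g * (B * L) * \<pi> (inv g) * B = \<pi> g * (B * (L * (\<pi> (inv g) * B)))"
        using g by (simp add: mult_mat_assoc_dim d)
      also have "\<dots> = \<pi> g * (\<pi> (inv g) * B)" using pB[OF inv_closed[OF g]] by simp
      also have "\<dots> = (\<pi> g * \<pi> (inv g)) * B" using g by (simp add: mult_mat_assoc_dim d)
      also have "\<pi> g * \<pi> (inv g) = 1\<^sub>m ?n" using rep_inv[OF \<pi> inv_closed[OF g]] g by simp
      finally show "\<pi> g * (B * L) * \<pi> (inv g) * B = B" using B by simp
    qed
    also have "\<dots> = ?N \<cdot>\<^sub>m B" using B by (intro eq_matI) (auto simp: sum_mat_def)
    finally show ?thesis .
  qed
  have BLA: "B * L * A = A"
  proof -
    have "B * L * A = sum_mat ?n ?n (\<lambda>g. B * L * (\<pi> g * (B * L) * \<pi> (inv g))) (carrier G)"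
      unfolding A_def average_def by (rule mult_sum_mat[OF BLc tm])
    also have "\<dots> = A" unfolding A_def average_def
    proof (rule sum_mat_cong)
      fix g assume g: "g \<in> carrier G"
      have "B * L * (\<pi> g * (B * L) * \<pi> (inv g)) = (B * (L * (\<pi> g * B))) * (L * \<pi> (inv g))"
        using g by (simp add: mult_mat_assoc_dim d)
      also have "\<dots> = \<pi> g * B * (L * \<pi> (inv g))" unfolding pB[OF g] ..
      also have "\<dots> = \<pi> g * (B * L) * \<pi> (inv g)" using g by (simp add: mult_mat_assoc_dim d)
      finally show "B * L * (\<pi> g * (B * L) * \<pi> (inv g)) = \<pi> g * (B * L) * \<pi> (inv g)" .
    qed
    finally show ?thesis .
  qed
  \<comment> \<open>The averaged projection. \<open>E * B = B\<close> says that it fixes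
    \<open>W\<close> pointwise and \<open>B * (L * E) = E\<close> that it maps into
    \<open>W\<close>; together they make it idempotent.\<close>
  define E where "E = (1 / ?N) \<cdot>\<^sub>m A"
  have E: "E \<in> carrier_mat ?n ?n" using A by (simp add: E_def)
  have EB: "E * B = B"
  proof -
    have "E * B = (1 / ?N) \<cdot>\<^sub>m (?N \<cdot>\<^sub>m B)"
      unfolding E_def AB[symmetric] by (rule mult_smult_assoc_mat[OF A B])
    then show ?thesis using N by (auto intro!: eq_matI)
  qed
  have BLE: "B * (L * E) = E"
  proof -
    have "B * (L * E) = B * L * E" using carrier_matD[OF E] by (simp add: mult_mat_assoc_dim d)
    also have "\<dots> = (1 / ?N) \<cdot>\<^sub>m (B * L * A)" unfolding E_def by (rule mult_smult_distrib[OF BLc A])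
    finally show ?thesis unfolding BLA E_def .
  qed
  have EE: "E * E = E"
  proof -
    have "E * E = E * (B * (L * E))" unfolding BLE ..
    also have "\<dots> = (E * B) * (L * E)" using carrier_matD[OF E] by (simp add: mult_mat_assoc_dim d)
    also have "\<dots> = E" unfolding EB BLE ..
    finally show ?thesis .
  qed
  have comm: "\<pi> g * E = E * \<pi> g" if g: "g \<in> carrier G" for g
    unfolding E_def mult_smult_distrib[OF rep_carrier[OF \<pi> g] A] mult_smult_assoc_mat[OF A rep_carrier[OF \<pi> g]]
    using average_intertwines[OF \<pi> \<pi> g BLc] by (simp add: A_def)
  have E0: "E \<noteq> 0\<^sub>m ?n ?n"
  proof
    assume "E = 0\<^sub>m ?n ?n"
    then have "B = 0\<^sub>m ?n k" using EB B by simp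
    then have "B *\<^sub>v v = 0\<^sub>v ?n" if "v \<in> carrier_vec k" for v using that by auto
    then have "W \<subseteq> {0\<^sub>v ?n}" using WB by auto
    then show False using W W0 by (auto simp: vec_subspace_def)
  qed
  have E1: "E \<noteq> 1\<^sub>m ?n"
  proof
    assume e: "E = 1\<^sub>m ?n"
    have "v \<in> W" if v: "v \<in> carrier_vec ?n" for v
    proof -
      have "B *\<^sub>v (L *\<^sub>v v) = (B * L) *\<^sub>v v" by (rule assoc_mult_mat_vec[OF B L v, symmetric])
      also have "B * L = 1\<^sub>m ?n" using BLE L unfolding e by simp
      finally have "v = B *\<^sub>v (L *\<^sub>v v)" using v by simp
      then show ?thesis using WB L v by (metis imageI mult_mat_vec_carrier)
    qed
    then show False using W W1 by (auto simp: vec_subspace_def)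
  qed
  obtain \<sigma> \<tau> where st: "is_rep G \<sigma>" "is_rep G \<tau>" "rep_dim G \<sigma> + rep_dim G \<tau> = ?n"
    "rep_iso G \<pi> (dsum \<sigma> \<tau>)" "rep_dim G \<sigma> = 0 \<Longrightarrow> E = 0\<^sub>m ?n ?n" "rep_dim G \<tau> = 0 \<Longrightarrow> E = 1\<^sub>m ?n"
    using split_by_idempotent[OF \<pi> E EE comm] by metis
  have "rep_dim G \<sigma> > 0" "rep_dim G \<tau> > 0" using st(5,6) E0 E1 by auto
  then show ?thesis using that[OF st(1,2) _ _ st(4)] st(3) by linarith
qed

end

section \<open>Tensor products and direct sums\<close>

lemma sum_div_mod:
  fixes f :: "nat \<Rightarrow> nat \<Rightarrow> 'b :: comm_monoid_add"
  shows "(\<Sum>k = 0..<n * m. f (k div m) (k mod m)) = (\<Sum>a = 0..<n. \<Sum>b = 0..<m. f a b)"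
proof (cases "m = 0")
  case False
  have lt: "a * m + b < n * m" if "a < n" "b < m" for a b
  proof -
    have "a * m + b < Suc a * m" using that by simp
    also have "\<dots> \<le> n * m" using that by (intro mult_le_mono1) simp
    finally show ?thesis .
  qed
  have "(\<Sum>k = 0..<n * m. f (k div m) (k mod m)) = (\<Sum>(a, b)\<in>{0..<n} \<times> {0..<m}. f a b)"
    by (rule sum.reindex_bij_witness[of _ "\<lambda>(a, b). a * m + b" "\<lambda>k. (k div m, k mod m)"])
      (use False lt in \<open>auto simp: less_mult_imp_div_less\<close>)
  then show ?thesis by (simp add: sum.cartesian_product)
qed auto

lemma kronecker_index:
  "A \<in> carrier_mat n n \<Longrightarrow> B \<in> carrier_mat m m \<Longrightarrow> i < n * m \<Longrightarrow> j < n * m \<Longrightarrow>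
    kronecker A B $$ (i, j) = A $$ (i div m, j div m) * B $$ (i mod m, j mod m)"
  by (auto simp: kronecker_def)

lemma kronecker_carrier:
  "A \<in> carrier_mat n n \<Longrightarrow> B \<in> carrier_mat m m \<Longrightarrow> kronecker A B \<in> carrier_mat (n * m) (n * m)"
  by (auto simp: kronecker_def)

lemma kronecker_mult:
  assumes A: "A \<in> carrier_mat n n" "B \<in> carrier_mat n n" and C: "C \<in> carrier_mat m m" "D \<in> carrier_mat m m"
  shows "kronecker (A * B) (C * D) = kronecker A C * kronecker B D"
proof (rule eq_matI)
  note k1 = kronecker_carrier[OF A(1) C(1)] and k2 = kronecker_carrier[OF A(2) C(2)]
  fix i j assume "i < dim_row (kronecker A C * kronecker B D)" "j < dim_col (kronecker A C * kronecker B D)"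
  then have ij: "i < n * m" "j < n * m" using k1 k2 by auto
  then have "m > 0" by (cases m) auto
  with ij have d: "i div m < n" "j div m < n" and mm: "i mod m < m" "j mod m < m"
    using less_mult_imp_div_less by auto
  have "(kronecker A C * kronecker B D) $$ (i, j) = (\<Sum>k = 0..<n * m.
      (A $$ (i div m, k div m) * B $$ (k div m, j div m)) * (C $$ (i mod m, k mod m) * D $$ (k mod m, j mod m)))"
    unfolding mult_mat_index[OF k1 k2 ij] using ij
    by (intro sum.cong refl) (simp add: kronecker_index[OF A(1) C(1)] kronecker_index[OF A(2) C(2)] mult_ac)
  also have "\<dots> = (A * B) $$ (i div m, j div m) * (C * D) $$ (i mod m, j mod m)"
    unfolding sum_div_mod[where f = "\<lambda>a b. (A $$ (i div m, a) * B $$ (a, j div m)) * (C $$ (i mod m, b) * D $$ (b, j mod m))"]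
      mult_mat_index[OF A d] mult_mat_index[OF C mm] by (simp add: sum_product)
  finally show "kronecker (A * B) (C * D) $$ (i, j) = (kronecker A C * kronecker B D) $$ (i, j)"
    using kronecker_index[OF mult_carrier_mat[OF A] mult_carrier_mat[OF C] ij] by simp
qed (use A C in \<open>auto simp: kronecker_def\<close>)

lemma kronecker_one: "kronecker (1\<^sub>m n) (1\<^sub>m m) = 1\<^sub>m (n * m)"
proof (rule eq_matI)
  fix i j assume "i < dim_row (1\<^sub>m (n * m) :: complex mat)" "j < dim_col (1\<^sub>m (n * m) :: complex mat)"
  then have ij: "i < n * m" "j < n * m" by auto
  then have "m > 0" by (cases m) auto
  with ij have d: "i div m < n" "j div m < n" and mm: "i mod m < m" "j mod m < m"
    using less_mult_imp_div_less by auto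
  have "i = j \<longleftrightarrow> i div m = j div m \<and> i mod m = j mod m" by (metis div_mult_mod_eq)
  then show "kronecker (1\<^sub>m n) (1\<^sub>m m) $$ (i, j) = (1\<^sub>m (n * m)) $$ (i, j)"
    using d mm ij by (simp add: kronecker_index[OF one_carrier_mat one_carrier_mat ij])
qed (auto simp: kronecker_def)

lemma mtrace_kronecker:
  assumes A: "A \<in> carrier_mat n n" and B: "B \<in> carrier_mat m m"
  shows "mtrace (kronecker A B) = mtrace A * mtrace B"
proof -
  have "mtrace (kronecker A B) = (\<Sum>k = 0..<n * m. A $$ (k div m, k div m) * B $$ (k mod m, k mod m))"
    using kronecker_carrier[OF A B] by (simp add: mtrace_def kronecker_index[OF A B])
  also have "\<dots> = mtrace A * mtrace B"
    unfolding sum_div_mod[where f = "\<lambda>a b. A $$ (a, a) * B $$ (b, b)"] using A B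
    by (simp add: mtrace_def sum_product)
  finally show ?thesis .
qed

context finite_grp
begin

lemma rep_tensor_rep:
  assumes \<sigma>: "is_rep G \<sigma>" and \<tau>: "is_rep G \<tau>"
  shows "is_rep G (rep_tensor \<sigma> \<tau>)"
proof (rule is_repI)
  show "rep_tensor \<sigma> \<tau> \<one> = 1\<^sub>m (rep_dim G \<sigma> * rep_dim G \<tau>)"
    by (simp add: rep_tensor_def rep_one[OF \<sigma>] rep_one[OF \<tau>] kronecker_one)
qed (auto simp: rep_tensor_def rep_hom[OF \<sigma>] rep_hom[OF \<tau>]
    intro!: kronecker_carrier kronecker_mult rep_carrier[OF \<sigma>] rep_carrier[OF \<tau>])

lemma char_tensor:
  "is_rep G \<sigma> \<Longrightarrow> is_rep G \<tau> \<Longrightarrow> g \<in> carrier G \<Longrightarrow> char (rep_tensor \<sigma> \<tau>) g = char \<sigma> g * char \<tau> g"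
  unfolding char_def rep_tensor_def using mtrace_kronecker[OF rep_carrier rep_carrier] by blast

text \<open>Values outside the group are arbitrary, so representations are compared on the carrier
  only. In particular \<open>rep_sum\<close> and \<open>dsum\<close> are matched there, where the
  dimension of a value is the dimension of the representation.\<close>

lemma is_rep_cong:
  assumes "\<And>g. g \<in> carrier G \<Longrightarrow> \<sigma> g = \<tau> g" "is_rep G \<tau>"
  shows "is_rep G \<sigma>" "rep_dim G \<sigma> = rep_dim G \<tau>"
proof -
  show d: "rep_dim G \<sigma> = rep_dim G \<tau>" using assms(1)[OF one_closed] by (simp add: rep_dim_def)
  show "is_rep G \<sigma>" using assms unfolding is_rep_def d by simp
qed

lemma rep_iso_cong:
  assumes "\<And>g. g \<in> carrier G \<Longrightarrow> \<tau> g = \<tau>' g" "rep_iso G \<sigma> \<tau>'"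
  shows "rep_iso G \<sigma> \<tau>"
proof -
  have d: "rep_dim G \<tau> = rep_dim G \<tau>'" using assms(1)[OF one_closed] by (simp add: rep_dim_def)
  obtain P where "P \<in> carrier_mat (rep_dim G \<sigma>) (rep_dim G \<sigma>)" "invertible_mat P"
    "\<forall>g\<in>carrier G. P * \<sigma> g = \<tau>' g * P" "rep_dim G \<sigma> = rep_dim G \<tau>'"
    using assms(2) unfolding rep_iso_def by blast
  then show ?thesis using assms(1) d unfolding rep_iso_def by (intro conjI bexI[of _ P]) auto
qed

lemma rep_sum_rep:
  "\<forall>\<tau>\<in>set \<tau>s. is_rep G \<tau> \<Longrightarrow> is_rep G (rep_sum \<tau>s)"
  "\<forall>\<tau>\<in>set \<tau>s. is_rep G \<tau> \<Longrightarrow> g \<in> carrier G \<Longrightarrow> char (rep_sum \<tau>s) g = (\<Sum>\<tau>\<leftarrow>\<tau>s. char \<tau> g)"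
proof -
  have "(\<forall>\<tau>\<in>set \<tau>s. is_rep G \<tau>) \<longrightarrow>
    is_rep G (rep_sum \<tau>s) \<and> (\<forall>g\<in>carrier G. char (rep_sum \<tau>s) g = (\<Sum>\<tau>\<leftarrow>\<tau>s. char \<tau> g))"
  proof (induction \<tau>s)
    case Nil
    have "is_rep G (rep_sum [])"
      by (rule is_repI[of _ 0]) (auto simp: rep_sum_def intro!: eq_matI)
    then show ?case by (auto simp: char_def rep_sum_def mtrace_def)
  next
    case (Cons \<tau> \<tau>s)
    show ?case
    proof (intro impI)
      assume "\<forall>\<tau>\<in>set (\<tau> # \<tau>s). is_rep G \<tau>"
      then have \<tau>: "is_rep G \<tau>" and S: "is_rep G (rep_sum \<tau>s)"
        and ch: "\<And>g. g \<in> carrier G \<Longrightarrow> char (rep_sum \<tau>s) g = (\<Sum>\<tau>\<leftarrow>\<tau>s. char \<tau> g)"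
        using Cons by auto
      have e: "rep_sum (\<tau> # \<tau>s) g = dsum \<tau> (rep_sum \<tau>s) g" if "g \<in> carrier G" for g
        using rep_dims[OF \<tau> that] rep_dims[OF S that]
        by (simp add: rep_sum_def dsum_def Let_def)
      have "is_rep G (rep_sum (\<tau> # \<tau>s))" by (rule is_rep_cong[OF e dsum_rep(1)[OF \<tau> S]])
      moreover have "char (rep_sum (\<tau> # \<tau>s)) g = (\<Sum>\<tau>\<leftarrow>\<tau> # \<tau>s. char \<tau> g)" if "g \<in> carrier G" for g
        using char_dsum[OF \<tau> S that] ch[OF that] e[OF that] by (simp add: char_def)
      ultimately show "is_rep G (rep_sum (\<tau> # \<tau>s)) \<and>
        (\<forall>g\<in>carrier G. char (rep_sum (\<tau> # \<tau>s)) g = (\<Sum>\<tau>\<leftarrow>\<tau> # \<tau>s. char \<tau> g))" by blast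
    qed
  qed
  then show "\<forall>\<tau>\<in>set \<tau>s. is_rep G \<tau> \<Longrightarrow> is_rep G (rep_sum \<tau>s)"
    "\<forall>\<tau>\<in>set \<tau>s. is_rep G \<tau> \<Longrightarrow> g \<in> carrier G \<Longrightarrow> char (rep_sum \<tau>s) g = (\<Sum>\<tau>\<leftarrow>\<tau>s. char \<tau> g)"
    by auto
qed

lemma rep_sum_append:
  assumes "\<forall>\<tau>\<in>set l1. is_rep G \<tau>" "\<forall>\<tau>\<in>set l2. is_rep G \<tau>" and g: "g \<in> carrier G"
  shows "rep_sum (l1 @ l2) g = dsum (rep_sum l1) (rep_sum l2) g"
proof -
  note r = rep_sum_rep(1)[OF assms(1)] rep_sum_rep(1)[OF assms(2)]
  have "rep_sum (l1 @ l2) g = four_block_mat (rep_sum l1 g)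
    (0\<^sub>m (dim_row (rep_sum l1 g)) (dim_col (rep_sum l2 g))) (0\<^sub>m (dim_row (rep_sum l2 g)) (dim_col (rep_sum l1 g)))
    (rep_sum l2 g)"
    by (simp add: rep_sum_def diag_block_mat_append Let_def)
  then show ?thesis by (simp add: dsum_def rep_dims[OF r(1) g] rep_dims[OF r(2) g])
qed

text \<open>Strong induction on the dimension: a reducible representation splits into two of smaller
  dimension. Dimension 0 is the empty sum, since irreducibility demands positive dimension.\<close>

theorem complete_reducibility:
  assumes "is_rep G \<pi>"
  shows "\<exists>\<tau>s. (\<forall>\<tau>\<in>set \<tau>s. irreducible_rep G \<tau>) \<and> rep_iso G \<pi> (rep_sum \<tau>s)"
  using assms
proof (induction "rep_dim G \<pi>" arbitrary: \<pi> rule: less_induct)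
  case less
  note \<pi> = less.prems
  let ?n = "rep_dim G \<pi>"
  show ?case
  proof (cases "?n = 0")
    case True
    have "rep_iso G \<pi> (rep_sum [])"
    proof (rule rep_isoI[OF \<pi>, of "1\<^sub>m 0" "1\<^sub>m 0"])
      show "rep_dim G (rep_sum []) = ?n" using True by (simp add: rep_dim_def rep_sum_def)
      fix g assume g: "g \<in> carrier G"
      show "1\<^sub>m 0 * \<pi> g = rep_sum [] g * 1\<^sub>m 0"
        using rep_carrier[OF \<pi> g] True by (intro eq_matI) (auto simp: rep_sum_def)
    qed (use True in auto)
    then show ?thesis by (intro exI[of _ "[]"]) auto
  next
    case n0: False
    show ?thesis
    proof (cases "irreducible_rep G \<pi>")
      case True
      have "rep_iso G \<pi> (rep_sum [\<pi>])"
        by (rule rep_iso_cong[OF _ rep_iso_refl[OF \<pi>]]) (simp add: rep_sum_def del: diag_block_mat.simps)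
      then show ?thesis using True by (intro exI[of _ "[\<pi>]"]) auto
    next
      case False
      then obtain W where W: "vec_subspace ?n W" "\<And>g w. g \<in> carrier G \<Longrightarrow> w \<in> W \<Longrightarrow> \<pi> g *\<^sub>v w \<in> W"
        "W \<noteq> {0\<^sub>v ?n}" "W \<noteq> carrier_vec ?n"
        using n0 \<pi> unfolding irreducible_rep_def vec_subspace_iff by blast
      obtain \<sigma> \<tau> where st: "is_rep G \<sigma>" "is_rep G \<tau>" "rep_dim G \<sigma> < ?n" "rep_dim G \<tau> < ?n"
        "rep_iso G \<pi> (dsum \<sigma> \<tau>)"
        using invariant_subspace_split[OF \<pi> W] by metis
      obtain l1 l2 where l: "\<forall>\<tau>\<in>set l1. irreducible_rep G \<tau>" "rep_iso G \<sigma> (rep_sum l1)"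
        "\<forall>\<tau>\<in>set l2. irreducible_rep G \<tau>" "rep_iso G \<tau> (rep_sum l2)"
        using less.hyps[OF st(3,1)] less.hyps[OF st(4,2)] by blast
      have r: "\<forall>\<tau>\<in>set l1. is_rep G \<tau>" "\<forall>\<tau>\<in>set l2. is_rep G \<tau>"
        using l irreducible_repD(1) by blast+
      note R = rep_sum_rep(1)[OF r(1)] rep_sum_rep(1)[OF r(2)]
      have "rep_iso G \<pi> (dsum (rep_sum l1) (rep_sum l2))"
        by (rule rep_iso_trans[OF \<pi> dsum_rep(1)[OF st(1,2)] dsum_rep(1)[OF R] st(5) dsum_iso[OF st(1,2) R l(2,4)]])
      from rep_iso_cong[OF rep_sum_append[OF r] this] have "rep_iso G \<pi> (rep_sum (l1 @ l2))" .
      then show ?thesis using l by (intro exI[of _ "l1 @ l2"]) auto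
    qed
  qed
qed

section \<open>Multiplicities, irreducible classes and expansion of characters\<close>

lemma form_sum_list: "form \<phi> (\<lambda>g. \<Sum>\<tau>\<leftarrow>\<tau>s. f \<tau> g) = (\<Sum>\<tau>\<leftarrow>\<tau>s. form \<phi> (f \<tau>))"
  by (induction \<tau>s) (simp_all add: form_def distrib_left sum.distrib add_divide_distrib)

text \<open>By orthogonality each summand contributes 1 or 0 to the pairing with the character of
  \<tau>. The right-hand side does not mention the decomposition, so the count is the same for all
  of them.\<close>

lemma decomposition_count:
  assumes \<tau>: "irreducible_rep G \<tau>" and \<pi>: "is_rep G \<pi>"
    and \<tau>s: "\<forall>\<tau>'\<in>set \<tau>s. irreducible_rep G \<tau>'" and iso: "rep_iso G \<pi> (rep_sum \<tau>s)"
  shows "of_nat (length (filter (rep_iso G \<tau>) \<tau>s)) = form (char \<tau>) (char \<pi>)"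
proof -
  have r: "\<forall>\<tau>'\<in>set \<tau>s. is_rep G \<tau>'" using \<tau>s irreducible_repD(1) by blast
  have "form (char \<tau>) (char \<pi>) = form (char \<tau>) (\<lambda>g. \<Sum>\<tau>'\<leftarrow>\<tau>s. char \<tau>' g)"
    using char_iso[OF \<pi> rep_sum_rep(1)[OF r] iso] rep_sum_rep(2)[OF r] by (intro form_cong) auto
  also have "\<dots> = (\<Sum>\<tau>'\<leftarrow>\<tau>s. form (char \<tau>) (char \<tau>'))" by (rule form_sum_list)
  also have "\<dots> = of_nat (length (filter (rep_iso G \<tau>) \<tau>s))"
    using \<tau>s by (induction \<tau>s) (auto simp: form_char_irreducible[OF \<tau>])
  finally show ?thesis ..
qed

text \<open>Complete reducibility gives existence and \<open>decomposition_count\<close> uniqueness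
  of the number described in \<open>rep_mult\<close>.\<close>

lemma rep_mult_eq_form:
  assumes \<tau>: "irreducible_rep G \<tau>" and \<pi>: "is_rep G \<pi>"
  shows "of_nat (rep_mult G \<tau> \<pi>) = form (char \<tau>) (char \<pi>)"
proof -
  let ?P = "\<lambda>k. \<exists>\<tau>s. (\<forall>\<tau>'\<in>set \<tau>s. irreducible_rep G \<tau>') \<and>
     rep_iso G \<pi> (rep_sum \<tau>s) \<and> k = length (filter (rep_iso G \<tau>) \<tau>s)"
  have c: "of_nat k = form (char \<tau>) (char \<pi>)" if "?P k" for k
    using that decomposition_count[OF \<tau> \<pi>] by auto
  have "?P (THE k. ?P k)"
  proof (rule theI')
    obtain k where "?P k" using complete_reducibility[OF \<pi>] by blast
    moreover have "k' = k''" if "?P k'" "?P k''" for k' k''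
      using c[OF that(1)] c[OF that(2)] of_nat_eq_iff[of k' k'', where 'a = complex] by simp
    ultimately show "\<exists>!k. ?P k" by blast
  qed
  then show ?thesis using c unfolding rep_mult_def by blast
qed

definition irr_rep :: "('a \<Rightarrow> complex mat) set \<Rightarrow> 'a \<Rightarrow> complex mat" where
  "irr_rep C = (SOME \<sigma>. \<sigma> \<in> C)"

lemma irr_iso_equiv: "equiv {\<sigma>. irreducible_rep G \<sigma>} (irr_iso G)"
proof (rule equivI)
  show "refl_on {\<sigma>. irreducible_rep G \<sigma>} (irr_iso G)"
    using rep_iso_refl irreducible_repD(1) by (auto simp: refl_on_def irr_iso_def)
  show "sym (irr_iso G)"
    using rep_iso_sym irreducible_repD(1) unfolding sym_def irr_iso_def by blast
  show "trans (irr_iso G)"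
    using rep_iso_trans irreducible_repD(1) unfolding trans_def irr_iso_def by blast
qed (auto simp: irr_iso_def)

lemma Irr_irr_rep: "C \<in> Irr G \<Longrightarrow> irr_rep C \<in> C"
  unfolding Irr_def irr_rep_def using in_quotient_imp_non_empty[OF irr_iso_equiv] some_in_eq by blast

lemma Irr_memD:
  assumes "C \<in> Irr G" "\<sigma> \<in> C"
  shows "irreducible_rep G \<sigma>" "is_rep G \<sigma>"
  using assms in_quotient_imp_subset[OF irr_iso_equiv] irreducible_repD(1) unfolding Irr_def by blast+

lemma Irr_mem_iso:
  assumes "C \<in> Irr G" "\<sigma> \<in> C" "\<tau> \<in> C"
  shows "rep_iso G \<sigma> \<tau>"
  using in_quotient_imp_in_rel[OF irr_iso_equiv, of C \<sigma> \<tau>] assms by (auto simp: Irr_def irr_iso_def)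

lemma Irr_mem_char: "C \<in> Irr G \<Longrightarrow> \<sigma> \<in> C \<Longrightarrow> g \<in> carrier G \<Longrightarrow> char \<sigma> g = char (irr_rep C) g"
  by (rule char_iso[OF Irr_memD(2) Irr_memD(2) Irr_mem_iso]) (auto intro: Irr_irr_rep)

lemma Irr_class:
  assumes \<sigma>: "irreducible_rep G \<sigma>"
  shows "irr_iso G `` {\<sigma>} \<in> Irr G" "\<sigma> \<in> irr_iso G `` {\<sigma>}"
    "C \<in> Irr G \<Longrightarrow> rep_iso G (irr_rep C) \<sigma> \<longleftrightarrow> C = irr_iso G `` {\<sigma>}"
proof -
  show 1: "irr_iso G `` {\<sigma>} \<in> Irr G" unfolding Irr_def using \<sigma> by (intro quotientI) simp
  show 2: "\<sigma> \<in> irr_iso G `` {\<sigma>}" using equiv_class_self[OF irr_iso_equiv] \<sigma> by simp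
  assume C: "C \<in> Irr G"
  have r: "irreducible_rep G (irr_rep C)" using Irr_memD[OF C Irr_irr_rep[OF C]] by simp
  show "rep_iso G (irr_rep C) \<sigma> \<longleftrightarrow> C = irr_iso G `` {\<sigma>}"
  proof
    assume "rep_iso G (irr_rep C) \<sigma>"
    then have "(irr_rep C, \<sigma>) \<in> irr_iso G" using r \<sigma> by (simp add: irr_iso_def)
    then show "C = irr_iso G `` {\<sigma>}"
      using quotient_eqI[OF irr_iso_equiv, of C "irr_iso G `` {\<sigma>}"] C 1 2 Irr_irr_rep[OF C] unfolding Irr_def by blast
  next
    assume "C = irr_iso G `` {\<sigma>}"
    then show "rep_iso G (irr_rep C) \<sigma>" using Irr_mem_iso[OF C Irr_irr_rep[OF C]] 2 by simp
  qed
qed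

lemma irr_char_orthonormal:
  assumes C: "C \<in> Irr G" and D: "D \<in> Irr G"
  shows "form (char (irr_rep C)) (char (irr_rep D)) = (if C = D then 1 else 0)"
proof -
  have c: "irreducible_rep G (irr_rep C)" and d: "irreducible_rep G (irr_rep D)"
    using Irr_memD(1)[OF C Irr_irr_rep[OF C]] Irr_memD(1)[OF D Irr_irr_rep[OF D]] by auto
  have "D = irr_iso G `` {irr_rep D}" using Irr_class(3)[OF d D] rep_iso_refl[OF irreducible_repD(1)[OF d]] by simp
  then have "rep_iso G (irr_rep C) (irr_rep D) \<longleftrightarrow> C = D" using Irr_class(3)[OF d C] by simp
  then show ?thesis using form_char_irreducible[OF c d] by simp
qed

text \<open>Orthonormality says that a character table of \<open>k\<close> classes has a right
  inverse, so \<open>k\<close> is at most the group order. Finiteness is essential: sums over an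
  infinite \<open>Irr G\<close> would be 0 by convention.\<close>

lemma finite_Irr: "finite (Irr G)"
proof -
  have le: "card F \<le> card (carrier G)" if F: "F \<subseteq> Irr G" "finite F" for F
  proof -
    let ?k = "card F" and ?n = "card (carrier G)"
    obtain f where f: "bij_betw f {0..<?k} F" using ex_bij_betw_nat_finite[OF F(2)] by blast
    obtain h where h: "bij_betw h {0..<?n} (carrier G)" using ex_bij_betw_nat_finite[OF fin] by blast
    define L where "L = Matrix.mat ?k ?n (\<lambda>(i, j). char (irr_rep (f i)) (h j))"
    define B where "B = Matrix.mat ?n ?k (\<lambda>(j, i). char (irr_rep (f i)) (inv (h j)) / of_nat ?n)"
    have L: "L \<in> carrier_mat ?k ?n" and B: "B \<in> carrier_mat ?n ?k" by (auto simp: L_def B_def)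
    have "L * B = 1\<^sub>m ?k"
    proof (rule eq_matI)
      fix i j assume "i < dim_row (1\<^sub>m ?k :: complex mat)" "j < dim_col (1\<^sub>m ?k :: complex mat)"
      then have ij: "i < ?k" "j < ?k" by auto
      then have fF: "f i \<in> Irr G" "f j \<in> Irr G" using f F(1) bij_betwE[OF f] by auto
      have "(L * B) $$ (i, j) = (\<Sum>r = 0..<?n. char (irr_rep (f i)) (h r) * char (irr_rep (f j)) (inv (h r)) / of_nat ?n)"
        unfolding mult_mat_index[OF L B ij] using ij by (intro sum.cong) (auto simp: L_def B_def)
      also have "\<dots> = form (char (irr_rep (f i))) (char (irr_rep (f j)))"
        unfolding form_def sum_divide_distrib
        by (rule sum.reindex_bij_betw[OF h, of "\<lambda>g. char (irr_rep (f i)) g * char (irr_rep (f j)) (inv g) / of_nat ?n"])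
      also have "\<dots> = (if f i = f j then 1 else 0)" by (rule irr_char_orthonormal[OF fF])
      also have "f i = f j \<longleftrightarrow> i = j" using f ij by (auto simp: bij_betw_def inj_on_def)
      finally show "(L * B) $$ (i, j) = (1\<^sub>m ?k) $$ (i, j)" using ij by simp
    qed (use L B in auto)
    then show ?thesis by (rule left_inverse_dim_le[OF L B])
  qed
  show ?thesis
  proof (rule ccontr)
    assume "infinite (Irr G)"
    then obtain F where "F \<subseteq> Irr G" "finite F" "card F = Suc (card (carrier G))"
      using infinite_arbitrarily_large by blast
    then show False using le[of F] by simp
  qed
qed

text \<open>The coefficients count summands of a decomposition by class, so the sum over classes
  merely regroups the sum over summands.\<close>

lemma char_expansion:
  assumes \<pi>: "is_rep G \<pi>" and g: "g \<in> carrier G"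
  shows "(\<Sum>C\<in>Irr G. form (char (irr_rep C)) (char \<pi>) * char (irr_rep C) g) = char \<pi> g"
proof -
  obtain \<tau>s where \<tau>s: "\<forall>\<tau>\<in>set \<tau>s. irreducible_rep G \<tau>" and iso: "rep_iso G \<pi> (rep_sum \<tau>s)"
    using complete_reducibility[OF \<pi>] by blast
  have r: "\<forall>\<tau>'\<in>set \<tau>s. is_rep G \<tau>'" using \<tau>s irreducible_repD(1) by blast
  have "(\<Sum>C\<in>Irr G. form (char (irr_rep C)) (char \<pi>) * char (irr_rep C) g) =
    (\<Sum>C\<in>Irr G. of_nat (length (filter (rep_iso G (irr_rep C)) \<tau>s)) * char (irr_rep C) g)"
    using decomposition_count[OF Irr_memD(1)[OF _ Irr_irr_rep] \<pi> \<tau>s iso] by (intro sum.cong) auto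
  also have "\<dots> = (\<Sum>\<tau>\<leftarrow>\<tau>s. char \<tau> g)"
    using \<tau>s
  proof (induction \<tau>s)
    case (Cons \<tau> \<tau>s)
    have t: "irreducible_rep G \<tau>" using Cons.prems by simp
    have "(\<Sum>C\<in>Irr G. of_nat (length (filter (rep_iso G (irr_rep C)) (\<tau> # \<tau>s))) * char (irr_rep C) g) =
      (\<Sum>C\<in>Irr G. (if C = irr_iso G `` {\<tau>} then char (irr_rep C) g else 0) +
         of_nat (length (filter (rep_iso G (irr_rep C)) \<tau>s)) * char (irr_rep C) g)"
      using Irr_class(3)[OF t] by (intro sum.cong refl) (simp add: distrib_right)
    also have "\<dots> = char (irr_rep (irr_iso G `` {\<tau>})) g + (\<Sum>\<tau>\<leftarrow>\<tau>s. char \<tau> g)"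
      using Cons Irr_class(1)[OF t] finite_Irr by (simp add: sum.distrib)
    also have "char (irr_rep (irr_iso G `` {\<tau>})) g = char \<tau> g"
      using Irr_mem_char[OF Irr_class(1,2)[OF t] g] by simp
    finally show ?case by simp
  qed simp
  also have "\<dots> = char \<pi> g"
    using rep_sum_rep(2)[OF r g] char_iso[OF \<pi> rep_sum_rep(1)[OF r] iso g] by simp
  finally show ?thesis .
qed

end

section \<open>Moments of the McKay graph\<close>

lemma mat_apply_adjoint:
  assumes "finite I"
  shows "inner_prod I (mat_apply I M x) y = inner_prod I x (mat_apply I (conj_transpose M) y)"
proof -
  have "inner_prod I (mat_apply I M x) y = (\<Sum>i\<in>I. \<Sum>j\<in>I. M i j * x j * cnj (y i))"
    by (simp add: inner_prod_def mat_apply_def sum_distrib_right)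
  also have "\<dots> = (\<Sum>j\<in>I. \<Sum>i\<in>I. M i j * x j * cnj (y i))" by (rule sum.swap)
  also have "\<dots> = inner_prod I x (mat_apply I (conj_transpose M) y)"
    by (simp add: inner_prod_def mat_apply_def conj_transpose_def sum_distrib_left mult_ac)
  finally show ?thesis .
qed

lemma mat_apply_pow_adjoint:
  assumes "finite I"
  shows "inner_prod I ((mat_apply I M ^^ m) x) y = inner_prod I x ((mat_apply I (conj_transpose M) ^^ m) y)"
proof (induction m arbitrary: y)
  case (Suc m)
  show ?case by (simp only: funpow.simps comp_apply mat_apply_adjoint[OF assms] Suc) (simp only: funpow_swap1)
qed simp

context finite_grp
begin

lemma trivial_irreducible: "irreducible_rep G (\<lambda>_. 1\<^sub>m 1)"
proof -
  have r: "is_rep G (\<lambda>_. 1\<^sub>m 1)" and d: "rep_dim G (\<lambda>_. 1\<^sub>m 1) = 1"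
    using is_repI[of "\<lambda>_. 1\<^sub>m 1" 1] by auto
  have "W = {0\<^sub>v 1} \<or> W = carrier_vec 1" if W: "vec_subspace 1 W" for W
  proof (cases "W = {0\<^sub>v 1}")
    case False
    then obtain w where w: "w \<in> W" "w \<noteq> 0\<^sub>v 1" using W by (auto simp: vec_subspace_def)
    have w1: "w \<in> carrier_vec 1" using W w by (auto simp: vec_subspace_def)
    have w0: "w $ 0 \<noteq> 0"
    proof
      assume "w $ 0 = 0"
      then have "w = 0\<^sub>v 1" using w1 by (intro eq_vecI) auto
      with w show False by simp
    qed
    have "v \<in> W" if v: "v \<in> carrier_vec 1" for v
    proof -
      have "v = (v $ 0 / w $ 0) \<cdot>\<^sub>v w" using v w1 w0 by (intro eq_vecI) auto
      moreover have "(v $ 0 / w $ 0) \<cdot>\<^sub>v w \<in> W" using W w by (simp add: vec_subspace_def)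
      ultimately show ?thesis by simp
    qed
    then show ?thesis using W by (auto simp: vec_subspace_def)
  qed simp
  then show ?thesis unfolding irreducible_rep_def vec_subspace_iff d using r by auto
qed

text \<open>Expanding \<open>\<rho>\<^sup>n = \<Sum>\<^bsub>C\<^esub> v\<^sub>n(C) \<chi>\<^sub>C\<close>, the vectors \<open>v\<^sub>n\<close> satisfy \<open>v\<^sub>n\<^sub>+\<^sub>1 = \<Delta>\<^sup>* v\<^sub>n\<close>, so the moments of the
  McKay graph are the products \<open>\<langle>v\<^sub>n, v\<^sub>m\<rangle>\<close>.\<close>

lemma moment_eq_char_sum:
  fixes \<rho> :: "'a \<Rightarrow> complex mat"
  defines "e1 \<equiv> \<lambda>C. if C = trivial_class G then 1 else 0"
  assumes \<rho>: "is_rep G \<rho>"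
    and \<Delta>: "\<And>C D. C \<in> Irr G \<Longrightarrow> D \<in> Irr G \<Longrightarrow>
      of_nat (a C D) = form (char (irr_rep D)) (char (rep_tensor \<rho> (irr_rep C)))"
  shows "inner_prod (Irr G) ((mat_apply (Irr G) (\<lambda>C D. of_nat (a C D)) ^^ m)
      ((mat_apply (Irr G) (conj_transpose (\<lambda>C D. of_nat (a C D))) ^^ n) e1)) e1 =
    (\<Sum>g\<in>carrier G. char \<rho> g ^ n * char \<rho> (inv g) ^ m) / of_nat (card (carrier G))"
proof -
  let ?I = "Irr G" and ?M = "conj_transpose (\<lambda>C D. of_nat (a C D))"
  define v where "v n = (mat_apply ?I ?M ^^ n) e1" for n
  have v0: "v 0 = e1" by (simp add: v_def)
  have vS: "v (Suc n) D = (\<Sum>C\<in>?I. of_nat (a C D) * v n C)" for n D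
    by (simp add: v_def mat_apply_def conj_transpose_def)
  \<comment> \<open>The entries of \<Delta> are natural numbers, so all coordinates are real and the
    conjugation in \<open>inner_prod\<close> disappears.\<close>
  have real: "cnj (v n C) = v n C" for n C
    by (induction n arbitrary: C) (auto simp: v0 vS e1_def)
  have irr: "is_rep G (irr_rep C)" if "C \<in> ?I" for C
    using Irr_memD(2)[OF that Irr_irr_rep[OF that]] .
  have tI: "trivial_class G \<in> ?I" and tm: "(\<lambda>_. 1\<^sub>m 1) \<in> trivial_class G"
    unfolding trivial_class_def using Irr_class(1,2)[OF trivial_irreducible] by auto
  have expand: "(\<Sum>C\<in>?I. v n C * char (irr_rep C) g) = char \<rho> g ^ n" if g: "g \<in> carrier G" for n g
  proof (induction n)
    case 0
    have "(\<Sum>C\<in>?I. v 0 C * char (irr_rep C) g) = (\<Sum>C\<in>?I. if C = trivial_class G then char (irr_rep C) g else 0)"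
      by (intro sum.cong) (auto simp: v0 e1_def)
    also have "\<dots> = char (irr_rep (trivial_class G)) g" using finite_Irr tI by simp
    also have "\<dots> = char (\<lambda>_. 1\<^sub>m 1) g" using Irr_mem_char[OF tI tm g] by simp
    finally show ?case by (simp add: char_def mtrace_def)
  next
    case (Suc n)
    have "(\<Sum>D\<in>?I. v (Suc n) D * char (irr_rep D) g) =
      (\<Sum>D\<in>?I. \<Sum>C\<in>?I. v n C * (form (char (irr_rep D)) (char (rep_tensor \<rho> (irr_rep C))) * char (irr_rep D) g))"
      by (intro sum.cong refl) (simp add: vS sum_distrib_left sum_distrib_right \<Delta> mult_ac)
    also have "\<dots> = (\<Sum>C\<in>?I. v n C * (\<Sum>D\<in>?I. form (char (irr_rep D)) (char (rep_tensor \<rho> (irr_rep C))) * char (irr_rep D) g))"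
      by (subst sum.swap) (simp add: sum_distrib_left)
    also have "\<dots> = (\<Sum>C\<in>?I. v n C * (char \<rho> g * char (irr_rep C) g))"
      by (intro sum.cong refl) (simp add: char_expansion[OF rep_tensor_rep[OF \<rho> irr] g] char_tensor[OF \<rho> irr g])
    also have "\<dots> = char \<rho> g * (\<Sum>C\<in>?I. v n C * char (irr_rep C) g)"
      by (simp add: sum_distrib_left mult_ac)
    finally show ?case by (simp add: Suc)
  qed
  have "inner_prod ?I ((mat_apply ?I (\<lambda>C D. of_nat (a C D)) ^^ m) (v n)) e1 = inner_prod ?I (v n) (v m)"
    unfolding mat_apply_pow_adjoint[OF finite_Irr] v_def ..
  also have "\<dots> = (\<Sum>C\<in>?I. v m C * v n C)" by (simp add: inner_prod_def real mult.commute)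
  \<comment> \<open>Inserting the orthonormality of the characters turns the coordinatewise product
    into the pairing of the two expansions.\<close>
  also have "\<dots> = (\<Sum>C\<in>?I. v m C * (\<Sum>D\<in>?I. v n D * form (char (irr_rep C)) (char (irr_rep D))))"
    using finite_Irr by (intro sum.cong refl) (simp add: irr_char_orthonormal if_distrib cong: if_cong sum.cong)
  also have "\<dots> = (\<Sum>C\<in>?I. v m C * form (char (irr_rep C)) (\<lambda>g. char \<rho> g ^ n))"
    unfolding form_sum_right[symmetric] using expand by (intro sum.cong refl arg_cong2[of _ _ _ _ "(*)"] form_cong) auto
  also have "\<dots> = form (\<lambda>g. char \<rho> g ^ n) (\<lambda>g. \<Sum>C\<in>?I. v m C * char (irr_rep C) g)"
    unfolding form_sum_right by (simp add: form_sym)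
  also have "\<dots> = form (\<lambda>g. char \<rho> g ^ n) (\<lambda>g. char \<rho> g ^ m)"
    using expand by (intro form_cong) auto
  finally show ?thesis unfolding v_def form_def .
qed

end

theorem mckay_moment_eq:
  assumes fg: "finite_grp (SU3_sub \<Gamma>)" and sub: "\<Gamma> \<subseteq> carrier SU3"
  shows "mckay_moment \<Gamma> m n =
    (\<Sum>g\<in>\<Gamma>. mtrace g ^ n * mtrace (inv\<^bsub>SU3_sub \<Gamma>\<^esub> g) ^ m) / of_nat (card \<Gamma>)"
proof -
  interpret finite_grp "SU3_sub \<Gamma>" by (rule fg)
  let ?G = "SU3_sub \<Gamma>"
  have \<rho>: "is_rep ?G (\<lambda>g. g)"
    by (rule is_repI[of _ 3]) (use sub in \<open>auto simp: SU3_def\<close>)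
  \<comment> \<open>Characters are constant on isomorphism classes, so all choices of
    representatives give the same multiplicity, and the definite description in
    \<open>mckay_adj\<close> is justified.\<close>
  have adj: "of_nat (mckay_adj \<Gamma> C D) = form (char (irr_rep D)) (char (rep_tensor (\<lambda>g. g) (irr_rep C)))"
    if C: "C \<in> Irr ?G" and D: "D \<in> Irr ?G" for C D
  proof -
    let ?P = "\<lambda>k. \<exists>\<sigma>\<in>C. \<exists>\<sigma>'\<in>D. k = rep_mult ?G \<sigma>' (rep_tensor (\<lambda>g. g) \<sigma>)"
    have c: "of_nat k = form (char (irr_rep D)) (char (rep_tensor (\<lambda>g. g) (irr_rep C)))" if P: "?P k" for k
    proof -
      obtain \<sigma> \<sigma>' where s: "\<sigma> \<in> C" "\<sigma>' \<in> D" "k = rep_mult ?G \<sigma>' (rep_tensor (\<lambda>g. g) \<sigma>)" using P by blast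
      have "of_nat k = form (char \<sigma>') (char (rep_tensor (\<lambda>g. g) \<sigma>))"
        unfolding s(3) by (rule rep_mult_eq_form[OF Irr_memD(1)[OF D s(2)] rep_tensor_rep[OF \<rho> Irr_memD(2)[OF C s(1)]]])
      also have "\<dots> = form (char (irr_rep D)) (char (rep_tensor (\<lambda>g. g) (irr_rep C)))"
        using Irr_mem_char[OF D s(2)] Irr_mem_char[OF C s(1)]
          char_tensor[OF \<rho> Irr_memD(2)[OF C s(1)]] char_tensor[OF \<rho> Irr_memD(2)[OF C Irr_irr_rep[OF C]]]
        by (intro form_cong) auto
      finally show ?thesis .
    qed
    have "?P (THE k. ?P k)"
    proof (rule theI')
      obtain k where "?P k" using Irr_irr_rep[OF C] Irr_irr_rep[OF D] by blast
      moreover have "k' = k''" if "?P k'" "?P k''" for k' k''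
        using c[OF that(1)] c[OF that(2)] of_nat_eq_iff[of k' k'', where 'a = complex] by simp
      ultimately show "\<exists>!k. ?P k" by blast
    qed
    then show ?thesis using c unfolding mckay_adj_def by blast
  qed
  show ?thesis unfolding mckay_moment_def Let_def
    using moment_eq_char_sum[OF \<rho> adj, of m n] by (simp add: char_def)
qed

section \<open>The group \<open>\<Sigma>(216\<times>3)\<close>\<close>

lemma \<omega>_cis: "\<omega> = cis (2 * pi / 3)"
  unfolding \<omega>_def cis_conv_exp by (rule arg_cong[of _ _ exp]) simp

lemma \<omega>_cube: "\<omega> ^ 3 = 1"
  unfolding \<omega>_cis Complex.DeMoivre by simp

lemma \<epsilon>_cis: "\<epsilon> = cis (2 * pi / 9)"
  unfolding \<epsilon>_def cis_conv_exp by (rule arg_cong[of _ _ exp]) simp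

lemma \<omega>_eq: "\<omega> = Complex (- 1 / 2) (sqrt 3 / 2)"
proof -
  have "cos (2 * pi / 3) = - 1 / 2" "sin (2 * pi / 3) = sqrt 3 / 2"
    using cos_double_cos[of "pi / 3"] sin_double[of "pi / 3"] by (simp_all add: cos_60 sin_60 power2_eq_square)
  then show ?thesis by (simp add: \<omega>_cis complex_eq_iff)
qed

lemma \<omega>_sq: "\<omega> ^ 2 = - 1 - \<omega>"
  by (simp add: \<omega>_eq power2_eq_square complex_eq_iff)

lemma cnj_\<omega>: "cnj \<omega> = - 1 - \<omega>"
  by (simp add: \<omega>_eq complex_eq_iff)

lemma \<omega>_neq_0: "\<omega> \<noteq> 0"
  by (simp add: \<omega>_def)

lemma \<epsilon>_cube: "\<epsilon> ^ 3 = \<omega>"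
  unfolding \<epsilon>_cis \<omega>_cis Complex.DeMoivre by simp

text \<open>The square root of -3 is itself an Eisenstein integer, coded \<open>(1, 2)\<close> in
  all tables.\<close>

lemma sqrt_neg3: "\<i> * complex_of_real (sqrt 3) = 1 + 2 * \<omega>"
  by (simp add: \<omega>_eq complex_eq_iff)

lemma \<omega>_pow_mod: "\<omega> ^ n = \<omega> ^ (n mod 3)"
proof -
  have "\<omega> ^ n = (\<omega> ^ 3) ^ (n div 3) * \<omega> ^ (n mod 3)"
    unfolding power_mult[symmetric] power_add[symmetric] by simp
  then show ?thesis by (simp add: \<omega>_cube)
qed

lemma \<omega>_pow_cong: "n mod 3 = m mod 3 \<Longrightarrow> \<omega> ^ n = \<omega> ^ m"
  using \<omega>_pow_mod[of n] \<omega>_pow_mod[of m] by simp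

lemma \<omega>_pow_inj: "\<omega> ^ n = \<omega> ^ m \<Longrightarrow> n mod 3 = m mod 3"
proof -
  assume "\<omega> ^ n = \<omega> ^ m"
  then have e: "\<omega> ^ (n mod 3) = \<omega> ^ (m mod 3)" using \<omega>_pow_mod by metis
  have "n mod 3 \<in> {0, 1, 2}" "m mod 3 \<in> {0, 1, 2}" by auto
  then show ?thesis using e \<omega>_sq by (auto simp: \<omega>_eq complex_eq_iff)
qed

text \<open>The pair \<open>(a, b)\<close> encodes the Eisenstein integer \<open>a + b \<omega>\<close>.\<close>

type_synonym eis = "int \<times> int"

definition eis_val :: "eis \<Rightarrow> complex" where
  "eis_val z = of_int (fst z) + of_int (snd z) * \<omega>"

definition eis_add :: "eis \<Rightarrow> eis \<Rightarrow> eis" where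
  "eis_add x y = (fst x + fst y, snd x + snd y)"

definition eis_mul :: "eis \<Rightarrow> eis \<Rightarrow> eis" where
  "eis_mul x y = (fst x * fst y - snd x * snd y, fst x * snd y + snd x * fst y - snd x * snd y)"

definition eis_cnj :: "eis \<Rightarrow> eis" where
  "eis_cnj x = (fst x - snd x, - snd x)"

lemma eis_val_add: "eis_val (eis_add x y) = eis_val x + eis_val y"
  by (simp add: eis_val_def eis_add_def algebra_simps)

lemma eis_val_mul: "eis_val (eis_mul x y) = eis_val x * eis_val y"
proof -
  have "eis_val x * eis_val y = of_int (fst x * fst y) + of_int (fst x * snd y + snd x * fst y) * \<omega> + of_int (snd x * snd y) * \<omega> ^ 2"
    by (simp add: eis_val_def algebra_simps power2_eq_square)
  then show ?thesis by (simp add: \<omega>_sq eis_val_def eis_mul_def algebra_simps)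
qed

lemma eis_val_cnj: "eis_val (eis_cnj x) = cnj (eis_val x)"
  by (simp add: eis_val_def eis_cnj_def cnj_\<omega> algebra_simps)

type_synonym emat = "nat \<Rightarrow> nat \<Rightarrow> eis"

definition emat_val :: "emat \<Rightarrow> complex mat" where
  "emat_val A = Matrix.mat 3 3 (\<lambda>(i, j). eis_val (A i j))"

definition emat_mul :: "emat \<Rightarrow> emat \<Rightarrow> emat" where
  "emat_mul A B i j = eis_add (eis_add (eis_mul (A i 0) (B 0 j)) (eis_mul (A i 1) (B 1 j))) (eis_mul (A i 2) (B 2 j))"

text \<open>Codes are functions on all indices; the test looks only at the 3 by 3 block that
  \<open>emat_val\<close> reads, which makes it executable.\<close>

definition emat_eq :: "emat \<Rightarrow> emat \<Rightarrow> bool" where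
  "emat_eq A B = list_all (\<lambda>i. list_all (\<lambda>j. A i j = B i j) [0, 1, 2]) [0, 1, 2]"

definition emat_tr :: "emat \<Rightarrow> eis" where
  "emat_tr A = eis_add (eis_add (A 0 0) (A 1 1)) (A 2 2)"

definition emat_of_list :: "eis list list \<Rightarrow> emat" where
  "emat_of_list xss i j = xss ! i ! j"

lemma less_3_iff: "i < 3 \<longleftrightarrow> i = 0 \<or> i = 1 \<or> i = (2::nat)"
  by auto

lemma emat_val_carrier [simp]: "emat_val A \<in> carrier_mat 3 3"
  by (simp add: emat_val_def)

lemma emat_val_dim [simp]: "dim_row (emat_val A) = 3" "dim_col (emat_val A) = 3"
  by (simp_all add: emat_val_def)

lemma emat_val_mul: "emat_val (emat_mul A B) = emat_val A * emat_val B"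
proof (rule eq_matI)
  fix i j assume "i < dim_row (emat_val A * emat_val B)" "j < dim_col (emat_val A * emat_val B)"
  then have ij: "i < 3" "j < 3" by auto
  show "emat_val (emat_mul A B) $$ (i, j) = (emat_val A * emat_val B) $$ (i, j)"
    unfolding mult_mat_index[OF emat_val_carrier emat_val_carrier ij] using ij
    by (simp add: emat_val_def emat_mul_def eis_val_add eis_val_mul numeral_3_eq_3 numeral_2_eq_2)
qed auto

lemma emat_val_cong: "emat_eq A B \<Longrightarrow> emat_val A = emat_val B"
  unfolding emat_eq_def emat_val_def by (auto intro!: eq_matI simp: less_3_iff)

lemma mtrace_emat_val: "mtrace (emat_val A) = eis_val (emat_tr A)"
  by (simp add: mtrace_def emat_val_def emat_tr_def eis_val_add numeral_3_eq_3 numeral_2_eq_2)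

section \<open>Determinants, adjoints and the group SU(3)\<close>

lemma det_3:
  assumes A: "A \<in> carrier_mat 3 3"
  shows "Determinant.det A =
    A $$ (0, 0) * (A $$ (1, 1) * A $$ (2, 2) - A $$ (1, 2) * A $$ (2, 1)) -
    A $$ (0, 1) * (A $$ (1, 0) * A $$ (2, 2) - A $$ (1, 2) * A $$ (2, 0)) +
    A $$ (0, 2) * (A $$ (1, 0) * A $$ (2, 1) - A $$ (1, 1) * A $$ (2, 0) :: complex)"
proof -
  have 2: "Determinant.det B = B $$ (0, 0) * B $$ (1, 1) - B $$ (0, 1) * B $$ (1, 0)"
    if B: "B \<in> carrier_mat 2 2" for B :: "complex mat"
  proof -
    have "Determinant.det B = (\<Sum>j<2. B $$ (0, j) * cofactor B 0 j)"
      by (rule laplace_expansion_row[OF B]) simp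
    also have "\<dots> = B $$ (0, 0) * B $$ (1, 1) - B $$ (0, 1) * B $$ (1, 0)"
      using B by (simp add: numeral_2_eq_2 cofactor_def det_single mat_delete_def mat_delete_carrier)
    finally show ?thesis .
  qed
  have c: "mat_delete A 0 j \<in> carrier_mat 2 2" for j
    using mat_delete_carrier[OF A, of 0 j] by (simp add: numeral_2_eq_2)
  have "Determinant.det A = (\<Sum>j<3. A $$ (0, j) * cofactor A 0 j)"
    by (rule laplace_expansion_row[OF A]) simp
  also have "\<dots> = A $$ (0, 0) * cofactor A 0 0 + A $$ (0, 1) * cofactor A 0 1 + A $$ (0, 2) * cofactor A 0 2"
    by (simp add: numeral_3_eq_3 numeral_2_eq_2)
  also have "cofactor A 0 0 = A $$ (1, 1) * A $$ (2, 2) - A $$ (1, 2) * A $$ (2, 1)"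
    unfolding cofactor_def 2[OF c] using A by (simp add: mat_delete_def numeral_2_eq_2)
  also have "cofactor A 0 1 = - (A $$ (1, 0) * A $$ (2, 2) - A $$ (1, 2) * A $$ (2, 0))"
    unfolding cofactor_def 2[OF c] using A by (simp add: mat_delete_def numeral_2_eq_2)
  also have "cofactor A 0 2 = A $$ (1, 0) * A $$ (2, 1) - A $$ (1, 1) * A $$ (2, 0)"
    unfolding cofactor_def 2[OF c] using A by (simp add: mat_delete_def numeral_2_eq_2)
  finally show ?thesis by (simp add: algebra_simps)
qed

lemma mat_adjoint_carrier: "A \<in> carrier_mat n n \<Longrightarrow> mat_adjoint A \<in> carrier_mat n n"
  by (auto simp: mat_adjoint_def)

lemma mat_adjoint_index:
  "A \<in> carrier_mat n n \<Longrightarrow> i < n \<Longrightarrow> j < n \<Longrightarrow> mat_adjoint (A :: complex mat) $$ (i, j) = cnj (A $$ (j, i))"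
  by (simp add: mat_adjoint_def mat_of_rows_index)

lemma mat_adjoint_mult:
  assumes A: "A \<in> carrier_mat n n" and B: "B \<in> carrier_mat n n"
  shows "mat_adjoint (A * B) = mat_adjoint B * mat_adjoint (A :: complex mat)"
proof (rule eq_matI)
  note a = mat_adjoint_carrier[OF A] and b = mat_adjoint_carrier[OF B]
  fix i j assume "i < dim_row (mat_adjoint B * mat_adjoint A)" "j < dim_col (mat_adjoint B * mat_adjoint A)"
  then have ij: "i < n" "j < n" using a b by auto
  have "mat_adjoint (A * B) $$ (i, j) = cnj ((A * B) $$ (j, i))"
    using A B ij by (intro mat_adjoint_index[of _ n]) auto
  also have "\<dots> = (\<Sum>r = 0..<n. cnj (A $$ (j, r)) * cnj (B $$ (r, i)))"
    by (simp add: mult_mat_index[OF A B ij(2,1)] del: index_mult_mat(1))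
  also have "\<dots> = (mat_adjoint B * mat_adjoint A) $$ (i, j)"
    unfolding mult_mat_index[OF b a ij]
    using ij by (intro sum.cong refl) (simp add: mat_adjoint_index[OF A] mat_adjoint_index[OF B])
  finally show "mat_adjoint (A * B) $$ (i, j) = (mat_adjoint B * mat_adjoint A) $$ (i, j)" .
qed (use mat_adjoint_carrier[OF mult_carrier_mat[OF A B]] mat_adjoint_carrier[OF A] mat_adjoint_carrier[OF B] in auto)

lemma mat_adjoint_adjoint: "A \<in> carrier_mat n n \<Longrightarrow> mat_adjoint (mat_adjoint A) = (A :: complex mat)"
  using mat_adjoint_carrier[of A n] mat_adjoint_carrier[of "mat_adjoint A" n]
  by (intro eq_matI) (auto simp: mat_adjoint_index[of _ n])

lemma mtrace_adjoint: "A \<in> carrier_mat n n \<Longrightarrow> mtrace (mat_adjoint A) = cnj (mtrace A)"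
  using mat_adjoint_carrier[of A n] by (simp add: mtrace_def mat_adjoint_index[of _ n])

lemma SU3_carrier_iff:
  "A \<in> carrier SU3 \<longleftrightarrow> A \<in> carrier_mat 3 3 \<and> A * mat_adjoint A = 1\<^sub>m 3 \<and> Determinant.det A = 1"
  by (auto simp: SU3_def)

lemma SU3_simps [simp]: "A \<otimes>\<^bsub>SU3\<^esub> B = A * B" "\<one>\<^bsub>SU3\<^esub> = 1\<^sub>m 3"
  by (simp_all add: SU3_def)

lemma SU3_adjoint:
  assumes "A \<in> carrier SU3"
  shows "mat_adjoint A \<in> carrier SU3" "mat_adjoint A * A = 1\<^sub>m 3"
proof -
  have A: "A \<in> carrier_mat 3 3" "A * mat_adjoint A = 1\<^sub>m 3" "Determinant.det A = 1"
    using assms by (auto simp: SU3_carrier_iff)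
  note a = mat_adjoint_carrier[OF A(1)]
  show 1: "mat_adjoint A * A = 1\<^sub>m 3" by (rule mat_mult_left_right_inverse[OF A(1) a A(2)])
  have "Determinant.det A * Determinant.det (mat_adjoint A) = 1"
    using det_mult[OF A(1) a] A(2) by simp
  then show "mat_adjoint A \<in> carrier SU3"
    using a 1 A by (simp add: SU3_carrier_iff mat_adjoint_adjoint[OF A(1)])
qed

lemma group_SU3: "group SU3"
proof (rule groupI)
  fix A B assume "A \<in> carrier SU3" "B \<in> carrier SU3"
  then have A: "A \<in> carrier_mat 3 3" "A * mat_adjoint A = 1\<^sub>m 3" "Determinant.det A = 1"
    and B: "B \<in> carrier_mat 3 3" "B * mat_adjoint B = 1\<^sub>m 3" "Determinant.det B = 1"
    by (auto simp: SU3_carrier_iff)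
  note a = carrier_matD[OF mat_adjoint_carrier[OF A(1)]] and b = carrier_matD[OF mat_adjoint_carrier[OF B(1)]]
  have "A * B * mat_adjoint (A * B) = A * ((B * mat_adjoint B) * mat_adjoint A)"
    unfolding mat_adjoint_mult[OF A(1) B(1)] using carrier_matD[OF A(1)] carrier_matD[OF B(1)] a b
    by (simp add: mult_mat_assoc_dim)
  also have "\<dots> = 1\<^sub>m 3" unfolding B(2) using A mat_adjoint_carrier[OF A(1)] by simp
  finally show "A \<otimes>\<^bsub>SU3\<^esub> B \<in> carrier SU3" using A B by (simp add: SU3_carrier_iff det_mult[OF A(1) B(1)])
next
  have "mat_adjoint (1\<^sub>m 3) = (1\<^sub>m 3 :: complex mat)"
    using mat_adjoint_carrier[of "1\<^sub>m 3 :: complex mat" 3]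
    by (intro eq_matI) (auto simp: mat_adjoint_index[of _ 3])
  then show "\<one>\<^bsub>SU3\<^esub> \<in> carrier SU3" by (simp add: SU3_carrier_iff)
next
  fix A B C assume "A \<in> carrier SU3" "B \<in> carrier SU3" "C \<in> carrier SU3"
  then show "A \<otimes>\<^bsub>SU3\<^esub> B \<otimes>\<^bsub>SU3\<^esub> C = A \<otimes>\<^bsub>SU3\<^esub> (B \<otimes>\<^bsub>SU3\<^esub> C)"
    by (simp add: SU3_carrier_iff assoc_mult_mat[of _ 3 3 _ 3 _ 3])
next
  fix A assume A: "A \<in> carrier SU3"
  then show "\<one>\<^bsub>SU3\<^esub> \<otimes>\<^bsub>SU3\<^esub> A = A" by (auto simp: SU3_carrier_iff)
  show "\<exists>B\<in>carrier SU3. B \<otimes>\<^bsub>SU3\<^esub> A = \<one>\<^bsub>SU3\<^esub>" using SU3_adjoint[OF A] by auto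
qed

lemma SU3_inv: "A \<in> carrier SU3 \<Longrightarrow> inv\<^bsub>SU3\<^esub> A = mat_adjoint A"
  using group.inv_equality[OF group_SU3, of "mat_adjoint A" A] SU3_adjoint by simp

definition emat_adj :: "emat \<Rightarrow> emat" where
  "emat_adj A i j = eis_cnj (A j i)"

definition emat_det :: "emat \<Rightarrow> eis" where
  "emat_det A = eis_add (eis_add
     (eis_mul (A 0 0) (eis_add (eis_mul (A 1 1) (A 2 2)) (eis_mul (-1, 0) (eis_mul (A 1 2) (A 2 1)))))
     (eis_mul (A 0 1) (eis_add (eis_mul (A 1 2) (A 2 0)) (eis_mul (-1, 0) (eis_mul (A 1 0) (A 2 2))))))
     (eis_mul (A 0 2) (eis_add (eis_mul (A 1 0) (A 2 1)) (eis_mul (-1, 0) (eis_mul (A 1 1) (A 2 0)))))"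

lemma det_emat_val: "Determinant.det (emat_val A) = eis_val (emat_det A)"
proof -
  have "eis_val (-1, 0) = -1" by (simp add: eis_val_def)
  then show ?thesis unfolding det_3[OF emat_val_carrier] emat_det_def eis_val_add eis_val_mul
    by (simp add: emat_val_def algebra_simps)
qed

definition emat_diag :: "eis \<Rightarrow> eis \<Rightarrow> eis \<Rightarrow> emat" where
  "emat_diag a b c i j = (if i = j then [a, b, c] ! i else (0, 0))"

text \<open>The generators are Eisenstein matrices up to a scalar \<open>c\<close> that may lie
  outside the Eisenstein integers. Unitarity and determinant 1 separate into an identity for the
  code, checked by evaluation, and two scalar conditions on \<open>c\<close>.\<close>

lemma smult_emat_val_in_SU3:
  assumes d: "emat_eq (emat_mul A (emat_adj A)) (emat_diag (d, 0) (d, 0) (d, 0))"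
    and c: "c * cnj c * of_int d = 1" "c ^ 3 * eis_val (emat_det A) = 1"
  shows "c \<cdot>\<^sub>m emat_val A \<in> carrier SU3"
proof -
  have C: "c \<cdot>\<^sub>m emat_val A \<in> carrier_mat 3 3" by simp
  have adj: "mat_adjoint (c \<cdot>\<^sub>m emat_val A) = cnj c \<cdot>\<^sub>m emat_val (emat_adj A)"
    using carrier_matD[OF mat_adjoint_carrier[OF C]]
    by (intro eq_matI) (auto simp: mat_adjoint_index[OF C], auto simp: emat_val_def emat_adj_def eis_val_cnj)
  have "c \<cdot>\<^sub>m emat_val A * mat_adjoint (c \<cdot>\<^sub>m emat_val A) = (c * cnj c) \<cdot>\<^sub>m emat_val (emat_mul A (emat_adj A))"
    unfolding adj emat_val_mul
      mult_smult_assoc_mat[OF emat_val_carrier smult_carrier_mat[OF emat_val_carrier]]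
      mult_smult_distrib[OF emat_val_carrier emat_val_carrier]
    by (auto intro!: eq_matI)
  also have "\<dots> = (c * cnj c) \<cdot>\<^sub>m emat_val (emat_diag (d, 0) (d, 0) (d, 0))"
    using emat_val_cong[OF d] by simp
  also have "\<dots> = 1\<^sub>m 3"
    using c(1) by (intro eq_matI) (auto simp: emat_val_def emat_diag_def less_3_iff eis_val_def)
  finally show ?thesis using C c(2) by (simp add: SU3_carrier_iff det_emat_val)
qed

section \<open>The Heisenberg group and tables for its cosets\<close>

text \<open>\<open>heis a b c = S\<^sub>2\<^sup>a S\<^sub>1\<^sup>b T\<^sup>c\<close>.\<close>

definition heis :: "nat \<Rightarrow> nat \<Rightarrow> nat \<Rightarrow> complex mat" where
  "heis a b c = Matrix.mat 3 3 (\<lambda>(i, j). if j = (i + c) mod 3 then \<omega> ^ (a + b * i) else 0)"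

definition heis_code :: "nat \<Rightarrow> nat \<Rightarrow> nat \<Rightarrow> emat" where
  "heis_code a b c i j =
     (if j = (i + c) mod 3 then [(1, 0), (0, 1), (-1, -1)] ! ((a + b * i) mod 3) else (0, 0))"

lemma heis_carrier [simp]: "heis a b c \<in> carrier_mat 3 3"
  by (simp add: heis_def)

lemma heis_dim [simp]: "dim_row (heis a b c) = 3" "dim_col (heis a b c) = 3"
  by (simp_all add: heis_def)

lemma heis_code: "emat_val (heis_code a b c) = heis a b c"
proof -
  have "eis_val ([(1, 0), (0, 1), (-1, -1)] ! (n mod 3)) = \<omega> ^ n" for n
  proof -
    have "n mod 3 \<in> {0, 1, 2}" by auto
    then show ?thesis unfolding \<omega>_pow_mod[of n] using \<omega>_sq by (auto simp: eis_val_def)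
  qed
  then show ?thesis unfolding heis_def emat_val_def heis_code_def
    by (auto intro!: eq_matI simp: eis_val_def[of "(0, 0)"])
qed

text \<open>The term \<open>b' * c\<close> comes from moving \<open>T^c\<close> past
  \<open>S1^b'\<close>: since \<open>T S1 = \<omega> S1 T\<close>, each exchange costs one factor
  \<omega>.\<close>

lemma heis_mult: "heis a b c * heis a' b' c' = heis (a + a' + b' * c) (b + b') (c + c')"
proof (rule eq_matI)
  fix i j assume "i < dim_row (heis (a + a' + b' * c) (b + b') (c + c'))" "j < dim_col (heis (a + a' + b' * c) (b + b') (c + c'))"
  then have ij: "i < 3" "j < 3" by auto
  have "(heis a b c * heis a' b' c') $$ (i, j) =
    (\<Sum>r = 0..<3. if r = (i + c) mod 3 then \<omega> ^ (a + b * i) * heis a' b' c' $$ (r, j) else 0)"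
    unfolding mult_mat_index[OF heis_carrier heis_carrier ij] using ij by (intro sum.cong) (auto simp: heis_def)
  also have "\<dots> = \<omega> ^ (a + b * i) * heis a' b' c' $$ ((i + c) mod 3, j)" by simp
  also have "\<dots> = heis (a + a' + b' * c) (b + b') (c + c') $$ (i, j)"
  proof (cases "j = (i + (c + c')) mod 3")
    case True
    have "b' * ((i + c) mod 3) mod 3 = b' * (i + c) mod 3" by (simp add: mod_mult_right_eq)
    then have "(a + b * i + (a' + b' * ((i + c) mod 3))) mod 3 = (a + b * i + (a' + b' * (i + c))) mod 3"
      by (metis mod_add_right_eq)
    then have "\<omega> ^ (a + b * i + (a' + b' * ((i + c) mod 3))) = \<omega> ^ (a + b * i + (a' + b' * (i + c)))"
      by (rule \<omega>_pow_cong)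
    also have "a + b * i + (a' + b' * (i + c)) = a + a' + b' * c + (b + b') * i" by (simp add: algebra_simps)
    finally have 1: "\<omega> ^ (a + b * i) * \<omega> ^ (a' + b' * ((i + c) mod 3)) = \<omega> ^ (a + a' + b' * c + (b + b') * i)"
      by (simp only: power_add)
    have "heis a' b' c' $$ ((i + c) mod 3, j) = \<omega> ^ (a' + b' * ((i + c) mod 3))"
      using True ij by (simp add: heis_def mod_simps add.assoc)
    moreover have "heis (a + a' + b' * c) (b + b') (c + c') $$ (i, j) = \<omega> ^ (a + a' + b' * c + (b + b') * i)"
      using True ij by (simp add: heis_def)
    ultimately show ?thesis using 1 by (simp only:)
  qed (use ij in \<open>simp add: heis_def mod_simps add.assoc\<close>)
  finally show "(heis a b c * heis a' b' c') $$ (i, j) = heis (a + a' + b' * c) (b + b') (c + c') $$ (i, j)" .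
qed auto

lemma heis_cong: "a mod 3 = a' mod 3 \<Longrightarrow> b mod 3 = b' mod 3 \<Longrightarrow> c mod 3 = c' mod 3 \<Longrightarrow> heis a b c = heis a' b' c'"
proof -
  assume e: "a mod 3 = a' mod 3" "b mod 3 = b' mod 3" "c mod 3 = c' mod 3"
  have "(i + c) mod 3 = (i + c') mod 3" "\<omega> ^ (a + b * i) = \<omega> ^ (a' + b' * i)" for i
    using e by (metis mod_add_right_eq, intro \<omega>_pow_cong, metis mod_add_eq mod_mult_left_eq)
  then show ?thesis by (simp only: heis_def)
qed

lemma heis_inj:
  assumes "heis a b c = heis a' b' c'"
  shows "a mod 3 = a' mod 3" "b mod 3 = b' mod 3" "c mod 3 = c' mod 3"
proof -
  have e: "heis a b c $$ (i, j) = heis a' b' c' $$ (i, j)" for i j using assms by simp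
  show c: "c mod 3 = c' mod 3"
    using e[of 0 "c mod 3"] by (auto simp: heis_def \<omega>_neq_0 split: if_splits)
  show a: "a mod 3 = a' mod 3"
    using e[of 0 "c mod 3"] c by (intro \<omega>_pow_inj) (simp add: heis_def)
  have "(1 + c) mod 3 = (1 + c') mod 3" using c by (metis mod_add_right_eq)
  then have "\<omega> ^ (a + b) = \<omega> ^ (a' + b')" using e[of 1 "(1 + c) mod 3"] by (simp add: heis_def)
  then have "(a + b) mod 3 = (a' + b') mod 3" by (rule \<omega>_pow_inj)
  from mod_add_cong[OF this mod_mult_cong[OF refl a, of 2]]
  have "(b + 3 * a) mod 3 = (b' + 3 * a') mod 3" by (simp add: algebra_simps)
  then show "b mod 3 = b' mod 3" by simp
qed

lemma heis_one: "heis 0 0 0 = 1\<^sub>m 3"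
  by (auto simp: heis_def intro!: eq_matI)

text \<open>Modulo 3 the exponents are \<open>b * c - a\<close>, \<open>- b\<close> and
  \<open>- c\<close>, written without subtraction.\<close>

lemma heis_inverse: "heis a b c * heis (2 * a + 4 * b * c) (2 * b) (2 * c) = 1\<^sub>m 3"
proof -
  have "heis a b c * heis (2 * a + 4 * b * c) (2 * b) (2 * c) = heis (3 * (a + 2 * b * c)) (3 * b) (3 * c)"
    by (simp add: heis_mult algebra_simps)
  also have "\<dots> = heis 0 0 0" by (rule heis_cong) auto
  finally show ?thesis by (simp add: heis_one)
qed

text \<open>Coset representatives of \<open>\<langle>S\<^sub>1, S\<^sub>2, T\<rangle>\<close>: the matrices \<open>U\<^sup>j q\<^sub>k = \<epsilon>\<^sup>2\<^sup>j diag(1, 1, \<omega>\<^sup>j) q\<^sub>k\<close>, where the \<open>q\<^sub>k\<close> are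
  \<open>1\<close>, \<open>V\<^sup>2\<close>, \<open>V\<^sup>\<plusminus>\<^sup>1\<close>, \<open>U V\<^sup>\<plusminus>\<^sup>1 U\<^sup>-\<^sup>1\<close>, \<open>U\<^sup>2 V\<^sup>\<plusminus>\<^sup>1 U\<^sup>-\<^sup>2\<close>, lifting the quaternion group in \<open>SL(2, 3)\<close>.
  The table lists \<open>\<surd>-3 q\<^sub>k\<close>.\<close>

definition quat_tab :: "eis list list list" where
  "quat_tab = [[[(1, 2), (0, 0), (0, 0)], [(0, 0), (1, 2), (0, 0)], [(0, 0), (0, 0), (1, 2)]], [[(-1, -2), (0,
     0), (0, 0)], [(0, 0), (0, 0), (-1, -2)], [(0, 0), (-1, -2), (0, 0)]], [[(1, 0), (1, 0), (1, 0)],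
     [(1, 0), (0, 1), (-1, -1)], [(1, 0), (-1, -1), (0, 1)]], [[(-1, 0), (-1, 0), (-1, 0)], [(-1, 0),
     (1, 1), (0, -1)], [(-1, 0), (0, -1), (1, 1)]], [[(1, 0), (1, 0), (-1, -1)], [(1, 0), (0, 1), (0,
     1)], [(0, 1), (1, 0), (0, 1)]], [[(-1, 0), (-1, 0), (1, 1)], [(-1, 0), (1, 1), (-1, 0)], [(0,
     -1), (1, 1), (1, 1)]], [[(1, 0), (1, 0), (0, 1)], [(1, 0), (0, 1), (1, 0)], [(-1, -1), (0, 1),
     (0, 1)]], [[(-1, 0), (-1, 0), (0, -1)], [(-1, 0), (1, 1), (1, 1)], [(1, 1), (-1, 0), (1, 1)]]]"

definition rep_code :: "nat \<Rightarrow> nat \<Rightarrow> emat" where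
  "rep_code j k i l = eis_mul (if i = 2 then [(1, 0), (0, 1), (-1, -1)] ! j else (1, 0)) (quat_tab ! k ! i ! l)"

definition coset_rep :: "nat \<Rightarrow> nat \<Rightarrow> complex mat" where
  "coset_rep j k = (\<epsilon> ^ (2 * j) / (\<i> * sqrt 3)) \<cdot>\<^sub>m emat_val (rep_code j k)"

text \<open>Entries \<open>(k', a, b, c)\<close> and \<open>(a, b, c)\<close> at position \<open>(j, k)\<close> of the tables stand for
  \<open>V r\<^sub>j\<^sub>k = r\<^sub>j\<^sub>k\<^sub>' heis a b c\<close>, \<open>S\<^sub>1 r\<^sub>j\<^sub>k = r\<^sub>j\<^sub>k heis a b c\<close> and \<open>T r\<^sub>j\<^sub>k = r\<^sub>j\<^sub>k heis a b c\<close>.\<close>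

definition V_tab :: "(nat \<times> nat \<times> nat \<times> nat) list list" where
  "V_tab = [[(2, 0, 0, 0), (3, 0, 0, 0), (1, 0, 0, 0), (0, 0, 0, 0), (7, 1, 0, 0), (6, 1, 2, 0), (4, 0, 2,
     2), (5, 2, 2, 1)], [(6, 0, 0, 0), (7, 0, 1, 0), (5, 1, 0, 0), (4, 1, 2, 0), (2, 1, 1, 2), (3, 2,
     0, 1), (1, 0, 2, 0), (0, 0, 0, 0)], [(4, 0, 0, 0), (5, 0, 2, 0), (6, 2, 0, 2), (7, 2, 1, 1), (1,
     0, 1, 0), (0, 0, 0, 0), (3, 1, 0, 0), (2, 1, 2, 0)]]"

definition S1_tab :: "(nat \<times> nat \<times> nat) list list" where
  "S1_tab = [[(0, 1, 0), (0, 2, 0), (0, 0, 2), (0, 0, 1), (2, 1, 2), (0, 2, 1), (1, 2, 2), (0, 1, 1)], [(0,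
     1, 0), (0, 2, 0), (0, 0, 2), (0, 0, 1), (2, 1, 2), (0, 2, 1), (1, 2, 2), (0, 1, 1)], [(0, 1, 0),
     (0, 2, 0), (0, 0, 2), (0, 0, 1), (2, 1, 2), (0, 2, 1), (1, 2, 2), (0, 1, 1)]]"

definition T_tab :: "(nat \<times> nat \<times> nat) list list" where
  "T_tab = [[(0, 0, 1), (0, 0, 2), (0, 1, 0), (0, 2, 0), (1, 2, 2), (2, 1, 1), (1, 2, 1), (2, 1, 2)], [(0,
     1, 1), (0, 2, 2), (2, 1, 2), (2, 2, 1), (1, 0, 1), (0, 0, 2), (0, 1, 0), (0, 2, 0)], [(0, 2, 1),
     (0, 1, 2), (1, 1, 1), (1, 2, 2), (0, 1, 0), (0, 2, 0), (0, 0, 2), (2, 0, 1)]]"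

definition V_code :: emat where
  "V_code = emat_of_list [[(1, 0), (1, 0), (1, 0)], [(1, 0), (0, 1), (-1, -1)], [(1, 0), (-1, -1), (0, 1)]]"

definition emat_smult :: "eis \<Rightarrow> emat \<Rightarrow> emat" where
  "emat_smult z A i j = eis_mul z (A i j)"

definition rep_idx :: "(nat \<times> nat) list" where
  "rep_idx = List.product [0, 1, 2] [0, 1, 2, 3, 4, 5, 6, 7]"

text \<open>The left-hand side of \<open>V r = r' h\<close> carries two denominators (those of
  \<open>V\<close> and \<open>r\<close>) and the right-hand side one. Clearing them leaves a factor
  square root of -3, which is the code \<open>(1, 2)\<close>.\<close>

lemma V_check: "list_all (\<lambda>(j, k). case V_tab ! j ! k of (k', a, b, c) \<Rightarrow> k' < 8 \<and>
    emat_eq (emat_mul V_code (rep_code j k)) (emat_smult (1, 2) (emat_mul (rep_code j k') (heis_code a b c)))) rep_idx"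
  by code_simp

lemma S1_check: "list_all (\<lambda>(j, k). case S1_tab ! j ! k of (a, b, c) \<Rightarrow>
    emat_eq (emat_mul (heis_code 0 1 0) (rep_code j k)) (emat_mul (rep_code j k) (heis_code a b c))) rep_idx"
  by code_simp

lemma T_check: "list_all (\<lambda>(j, k). case T_tab ! j ! k of (a, b, c) \<Rightarrow>
    emat_eq (emat_mul (heis_code 0 0 1) (rep_code j k)) (emat_mul (rep_code j k) (heis_code a b c))) rep_idx"
  by code_simp

section \<open>Generators in SU(3) and their action on the coset representatives\<close>

lemma cmod_\<epsilon>_pow: "\<epsilon> ^ n * cnj (\<epsilon> ^ n) = 1"
  unfolding complex_norm_square[symmetric] by (simp add: norm_power \<epsilon>_cis)

text \<open>For \<open>U\<close>, the identity \<open>\<epsilon>^5 = \<epsilon>^2 \<omega>\<close>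
  separates off a scalar and leaves Eisenstein entries.\<close>

lemma generators_eq:
  "S1 = heis 0 1 0" "S2 = heis 1 0 0" "T = heis 0 0 1"
  "V = (1 / (\<i> * sqrt 3)) \<cdot>\<^sub>m emat_val V_code"
  "U = \<epsilon> ^ 2 \<cdot>\<^sub>m emat_val (emat_diag (1, 0) (1, 0) (0, 1))"
proof -
  have e5: "\<epsilon> ^ 5 = \<epsilon> ^ 2 * \<omega>" unfolding \<epsilon>_cube[symmetric] power_add[symmetric] by simp
  have w: "eis_val (1, 0) = 1" "eis_val (0, 1) = \<omega>" "eis_val (-1, -1) = \<omega> ^ 2" "eis_val (0, 0) = 0"
    by (simp_all add: eis_val_def \<omega>_sq)
  show "S1 = heis 0 1 0" "S2 = heis 1 0 0" "T = heis 0 0 1"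
    by (auto simp: S1_def S2_def T_def heis_def mat_of_rows_list_def less_3_iff intro!: eq_matI)
  show "V = (1 / (\<i> * sqrt 3)) \<cdot>\<^sub>m emat_val V_code"
    unfolding V_def V_code_def emat_val_def emat_of_list_def
    by (intro arg_cong2[of _ _ _ _ "(\<cdot>\<^sub>m)"] refl eq_matI) (auto simp: mat_of_rows_list_def less_3_iff w)
  show "U = \<epsilon> ^ 2 \<cdot>\<^sub>m emat_val (emat_diag (1, 0) (1, 0) (0, 1))"
    unfolding U_def emat_val_def emat_diag_def
    by (intro eq_matI) (auto simp: mat_of_rows_list_def less_3_iff w e5)
qed

abbreviation generators :: "complex mat set" where
  "generators \<equiv> {S1, S2, T, V, U}"

lemma heis_in_SU3: "heis a b c \<in> carrier SU3" if "a < 3" "b < 3" "c < 3"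
proof -
  have "list_all (\<lambda>a. list_all (\<lambda>b. list_all (\<lambda>c.
    emat_eq (emat_mul (heis_code a b c) (emat_adj (heis_code a b c))) (emat_diag (1, 0) (1, 0) (1, 0)) \<and>
    emat_det (heis_code a b c) = (1, 0)) [0,1,2]) [0,1,2]) [0,1,2]" by code_simp
  then have "emat_eq (emat_mul (heis_code a b c) (emat_adj (heis_code a b c))) (emat_diag (1, 0) (1, 0) (1, 0)) \<and>
    emat_det (heis_code a b c) = (1, 0)"
    using that unfolding less_3_iff by auto
  then have "1 \<cdot>\<^sub>m emat_val (heis_code a b c) \<in> carrier SU3"
    by (intro smult_emat_val_in_SU3[of _ 1]) (auto simp: eis_val_def)
  moreover have "1 \<cdot>\<^sub>m heis a b c = heis a b c" by (auto intro!: eq_matI)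
  ultimately show ?thesis by (simp add: heis_code)
qed

lemma sqrt_neg3_sq: "(\<i> * complex_of_real (sqrt 3)) * (\<i> * complex_of_real (sqrt 3)) = -3"
  by (simp add: complex_eq_iff)

lemma generators_in_SU3: "generators \<subseteq> carrier SU3"
proof -
  let ?s = "\<i> * complex_of_real (sqrt 3)"
  have s: "?s \<noteq> 0" "cnj ?s = - ?s" by simp_all
  \<comment> \<open>The determinant -3 - 6 \<omega> is -3 times the square root of -3, that is its
    cube; dividing \<open>V_code\<close> by that root therefore gives determinant 1.\<close>
  have V: "emat_eq (emat_mul V_code (emat_adj V_code)) (emat_diag (3, 0) (3, 0) (3, 0))"
    and Vd: "emat_det V_code = (-3, -6)" by code_simp+
  have "(1 / ?s) * cnj (1 / ?s) * of_int 3 = - (3 / (?s * ?s))" by (simp add: s)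
  then have V1: "(1 / ?s) * cnj (1 / ?s) * of_int 3 = 1" unfolding sqrt_neg3_sq by simp
  have "(1 / ?s) ^ 3 * eis_val (-3, -6) = (1 / ?s) ^ 3 * (-3 * ?s)"
    by (simp only: sqrt_neg3) (simp add: eis_val_def algebra_simps)
  also have "\<dots> = -3 / (?s * ?s)" using s by (simp add: field_simps power3_eq_cube)
  finally have V2: "(1 / ?s) ^ 3 * eis_val (-3, -6) = 1" unfolding sqrt_neg3_sq by simp
  have "V \<in> carrier SU3"
    unfolding generators_eq by (rule smult_emat_val_in_SU3[OF V V1]) (simp only: Vd V2)
  moreover
  let ?D = "emat_diag (1, 0) (1, 0) (0, 1)"
  have D: "emat_eq (emat_mul ?D (emat_adj ?D)) (emat_diag (1, 0) (1, 0) (1, 0))"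
    and Dd: "emat_det ?D = (0, 1)" by code_simp+
  have U1: "\<epsilon> ^ 2 * cnj (\<epsilon> ^ 2) * of_int 1 = 1" using cmod_\<epsilon>_pow[of 2] by simp
  have "(\<epsilon> ^ 2) ^ 3 * \<omega> = \<omega> ^ 3"
    unfolding \<epsilon>_cube[symmetric] by (simp add: power_mult[symmetric] power_add[symmetric])
  then have U2: "(\<epsilon> ^ 2) ^ 3 * eis_val (emat_det ?D) = 1"
    unfolding Dd by (simp add: eis_val_def \<omega>_cube)
  have "U \<in> carrier SU3"
    unfolding generators_eq by (rule smult_emat_val_in_SU3[OF D U1 U2])
  ultimately show ?thesis using heis_in_SU3 by (simp add: generators_eq(1-3))
qed

lemma rep_idx_mem:
  assumes "j < 3" "k < 8"
  shows "(j, k) \<in> set rep_idx"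
proof -
  have "j \<in> set [0, 1, 2]" "k \<in> set [0, 1, 2, 3, 4, 5, 6, 7]" using assms by auto
  then show ?thesis unfolding rep_idx_def set_product by blast
qed

lemma coset_rep_carrier [simp]: "coset_rep j k \<in> carrier_mat 3 3"
  by (simp add: coset_rep_def)

lemma coset_rep_dim [simp]: "dim_row (coset_rep j k) = 3" "dim_col (coset_rep j k) = 3"
  by (simp_all add: coset_rep_def)

lemma emat_val_smult: "emat_val (emat_smult z A) = eis_val z \<cdot>\<^sub>m emat_val A"
  by (auto simp: emat_val_def emat_smult_def eis_val_mul intro!: eq_matI)

lemma smult_mult_smult:
  fixes A B :: "complex mat"
  assumes "A \<in> carrier_mat n n" "B \<in> carrier_mat n n"
  shows "(a \<cdot>\<^sub>m A) * (b \<cdot>\<^sub>m B) = (a * b) \<cdot>\<^sub>m (A * B)"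
  unfolding mult_smult_assoc_mat[OF assms(1) smult_carrier_mat[OF assms(2)]] mult_smult_distrib[OF assms]
  by (auto intro!: eq_matI)

lemma V_mult_coset_rep:
  assumes "j < 3" "k < 8" "V_tab ! j ! k = (k', a, b, c)"
  shows "k' < 8" "V * coset_rep j k = coset_rep j k' * heis a b c"
proof -
  let ?s = "\<i> * complex_of_real (sqrt 3)"
  have *: "k' < 8 \<and> emat_eq (emat_mul V_code (rep_code j k)) (emat_smult (1, 2) (emat_mul (rep_code j k') (heis_code a b c)))"
    using V_check rep_idx_mem[OF assms(1,2)] assms(3) unfolding list_all_iff by fastforce
  then show "k' < 8" by simp
  have e: "eis_val (1, 2) = ?s" unfolding sqrt_neg3 by (simp add: eis_val_def)
  have "V * coset_rep j k = (1 / ?s * (\<epsilon> ^ (2 * j) / ?s)) \<cdot>\<^sub>m emat_val (emat_mul V_code (rep_code j k))"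
    unfolding generators_eq coset_rep_def emat_val_mul by (rule smult_mult_smult[OF emat_val_carrier emat_val_carrier])
  also have "emat_val (emat_mul V_code (rep_code j k)) = ?s \<cdot>\<^sub>m (emat_val (rep_code j k') * heis a b c)"
    using emat_val_cong[OF conjunct2[OF *]] unfolding emat_val_smult emat_val_mul heis_code e .
  also have "(1 / ?s * (\<epsilon> ^ (2 * j) / ?s)) \<cdot>\<^sub>m \<dots> = (\<epsilon> ^ (2 * j) / ?s) \<cdot>\<^sub>m (emat_val (rep_code j k') * heis a b c)"
    by (auto intro!: eq_matI)
  also have "\<dots> = coset_rep j k' * heis a b c"
    unfolding coset_rep_def by (rule mult_smult_assoc_mat[OF emat_val_carrier heis_carrier, symmetric])
  finally show "V * coset_rep j k = coset_rep j k' * heis a b c" .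
qed

lemma code_mult_coset_rep:
  assumes "emat_eq (emat_mul A (rep_code j k)) (emat_mul (rep_code j k) (heis_code a b c))"
  shows "emat_val A * coset_rep j k = coset_rep j k * heis a b c"
proof -
  have "emat_val A * coset_rep j k = (\<epsilon> ^ (2 * j) / (\<i> * sqrt 3)) \<cdot>\<^sub>m (emat_val A * emat_val (rep_code j k))"
    unfolding coset_rep_def by (rule mult_smult_distrib[OF emat_val_carrier emat_val_carrier])
  also have "emat_val A * emat_val (rep_code j k) = emat_val (rep_code j k) * heis a b c"
    using emat_val_cong[OF assms] unfolding emat_val_mul heis_code .
  also have "(\<epsilon> ^ (2 * j) / (\<i> * sqrt 3)) \<cdot>\<^sub>m \<dots> = coset_rep j k * heis a b c"
    unfolding coset_rep_def by (rule mult_smult_assoc_mat[OF emat_val_carrier heis_carrier, symmetric])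
  finally show ?thesis .
qed

lemma S1_mult_coset_rep:
  assumes "j < 3" "k < 8" "S1_tab ! j ! k = (a, b, c)"
  shows "S1 * coset_rep j k = coset_rep j k * heis a b c"
  unfolding generators_eq heis_code[of 0 1 0, symmetric]
  by (rule code_mult_coset_rep)
    (use S1_check rep_idx_mem[OF assms(1,2)] assms(3) in \<open>unfold list_all_iff, fastforce\<close>)

lemma T_mult_coset_rep:
  assumes "j < 3" "k < 8" "T_tab ! j ! k = (a, b, c)"
  shows "T * coset_rep j k = coset_rep j k * heis a b c"
  unfolding generators_eq heis_code[of 0 0 1, symmetric]
  by (rule code_mult_coset_rep)
    (use T_check rep_idx_mem[OF assms(1,2)] assms(3) in \<open>unfold list_all_iff, fastforce\<close>)

lemma S2_mult_coset_rep: "S2 * coset_rep j k = coset_rep j k * heis 1 0 0"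
proof -
  have e: "heis 1 0 0 = \<omega> \<cdot>\<^sub>m 1\<^sub>m 3" by (auto simp: heis_def intro!: eq_matI)
  show ?thesis unfolding generators_eq e
    by (simp add: mult_smult_distrib[of _ 3 3 _ 3] mult_smult_assoc_mat[of _ 3 3 _ 3])
qed

lemma U_check: "list_all (\<lambda>k. list_all (\<lambda>j.
    emat_eq (emat_mul (emat_diag (1, 0) (1, 0) (0, 1)) (rep_code j k)) (rep_code (Suc j mod 3) k)) [0, 1, 2]) [0, 1, 2, 3, 4, 5, 6, 7]"
  by code_simp

text \<open>\<open>U\<close> raises the index \<open>j\<close> by 1. Wrapping around from 2 to 0
  costs \<open>U^3 = \<epsilon>^6 = \<omega>^2\<close>, which is the central element
  \<open>heis 2 0 0\<close>.\<close>

lemma U_mult_coset_rep: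
  assumes "j < 3" "k < 8"
  shows "U * coset_rep j k = coset_rep (Suc j mod 3) k * heis (if j = 2 then 2 else 0) 0 0"
proof -
  let ?D = "emat_diag (1, 0) (1, 0) (0, 1)" and ?s = "\<i> * complex_of_real (sqrt 3)"
  let ?w = "if j = 2 then \<omega> ^ 2 else 1"
  have "j \<in> set [0, 1, 2]" "k \<in> set [0, 1, 2, 3, 4, 5, 6, 7]" using assms by auto
  then have *: "emat_eq (emat_mul ?D (rep_code j k)) (rep_code (Suc j mod 3) k)"
    using U_check unfolding list_all_iff by blast
  have "\<omega> ^ 2 = \<epsilon> ^ 6" unfolding \<epsilon>_cube[symmetric] power_mult[symmetric] by simp
  then have p: "\<epsilon> ^ 2 * \<epsilon> ^ (2 * j) = \<epsilon> ^ (2 * (Suc j mod 3)) * ?w"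
    using assms(1) unfolding less_3_iff power_add[symmetric] by (elim disjE) simp_all
  have "U * coset_rep j k = (\<epsilon> ^ 2 * (\<epsilon> ^ (2 * j) / ?s)) \<cdot>\<^sub>m emat_val (emat_mul ?D (rep_code j k))"
    unfolding generators_eq coset_rep_def emat_val_mul by (rule smult_mult_smult[OF emat_val_carrier emat_val_carrier])
  also have "\<epsilon> ^ 2 * (\<epsilon> ^ (2 * j) / ?s) = (\<epsilon> ^ 2 * \<epsilon> ^ (2 * j)) / ?s" by (rule times_divide_eq_right)
  also have "\<dots> = \<epsilon> ^ (2 * (Suc j mod 3)) / ?s * ?w" unfolding p by (rule times_divide_eq_left[symmetric])
  also have "\<dots> \<cdot>\<^sub>m emat_val (emat_mul ?D (rep_code j k)) = ?w \<cdot>\<^sub>m coset_rep (Suc j mod 3) k"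
    unfolding emat_val_cong[OF *] coset_rep_def by (intro eq_matI) (simp_all only: index_smult_mat mult_ac)
  also have "\<dots> = coset_rep (Suc j mod 3) k * (?w \<cdot>\<^sub>m 1\<^sub>m 3)"
    unfolding mult_smult_distrib[OF coset_rep_carrier one_carrier_mat] right_mult_one_mat[OF coset_rep_carrier] ..
  also have "?w \<cdot>\<^sub>m 1\<^sub>m 3 = heis (if j = 2 then 2 else 0) 0 0"
    by (auto simp: heis_def intro!: eq_matI)
  finally show ?thesis .
qed

definition heis_cosets :: "complex mat set" where
  "heis_cosets = (\<lambda>((j, k), a, b, c). coset_rep j k * heis a b c) `
     (({0..<3} \<times> {0..<8}) \<times> {0..<3} \<times> {0..<3} \<times> {0..<3})"

lemma heis_cosetsI: "j < 3 \<Longrightarrow> k < 8 \<Longrightarrow> coset_rep j k * heis a b c \<in> heis_cosets"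
  unfolding heis_cosets_def
  by (rule image_eqI[of _ _ "((j, k), a mod 3, b mod 3, c mod 3)"])
    (auto intro!: arg_cong2[of _ _ _ _ "(*)"] heis_cong)

lemma heis_cosetsE:
  assumes "x \<in> heis_cosets"
  obtains j k a b c where "j < 3" "k < 8" "a < 3" "b < 3" "c < 3" "x = coset_rep j k * heis a b c"
  using assms unfolding heis_cosets_def by auto

text \<open>By the tables a generator sends each representative to a representative times a
  Heisenberg element, and the latter is absorbed into the coset.\<close>

lemma generator_mult_heis_cosets:
  assumes g: "g \<in> generators" and x: "x \<in> heis_cosets"
  shows "g * x \<in> heis_cosets"
proof -
  obtain j k a b c where jk: "j < 3" "k < 8" and x: "x = coset_rep j k * heis a b c"
    using heis_cosetsE[OF x] by metis
  obtain k1 a1 b1 c1 where v: "V_tab ! j ! k = (k1, a1, b1, c1)" by (cases "V_tab ! j ! k")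
  obtain a2 b2 c2 where s: "S1_tab ! j ! k = (a2, b2, c2)" by (cases "S1_tab ! j ! k")
  obtain a3 b3 c3 where t: "T_tab ! j ! k = (a3, b3, c3)" by (cases "T_tab ! j ! k")
  have m: "Suc j mod 3 < 3" by simp
  have "\<exists>j' k' a' b' c'. j' < 3 \<and> k' < 8 \<and> g * coset_rep j k = coset_rep j' k' * heis a' b' c'"
    using g
  proof (elim insertE emptyE)
    assume "g = S1" then show ?thesis using S1_mult_coset_rep[OF jk s] jk by blast
  next
    assume "g = S2" then show ?thesis using S2_mult_coset_rep[of j k] jk by blast
  next
    assume "g = T" then show ?thesis using T_mult_coset_rep[OF jk t] jk by blast
  next
    assume "g = V" then show ?thesis using V_mult_coset_rep[OF jk v] jk by blast
  next
    assume "g = U" then show ?thesis using U_mult_coset_rep[OF jk] jk m by blast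
  qed
  then obtain j' k' a' b' c' where r: "j' < 3" "k' < 8" "g * coset_rep j k = coset_rep j' k' * heis a' b' c'" by blast
  have gd: "g \<in> carrier_mat 3 3" using g generators_in_SU3 SU3_carrier_iff by blast
  have "g * x = g * coset_rep j k * heis a b c"
    unfolding x using gd by (simp add: mult_mat_assoc_dim)
  also have "\<dots> = coset_rep j' k' * (heis a' b' c' * heis a b c)" unfolding r by (simp add: mult_mat_assoc_dim)
  finally show ?thesis unfolding heis_mult using heis_cosetsI[OF r(1,2)] by simp
qed

lemma coset_rep_0: "coset_rep 0 0 = 1\<^sub>m 3"
proof -
  have "emat_eq (rep_code 0 0) (emat_diag (1, 2) (1, 2) (1, 2))" by code_simp
  then have "emat_val (rep_code 0 0) = emat_val (emat_diag (1, 2) (1, 2) (1, 2))" by (rule emat_val_cong)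
  also have "\<dots> = (\<i> * complex_of_real (sqrt 3)) \<cdot>\<^sub>m 1\<^sub>m 3"
    unfolding sqrt_neg3 by (intro eq_matI) (auto simp: emat_val_def emat_diag_def less_3_iff eis_val_def)
  finally show ?thesis by (auto simp: coset_rep_def intro!: eq_matI)
qed

section \<open>Enumeration of the 648 elements\<close>

interpretation SU3: group SU3 by (rule group_SU3)

lemma subgroup_Sigma: "subgroup Sigma_216x3 SU3"
  unfolding Sigma_216x3_def by (rule SU3.generate_is_subgroup[OF generators_in_SU3])

lemma Sigma_mult: "A \<in> Sigma_216x3 \<Longrightarrow> B \<in> Sigma_216x3 \<Longrightarrow> A * B \<in> Sigma_216x3"
  using subgroup.m_closed[OF subgroup_Sigma] by simp

lemma Sigma_generators: "generators \<subseteq> Sigma_216x3"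
  unfolding Sigma_216x3_def by (auto intro: generate.incl)

lemma Sigma_one: "1\<^sub>m 3 \<in> Sigma_216x3"
  using subgroup.one_closed[OF subgroup_Sigma] by simp

lemma heis_in_Sigma: "heis a b c \<in> Sigma_216x3"
proof -
  have g: "heis 1 0 0 \<in> Sigma_216x3" "heis 0 1 0 \<in> Sigma_216x3" "heis 0 0 1 \<in> Sigma_216x3"
    using Sigma_generators by (auto simp: generators_eq(1-3))
  have "heis a 0 0 \<in> Sigma_216x3" for a
  proof (induction a)
    case (Suc a)
    then show ?case using Sigma_mult[OF g(1) Suc] by (simp add: heis_mult)
  qed (simp add: heis_one Sigma_one)
  moreover have "heis 0 b 0 \<in> Sigma_216x3" for b
  proof (induction b)
    case (Suc b)
    then show ?case using Sigma_mult[OF g(2) Suc] by (simp add: heis_mult)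
  qed (simp add: heis_one Sigma_one)
  moreover have "heis 0 0 c \<in> Sigma_216x3" for c
  proof (induction c)
    case (Suc c)
    then show ?case using Sigma_mult[OF g(3) Suc] by (simp add: heis_mult)
  qed (simp add: heis_one Sigma_one)
  ultimately have "heis a 0 0 * heis 0 b 0 * heis 0 0 c \<in> Sigma_216x3" using Sigma_mult by blast
  then show ?thesis by (simp add: heis_mult)
qed

lemma Sigma_cancel_heis:
  assumes M: "M \<in> carrier_mat 3 3" and "M * heis a b c \<in> Sigma_216x3"
  shows "M \<in> Sigma_216x3"
proof -
  have "M * heis a b c * heis (2 * a + 4 * b * c) (2 * b) (2 * c) \<in> Sigma_216x3"
    using assms(2) heis_in_Sigma by (rule Sigma_mult)
  also have "M * heis a b c * heis (2 * a + 4 * b * c) (2 * b) (2 * c) = M * 1\<^sub>m 3"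
    unfolding heis_inverse[of a b c, symmetric] using M by (simp add: mult_mat_assoc_dim)
  finally show ?thesis using M by simp
qed

text \<open>Every representative is reached from the identity: \<open>U\<close> runs through all
  \<open>j\<close> for fixed \<open>k\<close>, and \<open>V\<close> changes \<open>k\<close>. The
  Heisenberg factors picked up on the way are cancelled inside the group.\<close>

lemma coset_rep_in_Sigma:
  assumes "j < 3" "k < 8"
  shows "coset_rep j k \<in> Sigma_216x3"
proof -
  define P where "P k \<longleftrightarrow> (\<forall>j<3. coset_rep j k \<in> Sigma_216x3)" for k
  have Ustep: "coset_rep (Suc j mod 3) k \<in> Sigma_216x3" if "j < 3" "k < 8" "coset_rep j k \<in> Sigma_216x3" for j k
    using Sigma_mult[of U "coset_rep j k"] that Sigma_generators U_mult_coset_rep[OF that(1,2)]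
    by (intro Sigma_cancel_heis[of "coset_rep (Suc j mod 3) k"]) auto
  have P: "P k" if "j < 3" "k < 8" "coset_rep j k \<in> Sigma_216x3" for j k
  proof -
    have a: "coset_rep (Suc j mod 3) k \<in> Sigma_216x3" by (rule Ustep[OF that])
    have b: "coset_rep (Suc (Suc j mod 3) mod 3) k \<in> Sigma_216x3" by (rule Ustep[OF _ that(2) a]) simp
    show ?thesis using that a b unfolding P_def less_3_iff by (auto simp: numeral_2_eq_2)
  qed
  have Vstep: "P k'" if "P k" "j < 3" "k < 8" "V_tab ! j ! k = (k', a, b, c)" for j k k' a b c
  proof (rule P[OF that(2) V_mult_coset_rep(1)[OF that(2-4)]])
    show "coset_rep j k' \<in> Sigma_216x3"
      using Sigma_mult[of V "coset_rep j k"] that(1,2) Sigma_generators V_mult_coset_rep(2)[OF that(2-4)]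
      unfolding P_def by (intro Sigma_cancel_heis[of "coset_rep j k'"]) auto
  qed
  have 0: "P 0" using P[of 0 0] Sigma_one by (simp add: coset_rep_0)
  \<comment> \<open>The paths through the \<open>V\<close> table are 0, 2, 1, 3 and 0, 6 and 0, 4,
    7, 5; each step names the \<open>j\<close> at which its entry is found.\<close>
  have 2: "P 2" by (rule Vstep[OF 0, of 0 2]) (simp_all add: V_tab_def)
  have 6: "P 6" by (rule Vstep[OF 0, of 1 6]) (simp_all add: V_tab_def)
  have 4: "P 4" by (rule Vstep[OF 0, of 2 4]) (simp_all add: V_tab_def)
  have 1: "P 1" by (rule Vstep[OF 2, of 0 1]) (simp_all add: V_tab_def)
  have 3: "P 3" by (rule Vstep[OF 1, of 0 3]) (simp_all add: V_tab_def)
  have 7: "P 7" by (rule Vstep[OF 4, of 0 7]) (simp_all add: V_tab_def)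
  have 5: "P 5" by (rule Vstep[OF 7, of 0 5]) (simp_all add: V_tab_def)
  have "k = 0 \<or> k = 1 \<or> k = 2 \<or> k = 3 \<or> k = 4 \<or> k = 5 \<or> k = 6 \<or> k = 7" using assms by auto
  then have "P k" using 0 1 2 3 4 5 6 7 by blast
  then show ?thesis using assms by (simp add: P_def)
qed

lemma heis_cosets_subset: "heis_cosets \<subseteq> Sigma_216x3"
proof
  fix x assume "x \<in> heis_cosets"
  then obtain j k a b c where "j < 3" "k < 8" "x = coset_rep j k * heis a b c"
    by (elim heis_cosetsE)
  then show "x \<in> Sigma_216x3" using Sigma_mult[OF coset_rep_in_Sigma heis_in_Sigma] by simp
qed

text \<open>Left multiplication by a generator maps the finite set of cosets to itself, hence permutes it;
  so the elements permuting it form a subgroup containing the generators.\<close>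

lemma Sigma_eq: "Sigma_216x3 = heis_cosets"
proof
  let ?X = heis_cosets
  have Xc: "?X \<subseteq> carrier SU3" using heis_cosets_subset subgroup.subset[OF subgroup_Sigma] by blast
  have fin: "finite ?X" by (simp add: heis_cosets_def)
  have perm: "(\<lambda>x. h \<otimes>\<^bsub>SU3\<^esub> x) ` ?X = ?X" if h: "h \<in> generators" for h
  proof (rule endo_inj_surj[OF fin])
    show "(\<lambda>x. h \<otimes>\<^bsub>SU3\<^esub> x) ` ?X \<subseteq> ?X" using generator_mult_heis_cosets[OF h] by auto
    show "inj_on (\<lambda>x. h \<otimes>\<^bsub>SU3\<^esub> x) ?X"
      using SU3.inj_on_cmult[of h] h generators_in_SU3 Xc by (meson inj_on_subset subsetD)
  qed
  show "Sigma_216x3 \<subseteq> ?X"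
  proof
    fix g assume "g \<in> Sigma_216x3"
    then have "g \<in> carrier SU3 \<and> (\<lambda>x. g \<otimes>\<^bsub>SU3\<^esub> x) ` ?X = ?X"
      unfolding Sigma_216x3_def
    proof (induction rule: generate.induct)
      case one
      have "(\<lambda>x. \<one>\<^bsub>SU3\<^esub> \<otimes>\<^bsub>SU3\<^esub> x) ` ?X = (\<lambda>x. x) ` ?X" using Xc by (intro image_cong refl SU3.l_one) auto
      then show ?case by (simp only: image_ident SU3.one_closed)
    next
      case (incl h)
      then show ?case using perm generators_in_SU3 by blast
    next
      case (inv h)
      then have h: "h \<in> carrier SU3" using generators_in_SU3 by blast
      have "(\<lambda>x. inv\<^bsub>SU3\<^esub> h \<otimes>\<^bsub>SU3\<^esub> x) ` ?X = (\<lambda>x. inv\<^bsub>SU3\<^esub> h \<otimes>\<^bsub>SU3\<^esub> x) ` (\<lambda>x. h \<otimes>\<^bsub>SU3\<^esub> x) ` ?X"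
        by (simp only: perm[OF inv])
      also have "\<dots> = (\<lambda>x. x) ` ?X"
        unfolding image_image using Xc h by (intro image_cong refl) (auto simp del: SU3_simps simp: SU3.m_assoc[symmetric])
      finally show ?case using h by (simp del: SU3_simps)
    next
      case (eng g h)
      have "(\<lambda>x. g \<otimes>\<^bsub>SU3\<^esub> h \<otimes>\<^bsub>SU3\<^esub> x) ` ?X = (\<lambda>x. g \<otimes>\<^bsub>SU3\<^esub> x) ` (\<lambda>x. h \<otimes>\<^bsub>SU3\<^esub> x) ` ?X"
        unfolding image_image using Xc eng by (intro image_cong refl) (auto simp del: SU3_simps simp: SU3.m_assoc)
      then show ?case using eng by (simp del: SU3_simps)
    qed
    moreover have "1\<^sub>m 3 \<in> ?X" using heis_cosetsI[of 0 0 0 0 0] by (simp add: coset_rep_0 heis_one)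
    ultimately have "g \<otimes>\<^bsub>SU3\<^esub> \<one>\<^bsub>SU3\<^esub> \<in> ?X" "g \<in> carrier SU3" by (auto simp del: SU3_simps(1))
    then show "g \<in> ?X" by (simp only: SU3.r_one)
  qed
qed (rule heis_cosets_subset)

lemma mod_3_add_cancel:
  fixes q y y' :: nat
  assumes "(q + y) mod 3 = (y' + q) mod 3"
  shows "y mod 3 = y' mod 3"
proof -
  from mod_add_cong[OF assms refl, of "2 * q"]
  have "(y + 3 * q) mod 3 = (y' + 3 * q) mod 3" by (simp add: algebra_simps)
  then show ?thesis by simp
qed

lemma SU3_left_cancel:
  assumes M: "M \<in> carrier SU3" and A: "A \<in> carrier_mat 3 3" and B: "B \<in> carrier_mat 3 3" and eq: "M * A = M * B"
  shows "A = B"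
proof -
  have m: "M \<in> carrier_mat 3 3" using M by (simp add: SU3_carrier_iff)
  have "X = mat_adjoint M * (M * X)" if X: "X \<in> carrier_mat 3 3" for X
  proof -
    have "mat_adjoint M * (M * X) = mat_adjoint M * M * X"
      by (rule assoc_mult_mat[OF mat_adjoint_carrier[OF m] m X, symmetric])
    then show ?thesis unfolding SU3_adjoint(2)[OF M] using X by simp
  qed
  from this[OF A] this[OF B] eq show ?thesis by simp
qed

text \<open>An element \<open>r\<close> of the group acts by conjugation on the Heisenberg group modulo its centre, and
  cosets are distinguished by the images of \<open>S\<^sub>1\<close> and \<open>T\<close>.\<close>

lemma conjugation_determines_coset:
  assumes r: "r \<in> carrier SU3" "r' \<in> carrier SU3" and A: "A \<in> carrier_mat 3 3"
    and eq: "r * heis a b c = r' * heis a' b' c'"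
    and s: "A * r = r * heis x y z" "A * r' = r' * heis x' y' z'"
  shows "y mod 3 = y' mod 3" "z mod 3 = z' mod 3"
proof -
  have rc: "r \<in> carrier_mat 3 3" "r' \<in> carrier_mat 3 3" using r by (auto simp: SU3_carrier_iff)
  note d = carrier_matD[OF rc(1)] carrier_matD[OF rc(2)] carrier_matD[OF A]
  obtain p q t where P: "heis a' b' c' * heis (2 * a + 4 * b * c) (2 * b) (2 * c) = heis p q t"
    using heis_mult by blast
  have "r = r * (heis a b c * heis (2 * a + 4 * b * c) (2 * b) (2 * c))"
    unfolding heis_inverse using rc by simp
  also have "\<dots> = r * heis a b c * heis (2 * a + 4 * b * c) (2 * b) (2 * c)" using d by (simp add: mult_mat_assoc_dim)
  also have "\<dots> = r' * heis p q t" unfolding eq P[symmetric] using d by (simp add: mult_mat_assoc_dim)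
  finally have rr: "r = r' * heis p q t" .
  have "r' * (heis p q t * heis x y z) = (r' * heis p q t) * heis x y z" using d by (simp add: mult_mat_assoc_dim)
  also have "\<dots> = A * (r' * heis p q t)" using s(1) unfolding rr[symmetric] by (simp only:)
  also have "\<dots> = A * r' * heis p q t" using d by (simp add: mult_mat_assoc_dim)
  also have "\<dots> = r' * (heis x' y' z' * heis p q t)" unfolding s(2) using d by (simp add: mult_mat_assoc_dim)
  finally have "r' * (heis p q t * heis x y z) = r' * (heis x' y' z' * heis p q t)" .
  from SU3_left_cancel[OF r(2) mult_carrier_mat[OF heis_carrier heis_carrier] mult_carrier_mat[OF heis_carrier heis_carrier] this]
  have "heis p q t * heis x y z = heis x' y' z' * heis p q t" .
  note h = heis_inj[OF this[unfolded heis_mult]]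
  show "y mod 3 = y' mod 3" "z mod 3 = z' mod 3" using h(2,3) by (auto dest: mod_3_add_cancel)
qed

text \<open>The exponent pairs of the conjugates of \<open>S1\<close> and \<open>T\<close> are the
  rows of a 2 by 2 matrix over the field with three elements. The 24 representatives give 24
  different matrices, which is all of SL(2, 3). The bounds turn congruences modulo 3 into
  equalities.\<close>

lemma conj_tab_check:
  "distinct (map (\<lambda>(j, k). (snd (S1_tab ! j ! k), snd (T_tab ! j ! k))) rep_idx)"
  "list_all (\<lambda>(j, k). case (S1_tab ! j ! k, T_tab ! j ! k) of ((a, b, c), (a', b', c')) \<Rightarrow>
     b < 3 \<and> c < 3 \<and> b' < 3 \<and> c' < 3) rep_idx"
  by code_simp+

text \<open>The conjugation action recovers the indices of the representative; cancelling it leaves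
  two Heisenberg elements, whose exponents below 3 are unique.\<close>

lemma heis_cosets_param_inj:
  "inj_on (\<lambda>((j, k), a, b, c). coset_rep j k * heis a b c)
     (({0..<3} \<times> {0..<8}) \<times> {0..<3} \<times> {0..<3} \<times> {0..<3})"
proof -
  have inj: "((j, k), a, b, c) = ((j', k'), a', b', c')"
    if jk: "j < 3" "k < 8" and jk': "j' < 3" "k' < 8" and l: "a < 3" "b < 3" "c < 3" "a' < 3" "b' < 3" "c' < 3"
      and eq: "coset_rep j k * heis a b c = coset_rep j' k' * heis a' b' c'" for j k a b c j' k' a' b' c' :: nat
  proof -
    have r: "coset_rep j k \<in> carrier SU3" "coset_rep j' k' \<in> carrier SU3"
      using coset_rep_in_Sigma[OF jk] coset_rep_in_Sigma[OF jk'] subgroup.subset[OF subgroup_Sigma] by auto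
    obtain x y z where s: "S1_tab ! j ! k = (x, y, z)" by (cases "S1_tab ! j ! k")
    obtain x' y' z' where s': "S1_tab ! j' ! k' = (x', y', z')" by (cases "S1_tab ! j' ! k'")
    obtain u v w where t: "T_tab ! j ! k = (u, v, w)" by (cases "T_tab ! j ! k")
    obtain u' v' w' where t': "T_tab ! j' ! k' = (u', v', w')" by (cases "T_tab ! j' ! k'")
    have lt: "y < 3" "z < 3" "v < 3" "w < 3"
      using bspec[OF conj_tab_check(2)[unfolded list_all_iff] rep_idx_mem[OF jk]] s t by auto
    have lt': "y' < 3" "z' < 3" "v' < 3" "w' < 3"
      using bspec[OF conj_tab_check(2)[unfolded list_all_iff] rep_idx_mem[OF jk']] s' t' by auto
    have c: "S1 \<in> carrier_mat 3 3" "T \<in> carrier_mat 3 3" by (simp_all add: generators_eq)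
    note e1 = conjugation_determines_coset[OF r c(1) eq S1_mult_coset_rep[OF jk s] S1_mult_coset_rep[OF jk' s']]
    note e2 = conjugation_determines_coset[OF r c(2) eq T_mult_coset_rep[OF jk t] T_mult_coset_rep[OF jk' t']]
    have yz: "y = y'" "z = z'" "v = v'" "w = w'" using lt lt' e1 e2 by auto
    have "(j, k) = (j', k')"
    proof (rule inj_onD[of "\<lambda>(j, k). (snd (S1_tab ! j ! k), snd (T_tab ! j ! k))" "set rep_idx"])
      show "inj_on (\<lambda>(j, k). (snd (S1_tab ! j ! k), snd (T_tab ! j ! k))) (set rep_idx)"
        using conj_tab_check(1) unfolding distinct_map by blast
    qed (use rep_idx_mem[OF jk] rep_idx_mem[OF jk'] s s' t t' yz in auto)
    then have "coset_rep j' k' * heis a b c = coset_rep j' k' * heis a' b' c'" using eq by simp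
    from heis_inj[OF SU3_left_cancel[OF r(2) heis_carrier heis_carrier this]]
    have "a = a'" "b = b'" "c = c'" using l by auto
    with \<open>(j, k) = (j', k')\<close> show ?thesis by simp
  qed
  let ?F = "\<lambda>((j, k), a, b, c). coset_rep j k * heis a b c"
  show ?thesis
  proof (rule inj_onI)
    fix x y :: "(nat \<times> nat) \<times> nat \<times> nat \<times> nat"
    obtain j k a b c j' k' a' b' c' where xy: "x = ((j, k), a, b, c)" "y = ((j', k'), a', b', c')"
      by (metis prod.exhaust)
    assume "x \<in> ({0..<3} \<times> {0..<8}) \<times> {0..<3} \<times> {0..<3} \<times> {0..<3}"
      "y \<in> ({0..<3} \<times> {0..<8}) \<times> {0..<3} \<times> {0..<3} \<times> {0..<3}"
      "?F x = ?F y"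
    then show "x = y" unfolding xy by (intro inj) auto
  qed
qed

theorem card_Sigma: "card Sigma_216x3 = 648"
  unfolding Sigma_eq heis_cosets_def card_image[OF heis_cosets_param_inj] by simp

lemma finite_Sigma: "finite Sigma_216x3"
  unfolding Sigma_eq heis_cosets_def by simp

section \<open>Distribution of the traces over the group\<close>

definition trace_codes :: "nat \<Rightarrow> nat \<Rightarrow> (eis \<times> int) list" where
  "trace_codes j k = map (\<lambda>(a, b, c). (emat_tr (emat_mul (rep_code j k) (heis_code a b c)), 1))
     (List.product [0, 1, 2] (List.product [0, 1, 2] [0, 1, 2]))"

text \<open>Three patterns occur, according to the number of vectors over the field with three
  elements fixed by the conjugation action: nine for the identity, three for the eight matrices of
  order 3, one otherwise. That number is the squared modulus of every nonzero trace in the coset,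
  and the squared moduli over a coset add up to 27. The entries are traces times the square root of
  -3, without the power of \<epsilon>.\<close>

definition coset_tab :: "nat \<Rightarrow> nat \<Rightarrow> (eis \<times> int) list" where
  "coset_tab j k =
     (if j = 0 then
        if k = 0 then [((0, 0), 24), ((3, 6), 1), ((-6, -3), 1), ((3, -3), 1)]
        else if k = 1 then [((-1, -2), 9), ((2, 1), 9), ((-1, 1), 9)]
        else [((1, 2), 9), ((1, -1), 9), ((-2, -1), 9)]
      else if j = 1 \<and> k \<in> {0, 2, 4, 6} then [((0, 0), 18), ((0, 3), 3), ((3, 0), 3), ((-3, -3), 3)]
      else if j = 2 \<and> k \<in> {0, 3, 5, 7} then [((0, 0), 18), ((3, 3), 3), ((-3, 0), 3), ((0, -3), 3)]
      else [((-1, -2), 9), ((2, 1), 9), ((-1, 1), 9)])"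

text \<open>An executable test that both lists give the same weighted sum of every function of the
  keys. It decides the trace table of each coset, the Weyl invariance of the point masses and the
  final comparison of distributions.\<close>

fun weights_match :: "('c \<times> int) list \<Rightarrow> ('c \<times> int) list \<Rightarrow> bool" where
  "weights_match xs [] \<longleftrightarrow> xs = []"
| "weights_match xs ((x, n) # tab) \<longleftrightarrow>
     sum_list (map snd (filter (\<lambda>p. fst p = x) xs)) = n \<and> weights_match (filter (\<lambda>p. fst p \<noteq> x) xs) tab"

lemma sum_list_filter_key:
  fixes f :: "'c \<Rightarrow> 'd :: comm_ring_1"
  shows "(\<Sum>(y, n)\<leftarrow>xs. of_int n * f y) =
    of_int (sum_list (map snd (filter (\<lambda>p. fst p = x) xs))) * f x + (\<Sum>(y, n)\<leftarrow>filter (\<lambda>p. fst p \<noteq> x) xs. of_int n * f y)"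
  by (induction xs) (auto simp: algebra_simps)

lemma weights_match_sum_list:
  fixes f :: "'c \<Rightarrow> 'd :: comm_ring_1"
  shows "weights_match xs tab \<Longrightarrow> (\<Sum>(x, n)\<leftarrow>xs. of_int n * f x) = (\<Sum>(x, n)\<leftarrow>tab. of_int n * f x)"
proof (induction xs tab rule: weights_match.induct)
  case (2 xs x n tab)
  then show ?case using sum_list_filter_key[where xs = xs and f = f and x = x] by simp
qed simp

lemma trace_codes_weights: "list_all (\<lambda>(j, k). weights_match (trace_codes j k) (coset_tab j k)) rep_idx"
  by code_simp

text \<open>The entry \<open>((j, a, b), n)\<close> records that \<open>n\<close> elements have trace \<open>\<epsilon>\<^sup>2\<^sup>j (a + b \<omega>) / \<surd>-3\<close>.\<close>

definition trace_tab :: "((nat \<times> eis) \<times> int) list" where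
  "trace_tab =
    [((0, 3, 6), 1), ((0, -6, -3), 1), ((0, 3, -3), 1), ((0, 0, 0), 168),
     ((0, -1, -2), 9), ((0, 2, 1), 9), ((0, -1, 1), 9),
     ((0, 1, 2), 54), ((0, 1, -1), 54), ((0, -2, -1), 54),
     ((1, 0, 3), 12), ((1, 3, 0), 12), ((1, -3, -3), 12),
     ((1, -1, -2), 36), ((1, 2, 1), 36), ((1, -1, 1), 36),
     ((2, 3, 3), 12), ((2, -3, 0), 12), ((2, 0, -3), 12),
     ((2, -1, -2), 36), ((2, -1, 1), 36), ((2, 2, 1), 36)]"

definition trace_val :: "nat \<times> eis \<Rightarrow> complex" where
  "trace_val p = \<epsilon> ^ (2 * fst p) / (\<i> * sqrt 3) * eis_val (snd p)"

lemma trace_val_0: "trace_val (j, 0, 0) = 0"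
  by (simp add: trace_val_def eis_val_def)

lemma mtrace_smult: "A \<in> carrier_mat n n \<Longrightarrow> mtrace (c \<cdot>\<^sub>m A) = c * mtrace A"
  by (simp add: mtrace_def sum_distrib_left)

lemma mtrace_coset: "mtrace (coset_rep j k * heis a b c) = trace_val (j, emat_tr (emat_mul (rep_code j k) (heis_code a b c)))"
proof -
  have "coset_rep j k * heis a b c = (\<epsilon> ^ (2 * j) / (\<i> * sqrt 3)) \<cdot>\<^sub>m (emat_val (emat_mul (rep_code j k) (heis_code a b c)))"
    unfolding coset_rep_def emat_val_mul heis_code by (rule mult_smult_assoc_mat[OF emat_val_carrier heis_carrier])
  then show ?thesis by (simp add: mtrace_smult[OF emat_val_carrier] mtrace_emat_val trace_val_def)
qed

theorem sum_trace_Sigma: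
  fixes f :: "complex \<Rightarrow> complex"
  shows "(\<Sum>g\<in>Sigma_216x3. f (mtrace g)) = (\<Sum>(x, n)\<leftarrow>trace_tab. of_int n * f (trace_val x))"
proof -
  let ?H = "List.product [0, 1, 2] (List.product [0, 1, 2] [0, 1, 2 :: nat]) :: (nat \<times> nat \<times> nat) list"
  have s: "{0..<3} = {0, 1, 2 :: nat}" "{0..<8} = {0, 1, 2, 3, 4, 5, 6, 7 :: nat}" by auto
  have sets: "set rep_idx = {0..<3} \<times> {0..<8}" "set ?H = {0..<3} \<times> {0..<3} \<times> {0..<3}"
    unfolding rep_idx_def set_product s by simp_all
  have dist: "distinct rep_idx" "distinct ?H"
    unfolding rep_idx_def by (intro distinct_product; simp)+
  define F where "F = (\<lambda>((j, k), a, b, c). coset_rep j k * heis a b c)"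
  have "(\<Sum>g\<in>Sigma_216x3. f (mtrace g)) = (\<Sum>x\<in>set rep_idx \<times> set ?H. f (mtrace (F x)))"
    unfolding Sigma_eq heis_cosets_def sum.reindex[OF heis_cosets_param_inj] sets comp_def F_def ..
  also have "\<dots> = (\<Sum>p\<in>set rep_idx. \<Sum>q\<in>set ?H. f (mtrace (F (p, q))))"
    by (rule sum.cartesian_product')
  also have "\<dots> = (\<Sum>p\<leftarrow>rep_idx. \<Sum>q\<leftarrow>?H. f (mtrace (F (p, q))))"
    by (simp only: sum_list_distinct_conv_sum_set[OF dist(1)] sum_list_distinct_conv_sum_set[OF dist(2)])
  also have "\<dots> = (\<Sum>(j, k)\<leftarrow>rep_idx. \<Sum>(x, n)\<leftarrow>trace_codes j k. of_int n * f (trace_val (j, x)))"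
    unfolding trace_codes_def map_map
    by (intro arg_cong[of _ _ sum_list] map_cong refl) (auto simp: F_def mtrace_coset comp_def case_prod_beta)
  also have "\<dots> = (\<Sum>(j, k)\<leftarrow>rep_idx. \<Sum>(x, n)\<leftarrow>coset_tab j k. of_int n * f (trace_val (j, x)))"
    using trace_codes_weights
    by (intro arg_cong[of _ _ sum_list] map_cong refl)
      (auto simp: list_all_iff intro!: weights_match_sum_list[where f = "\<lambda>x. f (trace_val (j, x))" for j])
  \<comment> \<open>The zero traces of the three values of \<open>j\<close> are merged into one
    entry: 24 + 4 x 18 + 4 x 18 = 168.\<close>
  also have "\<dots> = (\<Sum>(x, n)\<leftarrow>trace_tab. of_int n * f (trace_val x))"
    by (simp add: rep_idx_def coset_tab_def trace_tab_def trace_val_0)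
  finally show ?thesis .
qed

section \<open>Spectral measures on the torus\<close>

lemma space_circle: "space circle = sphere 0 1"
  by (simp add: circle_def space_restrict_space)

lemma space_torus: "space torus = sphere 0 1 \<times> sphere 0 1"
  by (simp add: torus_def space_pair_measure space_circle)

lemma measurable_circle_borel: "(\<lambda>x. x) \<in> borel_measurable circle"
  unfolding circle_def by (rule measurable_restrict_space1) simp

lemma measurable_fst_torus [measurable]: "fst \<in> borel_measurable torus"
  unfolding torus_def by (rule measurable_compose[OF measurable_fst measurable_circle_borel])

lemma measurable_snd_torus [measurable]: "snd \<in> borel_measurable torus"
  unfolding torus_def by (rule measurable_compose[OF measurable_snd measurable_circle_borel])

lemma measurable_torusI:
  assumes "f \<in> borel_measurable M" "g \<in> borel_measurable M"
    and "\<And>x. x \<in> space M \<Longrightarrow> norm (f x) = 1 \<and> norm (g x) = 1"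
  shows "(\<lambda>x. (f x, g x)) \<in> measurable M torus"
  unfolding torus_def circle_def
  by (intro measurable_Pair measurable_restrict_space2) (use assms in auto)

lemma torus_mem: "w \<in> space torus \<longleftrightarrow> norm (fst w) = 1 \<and> norm (snd w) = 1"
  by (cases w) (auto simp: space_torus)

lemma singleton_torus: "w \<in> space torus \<Longrightarrow> {w} \<in> sets torus"
proof -
  assume w: "w \<in> space torus"
  have "{w} = {x \<in> space torus. fst x = fst w \<and> snd x = snd w}"
    using w by (auto simp: prod_eq_iff)
  also have "\<dots> \<in> sets torus" by measurable
  finally show ?thesis .
qed

lemma weyl_measurable: "weyl1 \<in> measurable torus torus" "weyl2 \<in> measurable torus torus"
proof -
  have "(\<lambda>w. (inverse (snd w), inverse (fst w))) \<in> measurable torus torus"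
    by (rule measurable_torusI) (auto simp: torus_mem norm_inverse)
  then show "weyl1 \<in> measurable torus torus" by (simp add: weyl1_def case_prod_beta')
  have "(\<lambda>w. (inverse (snd w), fst w * inverse (snd w))) \<in> measurable torus torus"
    by (rule measurable_torusI) (auto simp: torus_mem norm_inverse norm_mult)
  then show "weyl2 \<in> measurable torus torus" by (simp add: weyl2_def case_prod_beta')
qed

lemma weyl_space: "w \<in> space torus \<Longrightarrow> weyl1 w \<in> space torus" "w \<in> space torus \<Longrightarrow> weyl2 w \<in> space torus"
  using weyl_measurable by (auto dest: measurable_space)

text \<open>The trace of the element of the maximal torus of \<open>SU(3)\<close> with parameters \<open>w\<close>, whose eigenvalues
  are \<open>w\<^sub>1\<close>, \<open>w\<^sub>2\<^sup>-\<^sup>1\<close> and \<open>w\<^sub>1\<^sup>-\<^sup>1 w\<^sub>2\<close>.\<close>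

definition torus_tr :: "complex \<times> complex \<Rightarrow> complex" where
  "torus_tr w = fst w + inverse (snd w) + inverse (fst w) * snd w"

lemma torus_tr_measurable [measurable]: "torus_tr \<in> borel_measurable torus"
  unfolding torus_tr_def by measurable

lemma cnj_torus_tr_measurable [measurable]: "(\<lambda>w. cnj (torus_tr w)) \<in> borel_measurable torus"
  by (intro measurable_compose[OF torus_tr_measurable] borel_measurable_continuous_onI continuous_intros)

lemma inverse_eq_cnj: "norm z = 1 \<Longrightarrow> inverse z = cnj z"
  by (metis complex_norm_square inverse_unique mult.commute norm_one of_real_1 one_power2)

lemma cnj_torus_tr:
  assumes "w \<in> space torus"
  shows "cnj (torus_tr w) = inverse (fst w) + snd w + fst w * inverse (snd w)"
proof -
  have n: "norm (fst w) = 1" "norm (snd w) = 1" using assms by (auto simp: torus_mem)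
  show ?thesis by (simp add: torus_tr_def inverse_eq_cnj[OF n(1)] inverse_eq_cnj[OF n(2)])
qed

lemma R_eq: "w \<in> space torus \<Longrightarrow> R m n w = torus_tr w ^ m * cnj (torus_tr w) ^ n"
  by (simp add: cnj_torus_tr) (simp add: R_def torus_tr_def case_prod_beta')

lemma norm_torus_tr: "w \<in> space torus \<Longrightarrow> norm (torus_tr w) \<le> 3"
proof -
  assume "w \<in> space torus"
  then have n: "norm (fst w) = 1" "norm (snd w) = 1" by (auto simp: torus_mem)
  have "norm (torus_tr w) \<le> norm (fst w) + norm (inverse (snd w)) + norm (inverse (fst w) * snd w)"
    unfolding torus_tr_def by (intro norm_triangle_le add_mono norm_triangle_ineq order_refl)
  then show ?thesis using n by (simp add: norm_mult norm_inverse)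
qed

text \<open>The three eigenvalues are the roots of a cubic whose coefficients are determined by the
  trace, so equal traces mean equal eigenvalues up to order. The six orderings are the six Weyl
  images.\<close>

lemma weyl_orbit:
  assumes w: "w \<in> space torus" and w': "w' \<in> space torus" and eq: "torus_tr w = torus_tr w'"
  shows "w' \<in> {w, weyl1 w, weyl2 w, weyl1 (weyl2 w), weyl2 (weyl2 w), weyl1 (weyl2 (weyl2 w))}"
proof -
  define x y z where xyz: "x = fst w" "y = inverse (snd w)" "z = inverse (fst w) * snd w"
  define x' y' z' where xyz': "x' = fst w'" "y' = inverse (snd w')" "z' = inverse (fst w') * snd w'"
  have nz: "fst w \<noteq> 0" "snd w \<noteq> 0" "fst w' \<noteq> 0" "snd w' \<noteq> 0" using w w' by (auto simp: torus_mem)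
  have prod: "x * y * z = 1" "x' * y' * z' = 1" using nz by (auto simp: xyz xyz' field_simps)
  have sum: "x' + y' + z' = x + y + z" using eq by (simp add: torus_tr_def xyz xyz')
  \<comment> \<open>For eigenvalues of modulus 1 with product 1, the second elementary symmetric
    function is the conjugate of the first.\<close>
  have "x * y + y * z + z * x = cnj (torus_tr w)" "x' * y' + y' * z' + z' * x' = cnj (torus_tr w')"
    unfolding cnj_torus_tr[OF w] cnj_torus_tr[OF w'] xyz xyz' using nz by (auto simp: field_simps)
  then have sum2: "x' * y' + y' * z' + z' * x' = x * y + y * z + z * x" using eq by simp
  have n0: "x \<noteq> 0" "y \<noteq> 0" "z \<noteq> 0" using prod by auto
  have "(x' - x) * (x' - y) * (x' - z) = x' ^ 3 - (x + y + z) * x' ^ 2 + (x * y + y * z + z * x) * x' - x * y * z"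
    by (simp add: algebra_simps power2_eq_square power3_eq_cube)
  also have "\<dots> = 0" unfolding sum[symmetric] sum2[symmetric] prod(1) prod(2)[symmetric]
    by (simp add: algebra_simps power2_eq_square power3_eq_cube)
  finally have r: "x' = x \<or> x' = y \<or> x' = z" by auto
  have two: "y' = p \<or> y' = q" if "y' + z' = p + q" "y' * z' = p * q" for p q
  proof -
    have "(y' - p) * (y' - q) = y' * y' - (p + q) * y' + p * q" by (simp add: algebra_simps)
    also have "\<dots> = 0" unfolding that[symmetric] by (simp add: algebra_simps)
    finally show ?thesis by auto
  qed
  have cases: "(x', y') \<in> {(x, y), (x, z), (y, x), (y, z), (z, x), (z, y)}"
    using r
  proof (elim disjE)
    assume e: "x' = x"
    have "x * (y' * z') = x * (y * z)" using prod e by (simp add: mult.assoc)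
    then have "y' = y \<or> y' = z" using two[of y z] sum e n0 by (simp add: algebra_simps)
    then show ?thesis using e by auto
  next
    assume e: "x' = y"
    have "y * (y' * z') = y * (x * z)" using prod e by (simp add: mult_ac)
    then have "y' = x \<or> y' = z" using two[of x z] sum e n0 by (simp add: algebra_simps)
    then show ?thesis using e by auto
  next
    assume e: "x' = z"
    have "z * (y' * z') = z * (x * y)" using prod e by (simp add: mult_ac)
    then have "y' = x \<or> y' = y" using two[of x y] sum e n0 by (simp add: algebra_simps)
    then show ?thesis using e by auto
  qed
  have w'e: "w' = (x', inverse y')" by (simp add: xyz')
  have 1: "w = (x, inverse y)" by (simp add: xyz)
  have 2: "weyl1 w = (y, inverse x)" by (simp add: weyl1_def xyz case_prod_beta')
  have 3: "weyl2 w = (y, inverse z)" using nz by (simp add: weyl2_def xyz case_prod_beta')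
  have 4: "weyl1 (y, inverse z) = (z, inverse y)" by (simp add: weyl1_def)
  have 5: "weyl2 (y, inverse z) = (z, inverse x)" using nz by (simp add: weyl2_def xyz)
  have 6: "weyl1 (z, inverse x) = (x, inverse z)" by (simp add: weyl1_def)
  show ?thesis unfolding 2 3 4 5 6 using cases w'e 1 by auto
qed

section \<open>Atomic measures on the torus\<close>

definition atomic :: "(complex \<times> complex) set \<Rightarrow> (complex \<times> complex \<Rightarrow> real) \<Rightarrow> (complex \<times> complex) measure" where
  "atomic S c = distr (point_measure S (\<lambda>w. ennreal (c w))) torus (\<lambda>w. w)"

lemma sets_atomic [simp, measurable_cong]: "sets (atomic S c) = sets torus"
  by (simp add: atomic_def)

lemma space_atomic [simp]: "space (atomic S c) = space torus"
  by (simp add: atomic_def)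

lemma measurable_point_torus: "S \<subseteq> space torus \<Longrightarrow> (\<lambda>w. w) \<in> measurable (point_measure S f) torus"
  by auto

lemma nn_integral_atomic:
  assumes "finite S" "S \<subseteq> space torus" "f \<in> borel_measurable torus"
  shows "(\<integral>\<^sup>+w. f w \<partial>atomic S c) = (\<Sum>w\<in>S. ennreal (c w) * f w)"
  unfolding atomic_def using assms
  by (subst nn_integral_distr[OF measurable_point_torus]) (auto simp: nn_integral_point_measure_finite)

lemma integral_atomic:
  fixes f :: "_ \<Rightarrow> complex"
  assumes "finite S" "S \<subseteq> space torus" "f \<in> borel_measurable torus" "\<And>w. w \<in> S \<Longrightarrow> 0 \<le> c w"
  shows "(\<integral>w. f w \<partial>atomic S c) = (\<Sum>w\<in>S. of_real (c w) * f w)"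
  unfolding atomic_def using assms
  by (subst integral_distr[OF measurable_point_torus])
    (auto simp: lebesgue_integral_point_measure_finite scaleR_conv_of_real)

lemma emeasure_weighted_atomic:
  assumes S: "finite S" "S \<subseteq> space torus" and f: "f \<in> borel_measurable torus"
    and nn: "\<And>w. w \<in> S \<Longrightarrow> 0 \<le> c w" "\<And>w. w \<in> S \<Longrightarrow> 0 \<le> f w" and A: "A \<in> sets torus"
  shows "emeasure (weighted f (atomic S c)) A = ennreal (\<Sum>w\<in>S. c w * f w * indicator A w)"
proof -
  have "emeasure (weighted f (atomic S c)) A = (\<integral>\<^sup>+w. ennreal (f w) * indicator A w \<partial>atomic S c)"
    unfolding weighted_def using f A by (subst emeasure_density) auto
  also have "\<dots> = (\<Sum>w\<in>S. ennreal (c w) * (ennreal (f w) * indicator A w))"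
    using f A by (intro nn_integral_atomic S) auto
  also have "\<dots> = (\<Sum>w\<in>S. ennreal (c w * f w * indicator A w))"
    using nn by (intro sum.cong refl) (auto simp: ennreal_mult indicator_def)
  also have "\<dots> = ennreal (\<Sum>w\<in>S. c w * f w * indicator A w)"
    using nn by (intro sum_ennreal) auto
  finally show ?thesis .
qed

lemma measure_weighted_atomic:
  assumes "finite S" "S \<subseteq> space torus" "f \<in> borel_measurable torus"
    "\<And>w. w \<in> S \<Longrightarrow> 0 \<le> c w" "\<And>w. w \<in> S \<Longrightarrow> 0 \<le> f w" "A \<in> sets torus"
  shows "measure (weighted f (atomic S c)) A = (\<Sum>w\<in>S. c w * f w * indicator A w)"
proof -
  have "0 \<le> (\<Sum>w\<in>S. c w * f w * indicator A w)"
    using assms by (intro sum_nonneg mult_nonneg_nonneg) auto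
  then show ?thesis
    using emeasure_weighted_atomic[OF assms] by (simp add: Sigma_Algebra.measure_def del: sum_mult_indicator)
qed

lemma weighted_one: "weighted (\<lambda>_. 1) M = M"
  by (simp add: weighted_def density_1)

lemma measure_atomic:
  assumes "finite S" "S \<subseteq> space torus" "\<And>w. w \<in> S \<Longrightarrow> 0 \<le> c w" "A \<in> sets torus"
  shows "emeasure (atomic S c) A = ennreal (\<Sum>w\<in>S. c w * indicator A w)"
    "measure (atomic S c) A = (\<Sum>w\<in>S. c w * indicator A w)"
  using emeasure_weighted_atomic[OF assms(1,2) _ assms(3) _ assms(4), of "\<lambda>_. 1"]
    measure_weighted_atomic[OF assms(1,2) _ assms(3) _ assms(4), of "\<lambda>_. 1"] by (simp_all add: weighted_one)

lemma d_upper_atomic: "d_upper N = atomic (D_set N) (\<lambda>_. 1 / card (D_set N))"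
  by (simp add: d_upper_def atomic_def uniform_count_measure_def)

definition discrete_circle :: "complex set \<Rightarrow> complex measure" where
  "discrete_circle Z = distr (uniform_count_measure Z) circle (\<lambda>z. z)"

lemma nn_integral_discrete_circle:
  assumes "finite Z" "Z \<subseteq> space circle" "f \<in> borel_measurable circle"
  shows "(\<integral>\<^sup>+z. f z \<partial>discrete_circle Z) = (\<Sum>z\<in>Z. ennreal (1 / card Z) * f z)"
proof -
  have "(\<lambda>z. z) \<in> measurable (uniform_count_measure Z) circle"
    unfolding uniform_count_measure_def using assms(2) by auto
  then show ?thesis
    unfolding discrete_circle_def using assms
    by (subst nn_integral_distr) (auto simp: uniform_count_measure_def nn_integral_point_measure_finite)
qed

text \<open>The factors are already pushed forward to the Borel sets of the circle, so the product
  is evaluated by iterated integration rather than by counting on a finite product.\<close>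

lemma pair_discrete_circle:
  assumes Z: "finite Z" "Z \<subseteq> space circle"
  shows "discrete_circle Z \<Otimes>\<^sub>M discrete_circle Z = atomic (Z \<times> Z) (\<lambda>_. 1 / card (Z \<times> Z))"
proof (rule measure_eqI)
  have sd: "sets (discrete_circle Z) = sets circle" by (simp add: discrete_circle_def)
  then show se: "sets (discrete_circle Z \<Otimes>\<^sub>M discrete_circle Z) = sets (atomic (Z \<times> Z) (\<lambda>_. 1 / card (Z \<times> Z)))"
    by (simp add: torus_def cong: sets_pair_measure_cong)
  have ZZ: "Z \<times> Z \<subseteq> space torus" using Z(2) by (auto simp: torus_def space_pair_measure)
  have "emeasure (discrete_circle Z) (space (discrete_circle Z)) = (\<integral>\<^sup>+z. 1 \<partial>discrete_circle Z)" by simp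
  also have "\<dots> = (\<Sum>z\<in>Z. ennreal (1 / card Z) * 1)" using Z by (rule nn_integral_discrete_circle) simp
  also have "\<dots> < \<infinity>" by (simp add: ennreal_mult_eq_top_iff less_top[symmetric] ennreal_of_nat_eq_real_of_nat)
  finally interpret finite_measure "discrete_circle Z" by (intro finite_measureI) auto
  fix A assume "A \<in> sets (discrete_circle Z \<Otimes>\<^sub>M discrete_circle Z)"
  then have A: "A \<in> sets torus" and A': "A \<in> sets (discrete_circle Z \<Otimes>\<^sub>M discrete_circle Z)" using se by simp_all
  have s: "Pair x -` A \<in> sets circle" for x
    using sets_Pair1[of A circle circle x] A by (simp add: torus_def)
  have "emeasure (discrete_circle Z \<Otimes>\<^sub>M discrete_circle Z) A =
    (\<integral>\<^sup>+x. \<integral>\<^sup>+y. indicator A (x, y) \<partial>discrete_circle Z \<partial>discrete_circle Z)"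
    by (rule emeasure_pair_measure[OF A'])
  also have "\<dots> = (\<integral>\<^sup>+x. (\<Sum>y\<in>Z. ennreal (1 / card Z) * indicator A (x, y)) \<partial>discrete_circle Z)"
  proof (intro nn_integral_cong nn_integral_discrete_circle Z)
    fix x
    have "indicator A (x, y) = (indicator (Pair x -` A) y :: ennreal)" for y by (simp add: indicator_def)
    then show "(\<lambda>y. indicator A (x, y) :: ennreal) \<in> borel_measurable circle" using s[of x] by simp
  qed
  also have "\<dots> = (\<Sum>x\<in>Z. ennreal (1 / card Z) * (\<Sum>y\<in>Z. ennreal (1 / card Z) * indicator A (x, y)))"
  proof (rule nn_integral_discrete_circle[OF Z])
    have "(\<lambda>x. (x, y)) \<in> measurable circle torus" if "y \<in> Z" for y
      unfolding torus_def using Z that by (intro measurable_Pair) auto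
    then have "(\<lambda>x. indicator A (x, y) :: ennreal) \<in> borel_measurable circle" if "y \<in> Z" for y
      using that A by (auto intro: measurable_compose[where f = "\<lambda>x. (x, y)"])
    then show "(\<lambda>x. \<Sum>y\<in>Z. ennreal (1 / card Z) * indicator A (x, y)) \<in> borel_measurable circle" by measurable
  qed
  also have "\<dots> = (\<Sum>w\<in>Z \<times> Z. ennreal (1 / card (Z \<times> Z)) * indicator A w)"
    unfolding sum.cartesian_product' sum_distrib_left
    by (intro sum.cong refl) (simp add: card_cartesian_product ennreal_mult'[symmetric] mult.assoc[symmetric])
  also have "\<dots> = emeasure (atomic (Z \<times> Z) (\<lambda>_. 1 / card (Z \<times> Z))) A"
    using nn_integral_atomic[of "Z \<times> Z" "indicator A" "\<lambda>_. 1 / card (Z \<times> Z)"] Z(1) ZZ A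
    by simp
  finally show "emeasure (discrete_circle Z \<Otimes>\<^sub>M discrete_circle Z) A = emeasure (atomic (Z \<times> Z) (\<lambda>_. 1 / card (Z \<times> Z))) A" .
qed

section \<open>Uniqueness of spectral measures\<close>

lemma is_spectral_measureD:
  assumes "is_spectral_measure \<Gamma> \<nu>"
  shows "finite_measure \<nu>" "sets \<nu> = sets torus" "space \<nu> = space torus"
    "distr \<nu> torus weyl1 = \<nu>" "distr \<nu> torus weyl2 = \<nu>"
    "(\<integral>w. torus_tr w ^ m * cnj (torus_tr w) ^ n \<partial>\<nu>) = mckay_moment \<Gamma> m n"
proof -
  show 1: "finite_measure \<nu>" "sets \<nu> = sets torus" "distr \<nu> torus weyl1 = \<nu>" "distr \<nu> torus weyl2 = \<nu>"
    using assms by (auto simp: is_spectral_measure_def)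
  show sp: "space \<nu> = space torus" by (rule sets_eq_imp_space_eq[OF 1(2)])
  have "(\<integral>w. torus_tr w ^ m * cnj (torus_tr w) ^ n \<partial>\<nu>) = (\<integral>w. R m n w \<partial>\<nu>)"
    by (intro Bochner_Integration.integral_cong refl) (simp add: sp R_eq)
  then show "(\<integral>w. torus_tr w ^ m * cnj (torus_tr w) ^ n \<partial>\<nu>) = mckay_moment \<Gamma> m n"
    using assms by (simp add: is_spectral_measure_def)
qed

lemma integrable_torus_tr_moment:
  assumes fm: "finite_measure \<nu>" and se: "sets \<nu> = sets torus"
  shows "integrable \<nu> (\<lambda>w. torus_tr w ^ m * cnj (torus_tr w) ^ n)"
proof -
  interpret finite_measure \<nu> by (rule fm)
  have sp: "space \<nu> = space torus" by (rule sets_eq_imp_space_eq[OF se])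
  show ?thesis
  proof (rule integrable_const_bound[of _ "3 ^ m * 3 ^ n"])
    have "(\<lambda>w. torus_tr w ^ m * cnj (torus_tr w) ^ n) \<in> borel_measurable torus" by measurable
    then show "(\<lambda>w. torus_tr w ^ m * cnj (torus_tr w) ^ n) \<in> borel_measurable \<nu>"
      using measurable_cong_sets[OF se refl] by blast
    show "AE w in \<nu>. norm (torus_tr w ^ m * cnj (torus_tr w) ^ n) \<le> 3 ^ m * 3 ^ n"
      by (intro AE_I2) (auto simp: sp norm_mult norm_power norm_torus_tr intro!: mult_mono power_mono)
  qed
qed

lemma poly_mult_cnj:
  "poly p z * cnj (poly q z) = (\<Sum>i\<le>degree p. \<Sum>j\<le>degree q. coeff p i * cnj (coeff q j) * (z ^ i * cnj z ^ j))"
  by (simp add: poly_altdef sum_product mult_ac)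

text \<open>The right-hand side depends on \<nu> only through \<Gamma>; this is how a fact computed
  for one spectral measure passes to another.\<close>

lemma integral_poly_torus_tr:
  assumes sm: "is_spectral_measure \<Gamma> \<nu>"
  shows "(\<integral>w. poly p (torus_tr w) * cnj (poly q (torus_tr w)) \<partial>\<nu>) =
    (\<Sum>i\<le>degree p. \<Sum>j\<le>degree q. coeff p i * cnj (coeff q j) * mckay_moment \<Gamma> i j)"
proof -
  note D = is_spectral_measureD[OF sm]
  show ?thesis unfolding poly_mult_cnj
    by (simp add: integrable_torus_tr_moment[OF D(1,2)] D(6))
qed

text \<open>A spectral measure is determined by its moments once the trace takes finitely many values on it:
  the polynomial vanishing at these values forces any other spectral measure onto the same fibres,
  Lagrange interpolation gives the masses of the fibres, and each fibre is a single Weyl orbit.\<close>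

context
  fixes \<Gamma> :: "complex mat set" and F :: "complex set"
  assumes finF: "finite F"
begin

definition fibre_poly :: "complex poly" where
  "fibre_poly = (\<Prod>z\<in>F. [:-z, 1:])"

definition lagrange_poly :: "complex \<Rightarrow> complex poly" where
  "lagrange_poly z = (\<Prod>y\<in>F - {z}. Polynomial.smult (1 / (z - y)) [:-y, 1:])"

lemma poly_fibre_poly: "poly fibre_poly x = 0 \<longleftrightarrow> x \<in> F"
  using finF by (simp add: fibre_poly_def poly_prod)

lemma poly_lagrange_poly: "x \<in> F \<Longrightarrow> z \<in> F \<Longrightarrow> poly (lagrange_poly z) x = (if x = z then 1 else 0)"
  using finF by (auto simp: lagrange_poly_def poly_prod diff_divide_distrib[symmetric] intro!: prod.neutral)

text \<open>The second premise is the integral of the squared modulus of \<open>fibre_poly\<close>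
  at the trace, written in moments so that it can be verified on one spectral measure and used for
  another.\<close>

lemma spectral_AE_fibres:
  assumes "is_spectral_measure \<Gamma> \<nu>"
    and "(\<Sum>i\<le>degree fibre_poly. \<Sum>j\<le>degree fibre_poly. coeff fibre_poly i * cnj (coeff fibre_poly j) * mckay_moment \<Gamma> i j) = 0"
  shows "AE w in \<nu>. torus_tr w \<in> F"
proof -
  note D = is_spectral_measureD[OF assms(1)]
  interpret finite_measure \<nu> by (rule D(1))
  let ?g = "\<lambda>w. (norm (poly fibre_poly (torus_tr w)))\<^sup>2"
  have c: "poly fibre_poly z * cnj (poly fibre_poly z) = complex_of_real ((norm (poly fibre_poly z))\<^sup>2)" for z
    using complex_norm_square[of "poly fibre_poly z"] by simp
  have "complex_of_real (\<integral>w. ?g w \<partial>\<nu>) = (\<integral>w. poly fibre_poly (torus_tr w) * cnj (poly fibre_poly (torus_tr w)) \<partial>\<nu>)"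
    unfolding c integral_complex_of_real ..
  also have "\<dots> = 0" unfolding integral_poly_torus_tr[OF assms(1)] by (rule assms(2))
  finally have z: "(\<integral>w. ?g w \<partial>\<nu>) = 0" by simp
  have "integrable \<nu> (\<lambda>w. poly fibre_poly (torus_tr w) * cnj (poly fibre_poly (torus_tr w)))"
    unfolding poly_mult_cnj by (simp add: integrable_torus_tr_moment[OF D(1,2)])
  from integrable_Re[OF this] have i: "integrable \<nu> ?g" unfolding c by simp
  have "AE w in \<nu>. ?g w = 0"
    using integral_nonneg_eq_0_iff_AE[OF i] z by simp
  then show ?thesis by (rule AE_mp) (auto simp: poly_fibre_poly)
qed

text \<open>Almost everywhere the Lagrange polynomial at the trace is the indicator of the fibre;
  the factor 1 brings the integrand into the form of \<open>integral_poly_torus_tr\<close>.\<close>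

lemma spectral_measure_fibre:
  assumes sm: "is_spectral_measure \<Gamma> \<nu>" and ae: "AE w in \<nu>. torus_tr w \<in> F" and z: "z \<in> F"
  shows "complex_of_real (measure \<nu> {w \<in> space torus. torus_tr w = z}) =
    (\<Sum>i\<le>degree (lagrange_poly z). \<Sum>j\<le>degree (1 :: complex poly).
       coeff (lagrange_poly z) i * cnj (coeff 1 j) * mckay_moment \<Gamma> i j)"
proof -
  note D = is_spectral_measureD[OF sm]
  interpret finite_measure \<nu> by (rule D(1))
  let ?X = "{w \<in> space torus. torus_tr w = z}"
  have X: "?X \<in> sets \<nu>" unfolding D(2) by measurable
  have "(\<integral>w. poly (lagrange_poly z) (torus_tr w) * cnj (poly 1 (torus_tr w)) \<partial>\<nu>) = (\<integral>w. complex_of_real (indicator ?X w) \<partial>\<nu>)"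
  proof (rule integral_cong_AE)
    show "AE w in \<nu>. poly (lagrange_poly z) (torus_tr w) * cnj (poly 1 (torus_tr w)) = complex_of_real (indicator ?X w)"
      using ae AE_space by eventually_elim (auto simp: poly_lagrange_poly z D(3))
    have "integrable \<nu> (\<lambda>w. poly (lagrange_poly z) (torus_tr w) * cnj (poly 1 (torus_tr w)))"
      unfolding poly_mult_cnj
      by (intro Bochner_Integration.integrable_sum integrable_mult_right integrable_torus_tr_moment D(1,2))
    then show "(\<lambda>w. poly (lagrange_poly z) (torus_tr w) * cnj (poly 1 (torus_tr w))) \<in> borel_measurable \<nu>"
      by (rule borel_measurable_integrable)
  qed (use X in measurable)
  also have "\<dots> = complex_of_real (measure \<nu> ?X)" using X by simp
  finally show ?thesis unfolding integral_poly_torus_tr[OF sm] ..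
qed

end

text \<open>The Weyl maps are injective on the torus, so the preimage of the image of a point is
  that point alone.\<close>

lemma spectral_weyl_singleton:
  assumes sm: "is_spectral_measure \<Gamma> \<nu>" and w: "w \<in> space torus"
  shows "measure \<nu> {weyl1 w} = measure \<nu> {w}" "measure \<nu> {weyl2 w} = measure \<nu> {w}"
proof -
  note D = is_spectral_measureD[OF sm]
  have nz: "fst v \<noteq> 0" "snd v \<noteq> 0" if "v \<in> space torus" for v using that by (auto simp: torus_mem)
  have pre: "weyl1 -` {weyl1 w} \<inter> space \<nu> = {w}" "weyl2 -` {weyl2 w} \<inter> space \<nu> = {w}"
    using w nz[OF w] nz unfolding D(3) by (auto simp: weyl1_def weyl2_def case_prod_beta' prod_eq_iff)
  have m: "weyl1 \<in> measurable \<nu> torus" "weyl2 \<in> measurable \<nu> torus"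
    using weyl_measurable measurable_cong_sets[OF D(2) refl] by blast+
  have "measure \<nu> {weyl1 w} = measure (distr \<nu> torus weyl1) {weyl1 w}" by (simp only: D(4))
  then show "measure \<nu> {weyl1 w} = measure \<nu> {w}"
    using pre measure_distr[OF m(1) singleton_torus[OF weyl_space(1)[OF w]]] by simp
  have "measure \<nu> {weyl2 w} = measure (distr \<nu> torus weyl2) {weyl2 w}" by (simp only: D(5))
  then show "measure \<nu> {weyl2 w} = measure \<nu> {w}"
    using pre measure_distr[OF m(2) singleton_torus[OF weyl_space(2)[OF w]]] by simp
qed

lemma spectral_same_fibre:
  assumes sm: "is_spectral_measure \<Gamma> \<nu>" and w: "w \<in> space torus" "w' \<in> space torus" "torus_tr w = torus_tr w'"
  shows "measure \<nu> {w'} = measure \<nu> {w}"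
proof -
  note s1 = spectral_weyl_singleton(1)[OF sm] and s2 = spectral_weyl_singleton(2)[OF sm]
  note p = w(1) weyl_space(2)[OF w(1)] weyl_space(2)[OF weyl_space(2)[OF w(1)]]
  show ?thesis using weyl_orbit[OF w] s1[OF p(1)] s1[OF p(2)] s1[OF p(3)] s2[OF p(1)] s2[OF p(2)] by auto
qed

lemma finite_torus_fibre: "finite {w \<in> space torus. torus_tr w = z}"
proof (cases "\<exists>w \<in> space torus. torus_tr w = z")
  case True
  then obtain w where w: "w \<in> space torus" "torus_tr w = z" by blast
  have "{w \<in> space torus. torus_tr w = z} \<subseteq> {w, weyl1 w, weyl2 w, weyl1 (weyl2 w), weyl2 (weyl2 w), weyl1 (weyl2 (weyl2 w))}"
    using weyl_orbit[OF w(1)] w(2) by blast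
  then show ?thesis by (rule finite_subset) simp
qed (auto intro: finite_subset[of _ "{}"])

theorem spectral_measure_unique:
  assumes sm: "is_spectral_measure \<Gamma> \<mu>" "is_spectral_measure \<Gamma> \<nu>"
    and F: "finite F" and ae: "AE w in \<mu>. torus_tr w \<in> F"
  shows "\<nu> = \<mu>"
proof -
  note M = is_spectral_measureD[OF sm(1)] and N = is_spectral_measureD[OF sm(2)]
  interpret M: finite_measure \<mu> by (rule M(1))
  interpret N: finite_measure \<nu> by (rule N(1))
  \<comment> \<open>The integrand vanishes almost everywhere for \<mu>. The value is a combination
    of moments, so it is 0 for \<nu> as well.\<close>
  have "(\<integral>w. poly (fibre_poly F) (torus_tr w) * cnj (poly (fibre_poly F) (torus_tr w)) \<partial>\<mu>) = (\<integral>w. 0 \<partial>\<mu>)"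
  proof (rule integral_cong_AE)
    have "integrable \<mu> (\<lambda>w. poly (fibre_poly F) (torus_tr w) * cnj (poly (fibre_poly F) (torus_tr w)))"
      unfolding poly_mult_cnj by (simp add: integrable_torus_tr_moment[OF M(1,2)])
    then show "(\<lambda>w. poly (fibre_poly F) (torus_tr w) * cnj (poly (fibre_poly F) (torus_tr w))) \<in> borel_measurable \<mu>"
      by (rule borel_measurable_integrable)
    show "AE w in \<mu>. poly (fibre_poly F) (torus_tr w) * cnj (poly (fibre_poly F) (torus_tr w)) = 0"
      using ae by eventually_elim (simp add: poly_fibre_poly[OF F])
  qed simp
  then have ae': "AE w in \<nu>. torus_tr w \<in> F"
    unfolding integral_poly_torus_tr[OF sm(1)] by (intro spectral_AE_fibres[OF F sm(2)]) simp
  let ?X = "\<lambda>z. {w \<in> space torus. torus_tr w = z}"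
  define X where "X = (\<Union>z\<in>F. ?X z)"
  have finX: "finite X" unfolding X_def using F finite_torus_fibre by blast
  have fibre: "measure \<rho> (?X (torus_tr w)) = card (?X (torus_tr w)) * measure \<rho> {w}"
    if s: "is_spectral_measure \<Gamma> \<rho>" and w: "w \<in> space torus" for \<rho> w
  proof -
    note D = is_spectral_measureD[OF s]
    interpret finite_measure \<rho> by (rule D(1))
    have "measure \<rho> (?X (torus_tr w)) = (\<Sum>v\<in>?X (torus_tr w). measure \<rho> {v})"
      using finite_torus_fibre by (intro measure_eq_sum_singleton) (auto simp: D(2) intro: singleton_torus)
    also have "\<dots> = (\<Sum>v\<in>?X (torus_tr w). measure \<rho> {w})"
      by (intro sum.cong refl spectral_same_fibre[OF s w]) auto
    finally show ?thesis by simp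
  qed
  \<comment> \<open>The masses of the fibres agree by interpolation, and each is spread evenly over
    the points of its fibre.\<close>
  have single: "measure \<nu> {w} = measure \<mu> {w}" if w: "w \<in> X" for w
  proof -
    have w': "w \<in> space torus" "torus_tr w \<in> F" using w by (auto simp: X_def)
    have "complex_of_real (measure \<nu> (?X (torus_tr w))) = complex_of_real (measure \<mu> (?X (torus_tr w)))"
      unfolding spectral_measure_fibre[OF F sm(1) ae w'(2)] spectral_measure_fibre[OF F sm(2) ae' w'(2)] ..
    then have "measure \<nu> (?X (torus_tr w)) = measure \<mu> (?X (torus_tr w))" by simp
    moreover have "card (?X (torus_tr w)) > 0" using finite_torus_fibre w' by (subst card_gt_0_iff) blast
    ultimately show ?thesis using fibre[OF sm(1) w'(1)] fibre[OF sm(2) w'(1)] by simp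
  qed
  have meas: "measure \<rho> A = (\<Sum>w\<in>X \<inter> A. measure \<rho> {w})"
    if s: "is_spectral_measure \<Gamma> \<rho>" and a: "AE w in \<rho>. torus_tr w \<in> F" and A: "A \<in> sets torus" for \<rho> A
  proof -
    note D = is_spectral_measureD[OF s]
    interpret finite_measure \<rho> by (rule D(1))
    have XA: "X \<inter> A \<in> sets torus"
      using finX by (intro sets.countable[OF singleton_torus]) (auto simp: X_def countable_finite)
    have "measure \<rho> A = measure \<rho> (X \<inter> A)"
    proof (rule measure_eq_AE)
      show "AE w in \<rho>. w \<in> A \<longleftrightarrow> w \<in> X \<inter> A"
        using a AE_space by eventually_elim (auto simp: X_def D(3))
    qed (use A XA in \<open>simp_all add: D(2)\<close>)
    also have "\<dots> = (\<Sum>w\<in>X \<inter> A. measure \<rho> {w})"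
      using finX by (intro measure_eq_sum_singleton) (auto simp: D(2) X_def intro!: singleton_torus)
    finally show ?thesis .
  qed
  show ?thesis
  proof (rule measure_eqI)
    show "sets \<nu> = sets \<mu>" by (simp add: M(2) N(2))
    fix A assume "A \<in> sets \<nu>"
    then have A: "A \<in> sets torus" by (simp add: N(2))
    have "measure \<nu> A = measure \<mu> A"
      unfolding meas[OF sm(1) ae A] meas[OF sm(2) ae' A] using single by (intro sum.cong) auto
    then show "emeasure \<nu> A = emeasure \<mu> A"
      by (simp add: M.emeasure_eq_measure N.emeasure_eq_measure)
  qed
qed

section \<open>Comparison with the formula\<close>

text \<open>36 is the least common multiple of 18 and 12, the orders of the roots of unity in
  \<open>D_set 6\<close> and \<open>D_set 4\<close>; the orders 9, 6 and 3 in the other terms divide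
  it.\<close>

definition unit36 :: "int \<Rightarrow> complex" where
  "unit36 k = cis (pi * k / 18)"

lemma unit36_add: "unit36 (a + b) = unit36 a * unit36 b"
  by (simp add: unit36_def cis_mult distrib_left add_divide_distrib)

lemma unit36_norm [simp]: "norm (unit36 a) = 1"
  by (simp add: unit36_def)

lemma unit36_uminus: "unit36 (- a) = inverse (unit36 a)"
  by (simp add: unit36_def cis_inverse)

lemma unit36_period: "unit36 (36 * k) = 1"
proof -
  have "unit36 (36 * k) = cis (2 * pi * of_int k)" by (simp add: unit36_def mult_ac)
  then show ?thesis by (simp add: cis_multiple_2pi)
qed

lemma unit36_mod: "unit36 (a mod 36) = unit36 a"
proof -
  have "unit36 a = unit36 (36 * (a div 36) + a mod 36)" by simp
  then show ?thesis unfolding unit36_add by (simp add: unit36_period)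
qed

lemma unit36_inj: "unit36 a = unit36 b \<Longrightarrow> a mod 36 = b mod 36"
proof -
  assume "unit36 a = unit36 b"
  then have "unit36 (a + - b) = 1" by (simp only: unit36_add unit36_uminus) (metis norm_one norm_zero right_inverse unit36_norm zero_neq_one)
  then have "cos (pi * (a - b) / 18) = 1" by (simp add: unit36_def complex_eq_iff)
  then obtain n :: int where "pi * real_of_int (a - b) / 18 = real_of_int n * 2 * pi" using cos_one_2pi_int by blast
  then have "real_of_int (a - b) = real_of_int (36 * n)" by simp
  then have "a - b = 36 * n" by (simp only: of_int_eq_iff)
  then show ?thesis by (simp add: mod_eq_dvd_iff)
qed

lemma unit36_18: "unit36 18 = -1"
  by (simp add: unit36_def)

definition pt :: "int \<times> int \<Rightarrow> complex \<times> complex" where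
  "pt q = (unit36 (fst q), unit36 (snd q))"

lemma pt_in_torus [simp]: "pt q \<in> space torus"
  by (simp add: pt_def torus_mem)

lemma weyl_pt: "weyl1 (pt (a, b)) = pt (- b, - a)" "weyl2 (pt (a, b)) = pt (- b, a - b)"
  by (simp_all add: pt_def weyl1_def weyl2_def unit36_uminus unit36_add diff_conv_add_uminus del: add_uminus_conv_diff)

lemma pt_mod: "pt (a mod 36, b mod 36) = pt (a, b)"
  by (simp add: pt_def unit36_mod)

lemma torus_tr_pt: "torus_tr (pt (a, b)) = unit36 a + unit36 (- b) + unit36 (b - a)"
  by (simp add: torus_tr_def pt_def unit36_uminus unit36_add diff_conv_add_uminus mult.commute del: add_uminus_conv_diff)

definition steps :: "int \<Rightarrow> int list" where
  "steps s = map (\<lambda>k. s * k) [0..36 div s - 1]"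

definition square_grid :: "int \<Rightarrow> (int \<times> int) list" where
  "square_grid s = List.product (steps s) (steps s)"

text \<open>Exponents of the points of \<open>D_set N\<close> for \<open>N * s = 12\<close>: a 3N-th
  root of unity has exponent \<open>s * q\<close>, and the condition that 3 divides
  \<open>q1 + q2\<close> becomes divisibility of \<open>a + b\<close> by
  \<open>3 * s\<close>.\<close>

definition tri_grid :: "int \<Rightarrow> (int \<times> int) list" where
  "tri_grid s = filter (\<lambda>(a, b). (a + b) mod (3 * s) = 0) (square_grid s)"

lemma distinct_steps: "s > 0 \<Longrightarrow> distinct (steps s)"
  by (auto simp: steps_def distinct_map inj_on_def)

lemma distinct_grid: "s > 0 \<Longrightarrow> distinct (square_grid s)" "s > 0 \<Longrightarrow> distinct (tri_grid s)"
  by (simp_all add: square_grid_def tri_grid_def distinct_product distinct_steps)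

lemma set_steps: "s > 0 \<Longrightarrow> n * s = 36 \<Longrightarrow> set (steps s) = (\<lambda>k. s * k) ` {0..<n}"
proof -
  assume "s > 0" "n * s = 36"
  then have "36 div s = n" by (metis less_irrefl nonzero_mult_div_cancel_right)
  then show ?thesis by (auto simp: steps_def)
qed

lemma steps_range: "s > 0 \<Longrightarrow> n * s = 36 \<Longrightarrow> a \<in> set (steps s) \<Longrightarrow> 0 \<le> a \<and> a < 36"
proof -
  assume a: "s > 0" "n * s = 36" "a \<in> set (steps s)"
  then obtain k where k: "a = s * k" "0 \<le> k" "k < n" by (auto simp: set_steps)
  have "s * k < s * n" using a(1) k by simp
  then show ?thesis using a k by (simp add: mult.commute)
qed

lemma inj_pt_grid:
  assumes "s > 0" "n * s = 36"
  shows "inj_on pt (set (square_grid s))" "inj_on pt (set (tri_grid s))"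
proof -
  have r: "a mod 36 = a" if "a \<in> set (steps s)" for a
    using steps_range[OF assms that] by simp
  show "inj_on pt (set (square_grid s))"
  proof (rule inj_onI)
    fix x y assume "x \<in> set (square_grid s)" "y \<in> set (square_grid s)" "pt x = pt y"
    then show "x = y" using unit36_inj[of "fst x" "fst y"] unit36_inj[of "snd x" "snd y"] r
      by (auto simp: square_grid_def pt_def prod_eq_iff)
  qed
  then show "inj_on pt (set (tri_grid s))" by (rule inj_on_subset) (auto simp: tri_grid_def)
qed

lemma D_set_eq:
  assumes N: "N * s = 12"
  shows "D_set N = pt ` set (tri_grid (int s))"
proof -
  have pos: "N > 0" "s > 0" using N by (auto intro: gr0I)
  have n: "int (3 * N) * int s = 36" using arg_cong[OF N, of int] by simp
  have u: "exp (2 * pi * \<i> * of_nat q / (3 * of_nat N)) = unit36 (int s * int q)" for q :: nat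
  proof -
    have "real s * real N = 12" using N by (metis mult.commute of_nat_mult of_nat_numeral)
    then have e: "2 * pi * q / (3 * N) = pi * (int s * int q) / 18" using pos by (simp add: field_simps)
    have "exp (2 * pi * \<i> * of_nat q / (3 * of_nat N)) = cis (2 * pi * q / (3 * N))"
      unfolding cis_conv_exp by (rule arg_cong[of _ _ exp]) simp
    then show ?thesis unfolding e unit36_def by simp
  qed
  have m: "(q1 + q2) mod 3 = 0 \<longleftrightarrow> (int s * int q1 + int s * int q2) mod (3 * int s) = 0" for q1 q2 :: nat
  proof -
    have "(int s * int q1 + int s * int q2) mod (3 * int s) = int s * (int (q1 + q2) mod 3)"
      unfolding mult.commute[of 3] mult_mod_right by (simp only: of_nat_add distrib_left)
    moreover have "(q1 + q2) mod 3 = 0 \<longleftrightarrow> int (q1 + q2) mod 3 = 0" by presburger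
    ultimately show ?thesis using pos by simp
  qed
  have st: "set (steps (int s)) = (\<lambda>q. int s * int q) ` {0..<3 * N}"
    using set_steps[of "int s", OF _ n] pos image_int_atLeastLessThan[of 0 "3 * N"] by (simp add: image_image[symmetric])
  show ?thesis
  proof (intro equalityI subsetI)
    fix w assume "w \<in> D_set N"
    then obtain q1 q2 where q: "w = (exp (2 * pi * \<i> * of_nat q1 / (3 * of_nat N)), exp (2 * pi * \<i> * of_nat q2 / (3 * of_nat N)))"
      "q1 < 3 * N" "q2 < 3 * N" "(q1 + q2) mod 3 = 0" unfolding D_set_def by auto
    have "int s * int q1 \<in> set (steps (int s))" "int s * int q2 \<in> set (steps (int s))"
      unfolding st by (rule image_eqI[of _ _ q1], use q in simp_all) (rule image_eqI[of _ _ q2], use q in simp_all)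
    then have "(int s * int q1, int s * int q2) \<in> set (tri_grid (int s))"
      unfolding tri_grid_def square_grid_def using q(4) m[of q1 q2] by simp
    then show "w \<in> pt ` set (tri_grid (int s))"
      by (rule rev_image_eqI) (simp only: q u pt_def fst_conv snd_conv)
  next
    fix w assume "w \<in> pt ` set (tri_grid (int s))"
    then obtain a b where "w = pt (a, b)" and t: "(a, b) \<in> set (tri_grid (int s))" by auto
    then have "a \<in> set (steps (int s))" "b \<in> set (steps (int s))" by (auto simp: tri_grid_def square_grid_def)
    then obtain q1 q2 where ab: "a = int s * int q1" "b = int s * int q2" "q1 < 3 * N" "q2 < 3 * N"
      unfolding st by (force simp del: mult_cancel_left)
    then have "(q1 + q2) mod 3 = 0" using t m by (simp add: tri_grid_def)
    moreover have "w = (exp (2 * pi * \<i> * of_nat q1 / (3 * of_nat N)), exp (2 * pi * \<i> * of_nat q2 / (3 * of_nat N)))"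
      unfolding \<open>w = pt (a, b)\<close> ab u pt_def by simp
    ultimately show "w \<in> D_set N" unfolding D_set_def using ab(3,4) by (intro CollectI exI[of _ q1] exI[of _ q2] conjI) simp_all
  qed
qed

lemma roots_eq:
  assumes n: "n * s = 36"
  shows "{z. z ^ n = 1} = unit36 ` set (steps (int s))"
proof -
  have pos: "n > 0" "s > 0" using n by (auto intro: gr0I)
  have n': "int n * int s = 36" using n by (metis of_nat_mult of_nat_numeral)
  have u: "cis (2 * pi * real k / real n) = unit36 (int s * int k)" for k
  proof -
    have "real s * real n = 36" using n by (metis mult.commute of_nat_mult of_nat_numeral)
    then have e: "2 * pi * k / n = pi * (int s * int k) / 18" using pos by (simp add: field_simps)
    show ?thesis unfolding e unit36_def by simp
  qed
  have "{z. z ^ n = 1} = (\<lambda>k. cis (2 * pi * real k / real n)) ` {..<n}"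
    using Complex.bij_betw_roots_unity[OF pos(1)] by (simp add: bij_betw_def)
  also have "\<dots> = unit36 ` (\<lambda>k. int s * int k) ` {0..<n}"
    by (simp only: u image_image atLeast0LessThan)
  also have "(\<lambda>k. int s * int k) ` {0..<n} = set (steps (int s))"
    using set_steps[of "int s", OF _ n'] pos image_int_atLeastLessThan[of 0 n] by (simp add: image_image[symmetric])
  finally show ?thesis .
qed

section \<open>Values of J on the grids\<close>

lemma J_torus:
  assumes w: "w \<in> space torus"
  shows "J w = 4 * pi\<^sup>2 * (Im (fst w * snd w) - Im (fst w * fst w * cnj (snd w)) - Im (snd w * snd w * cnj (fst w)))"
proof -
  have n: "norm (fst w) = 1" "norm (snd w) = 1" using w by (auto simp: torus_mem)
  then have nz: "fst w \<noteq> 0" "snd w \<noteq> 0" by auto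
  define s t where "s = Arg (fst w)" "t = Arg (snd w)"
  have c: "fst w = cis s" "snd w = cis t"
    using cis_Arg[OF nz(1)] cis_Arg[OF nz(2)] n by (simp_all add: s_t_def sgn_div_norm)
  have "J w = 4 * pi\<^sup>2 * (sin (s + t) - sin (2 * s - t) - sin (2 * t - s))"
    by (simp add: J_def J_angle_def case_prod_beta' s_t_def[symmetric] distrib_left diff_divide_distrib right_diff_distrib)
  then show ?thesis by (simp only: c cis_cnj cis_mult cis.sel mult_2 diff_conv_add_uminus)
qed

text \<open>The polynomial expression in the coordinates and their conjugates bypasses the
  discontinuity of \<open>Arg\<close>.\<close>

lemma J_measurable [measurable]: "J \<in> borel_measurable torus"
proof -
  have c: "(\<lambda>w. cnj (fst w)) \<in> borel_measurable torus" "(\<lambda>w. cnj (snd w)) \<in> borel_measurable torus"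
    by (intro measurable_compose[OF measurable_fst_torus] measurable_compose[OF measurable_snd_torus]
        borel_measurable_continuous_onI continuous_intros)+
  note c [measurable]
  have "(\<lambda>w. 4 * pi\<^sup>2 * (Im (fst w * snd w) - Im (fst w * fst w * cnj (snd w)) - Im (snd w * snd w * cnj (fst w)))) \<in> borel_measurable torus"
    by measurable
  then show ?thesis by (rule measurable_cong[THEN iffD2, rotated]) (rule J_torus)
qed

text \<open>The sine of \<open>k\<close> times 60 degrees in units of half the square root of 3;
  \<open>sin4\<close> is the sine of \<open>k\<close> times 90 degrees.\<close>

definition sin6 :: "int \<Rightarrow> int" where
  "sin6 k = (let m = k mod 6 in if m = 1 \<or> m = 2 then 1 else if m = 4 \<or> m = 5 then -1 else 0)"

definition sin4 :: "int \<Rightarrow> int" where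
  "sin4 k = (let m = k mod 4 in if m = 1 then 1 else if m = 3 then -1 else 0)"

text \<open>\<open>J\<close> in units of 2 \<pi>^2 times the square root of 3, valid where the three
  exponents are divisible by 6; \<open>J4\<close> is \<open>J\<close> in units of 4 \<pi>^2 where
  they are divisible by 9. Squaring yields the factors 12 \<pi>^4 and 16 \<pi>^4.\<close>

definition J6 :: "int \<times> int \<Rightarrow> int" where
  "J6 q = (case q of (a, b) \<Rightarrow> sin6 ((a + b) div 6) - sin6 ((2 * a - b) div 6) - sin6 ((2 * b - a) div 6))"

definition J4 :: "int \<times> int \<Rightarrow> int" where
  "J4 q = (case q of (a, b) \<Rightarrow> sin4 ((a + b) div 9) - sin4 ((2 * a - b) div 9) - sin4 ((2 * b - a) div 9))"

lemma cases_mod_6: "(k::int) mod 6 = 0 \<or> k mod 6 = 1 \<or> k mod 6 = 2 \<or> k mod 6 = 3 \<or> k mod 6 = 4 \<or> k mod 6 = 5"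
  by presburger

lemma Im_unit36_6: "Im (unit36 (6 * k)) = sqrt 3 / 2 * sin6 k"
proof -
  have "unit36 (6 * k) = unit36 (6 * (k mod 6))"
    using unit36_mod[of "6 * k"] by (simp add: mult_mod_right)
  then have "Im (unit36 (6 * k)) = sin (pi * (k mod 6) / 3)" by (simp add: unit36_def)
  moreover have "sin (pi * 2 / 3) = sqrt 3 / 2" "sin (pi * 4 / 3) = - (sqrt 3 / 2)" "sin (pi * 5 / 3) = - (sqrt 3 / 2)"
    using sin_pi_minus[of "pi / 3"] sin_periodic_pi[of "pi / 3"] sin_2pi_minus[of "pi / 3"]
    by (simp_all add: sin_60 field_simps)
  ultimately show ?thesis using cases_mod_6[of k] by (auto simp: sin6_def sin_60)
qed

lemma Im_unit36_9: "Im (unit36 (9 * k)) = sin4 k"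
proof -
  have "unit36 (9 * k) = unit36 (9 * (k mod 4))"
    using unit36_mod[of "9 * k"] by (simp add: mult_mod_right)
  then have "Im (unit36 (9 * k)) = sin (pi * (k mod 4) / 2)" by (simp add: unit36_def)
  moreover have "k mod 4 = 0 \<or> k mod 4 = 1 \<or> k mod 4 = 2 \<or> k mod 4 = 3" by presburger
  moreover have "sin (pi * 3 / 2) = - 1" using sin_3over2_pi by (simp add: mult.commute)
  ultimately show ?thesis by (auto simp: sin4_def)
qed

lemma J_pt: "J (pt (a, b)) = 4 * pi\<^sup>2 * (Im (unit36 (a + b)) - Im (unit36 (2 * a - b)) - Im (unit36 (2 * b - a)))"
proof -
  have "cnj (unit36 k) = unit36 (- k)" for k by (simp add: unit36_def cis_cnj)
  then show ?thesis
    unfolding J_torus[OF pt_in_torus] by (simp add: pt_def unit36_add[symmetric])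
qed

lemma J_sq6:
  assumes "6 dvd a + b" "6 dvd 2 * a - b" "6 dvd 2 * b - a"
  shows "(J (pt (a, b)))\<^sup>2 = 12 * pi ^ 4 * (J6 (a, b))\<^sup>2"
proof -
  obtain x y z where k: "a + b = 6 * x" "2 * a - b = 6 * y" "2 * b - a = 6 * z"
    using assms by (auto elim!: dvdE)
  have "real_of_int (J6 (a, b)) = sin6 x - sin6 y - sin6 z" by (simp add: J6_def k)
  then have "J (pt (a, b)) = 4 * pi\<^sup>2 * (sqrt 3 / 2 * J6 (a, b))"
    unfolding J_pt k Im_unit36_6 by (simp only: right_diff_distrib of_int_diff)
  then show ?thesis by (simp add: power_mult_distrib power_divide)
qed

lemma J_sq4:
  assumes "9 dvd a + b" "9 dvd 2 * a - b" "9 dvd 2 * b - a"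
  shows "(J (pt (a, b)))\<^sup>2 = 16 * pi ^ 4 * (J4 (a, b))\<^sup>2"
proof -
  obtain x y z where k: "a + b = 9 * x" "2 * a - b = 9 * y" "2 * b - a = 9 * z"
    using assms by (auto elim!: dvdE)
  have "J (pt (a, b)) = 4 * pi\<^sup>2 * J4 (a, b)"
    unfolding J_pt k Im_unit36_9 by (simp add: J4_def k)
  then show ?thesis by (simp add: power_mult_distrib)
qed

text \<open>Since \<open>2 * a - b = 3 * a - (a + b)\<close>, the sines in \<open>J\<close> are
  taken at multiples of \<open>3 * s\<close>: a coarser set of angles than that of the coordinates,
  which is why \<open>J\<close> squared is rational up to \<pi>^4.\<close>

lemma tri_grid_dvd:
  assumes "s > 0" "(a, b) \<in> set (tri_grid s)"
  shows "3 * s dvd a + b" "3 * s dvd 2 * a - b" "3 * s dvd 2 * b - a"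
proof -
  have d: "s dvd a" "s dvd b" and ab: "3 * s dvd a + b"
    using assms by (auto simp: tri_grid_def square_grid_def steps_def)
  have "3 * s dvd 3 * a" "3 * s dvd 3 * b" using d by simp_all
  note this[THEN dvd_diff, OF ab]
  then show "3 * s dvd 2 * a - b" "3 * s dvd 2 * b - a" by simp_all
  show "3 * s dvd a + b" by (rule ab)
qed

lemma square_grid_dvd: "(a, b) \<in> set (square_grid s) \<Longrightarrow> s dvd a \<and> s dvd b"
  by (auto simp: square_grid_def steps_def)

lemma J_sq_tri:
  assumes "q \<in> set (tri_grid s)"
  shows "s = 2 \<or> s = 4 \<Longrightarrow> (J (pt q))\<^sup>2 = 12 * pi ^ 4 * (J6 q)\<^sup>2"
    "s = 3 \<Longrightarrow> (J (pt q))\<^sup>2 = 16 * pi ^ 4 * (J4 q)\<^sup>2"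
proof -
  obtain a b where q: "q = (a, b)" by fastforce
  have d: "3 * s dvd a + b" "3 * s dvd 2 * a - b" "3 * s dvd 2 * b - a" if "s > 0"
    using tri_grid_dvd[OF that] assms q by auto
  show "(J (pt q))\<^sup>2 = 12 * pi ^ 4 * (J6 q)\<^sup>2" if "s = 2 \<or> s = 4"
  proof -
    have "6 dvd 3 * s" "s > 0" using that by auto
    note dvd_trans[OF this(1)] and d[OF this(2)]
    then show ?thesis unfolding q by (intro J_sq6)
  qed
  show "(J (pt q))\<^sup>2 = 16 * pi ^ 4 * (J4 q)\<^sup>2" if "s = 3"
    unfolding q using d that by (intro J_sq4) auto
qed

lemma J_sq_square:
  assumes "q \<in> set (square_grid 6)"
  shows "(J (pt q))\<^sup>2 = 12 * pi ^ 4 * (J6 q)\<^sup>2"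
proof -
  obtain a b where q: "q = (a, b)" by fastforce
  then have "6 dvd a" "6 dvd b" using square_grid_dvd assms by auto
  then show ?thesis unfolding q by (intro J_sq6) auto
qed

lemma measure_weighted_list:
  assumes "inj_on pt (set G)" "distinct G" "f \<in> borel_measurable torus" "\<And>w. 0 \<le> f w" "A \<in> sets torus"
  shows "measure (weighted f (atomic (pt ` set G) (\<lambda>_. 1 / card (pt ` set G)))) A =
    (\<Sum>q\<leftarrow>G. f (pt q) * indicator A (pt q)) / length G"
proof -
  have "measure (weighted f (atomic (pt ` set G) (\<lambda>_. 1 / card (pt ` set G)))) A =
      (\<Sum>w\<in>pt ` set G. 1 / card (pt ` set G) * f w * indicator A w)"
    using assms by (intro measure_weighted_atomic) auto
  also have "\<dots> = (\<Sum>q\<in>set G. 1 / length G * (f (pt q) * indicator A (pt q)))"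
    using assms(1,2) by (simp add: sum.reindex card_image distinct_card mult.assoc del: sum_mult_indicator)
  also have "\<dots> = (\<Sum>q\<leftarrow>G. f (pt q) * indicator A (pt q)) / length G"
    unfolding sum_distrib_left[symmetric] sum_list_distinct_conv_sum_set[OF assms(2)] by simp
  finally show ?thesis .
qed

lemma measure_d_upper:
  assumes "N * s = 12" "f \<in> borel_measurable torus" "\<And>w. 0 \<le> f w" "A \<in> sets torus"
  shows "measure (weighted f (d_upper N)) A =
    (\<Sum>q\<leftarrow>tri_grid (int s). f (pt q) * indicator A (pt q)) / length (tri_grid (int s))"
proof -
  have s: "int s > 0" using assms(1) by (auto intro: gr0I)
  have n: "int (3 * N) * int s = 36" using arg_cong[OF assms(1), of int] by simp
  show ?thesis unfolding d_upper_atomic D_set_eq[OF assms(1)]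
    using inj_pt_grid(2)[OF s n] distinct_grid(2)[OF s] assms(2-4) by (rule measure_weighted_list)
qed

lemma measure_d_roots:
  assumes "nat \<lfloor>2 * k\<rfloor> * s = 36" "f \<in> borel_measurable torus" "\<And>w. 0 \<le> f w" "A \<in> sets torus"
  shows "measure (weighted f (d_roots k \<Otimes>\<^sub>M d_roots k)) A =
    (\<Sum>q\<leftarrow>square_grid (int s). f (pt q) * indicator A (pt q)) / length (square_grid (int s))"
proof -
  have s: "int s > 0" using assms(1) by (auto intro: gr0I)
  have n: "int (nat \<lfloor>2 * k\<rfloor>) * int s = 36" using arg_cong[OF assms(1), of int] by (simp only: of_nat_mult of_nat_numeral)
  have "d_roots k = discrete_circle (unit36 ` set (steps (int s)))"
    unfolding d_roots_def discrete_circle_def roots_eq[OF assms(1)] ..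
  moreover have "unit36 ` set (steps (int s)) \<times> unit36 ` set (steps (int s)) = pt ` set (square_grid (int s))"
    by (auto simp: square_grid_def pt_def image_iff)
  ultimately have "d_roots k \<Otimes>\<^sub>M d_roots k =
      atomic (pt ` set (square_grid (int s))) (\<lambda>_. 1 / card (pt ` set (square_grid (int s))))"
    using pair_discrete_circle[of "unit36 ` set (steps (int s))"] by (simp add: space_circle image_subset_iff)
  then show ?thesis
    using measure_weighted_list[OF inj_pt_grid(1)[OF s n] distinct_grid(1)[OF s] assms(2-4)] by simp
qed

section \<open>The formula as a weighted list of points\<close>

fun insert_weight :: "'c \<times> int \<Rightarrow> ('c \<times> int) list \<Rightarrow> ('c \<times> int) list" where
  "insert_weight p [] = [p]"
| "insert_weight p (r # ps) = (if fst p = fst r then (fst r, snd p + snd r) # ps else r # insert_weight p ps)"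

text \<open>Positive and negative terms meet at the same points, so zeros are dropped again after
  collecting; dropping them beforehand only shortens the list to be merged.\<close>

definition merge_weights :: "('c \<times> int) list \<Rightarrow> ('c \<times> int) list" where
  "merge_weights ps = filter (\<lambda>p. snd p \<noteq> 0) (foldr insert_weight (filter (\<lambda>p. snd p \<noteq> 0) ps) [])"

lemma sum_merge_weights:
  fixes f :: "'c \<Rightarrow> 'd :: comm_ring_1"
  shows "(\<Sum>(x, n)\<leftarrow>merge_weights ps. of_int n * f x) = (\<Sum>(x, n)\<leftarrow>ps. of_int n * f x)"
proof -
  have i: "(\<Sum>(x, n)\<leftarrow>insert_weight p qs. of_int n * f x) = of_int (snd p) * f (fst p) + (\<Sum>(x, n)\<leftarrow>qs. of_int n * f x)" for p qs
    by (induction qs) (auto simp: case_prod_beta algebra_simps)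
  have z: "(\<Sum>(x, n)\<leftarrow>filter (\<lambda>p. snd p \<noteq> 0) qs. of_int n * f x) = (\<Sum>(x, n)\<leftarrow>qs. of_int n * f x)" for qs
    by (induction qs) (auto simp: case_prod_beta)
  have "(\<Sum>(x, n)\<leftarrow>foldr insert_weight qs []. of_int n * f x) = (\<Sum>(x, n)\<leftarrow>qs. of_int n * f x)" for qs
    by (induction qs) (auto simp: i[unfolded case_prod_beta] case_prod_beta)
  then show ?thesis unfolding merge_weights_def z by (simp add: z)
qed

text \<open>The right-hand side of the formula, in units of \<open>1/23328 = 1/(36 \<cdot> 648)\<close>.\<close>

definition signed_weights :: "((int \<times> int) \<times> int) list" where
  "signed_weights =
     map (\<lambda>q. (q, 54 * (J6 q * J6 q))) (tri_grid 2) @ map (\<lambda>q. (q, 81 * (J4 q * J4 q))) (tri_grid 3) @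
     map (\<lambda>q. (q, 144 + 112 * (J6 q * J6 q))) (tri_grid 4) @ map (\<lambda>q. (q, 108)) (tri_grid 6) @
     map (\<lambda>q. (q, - 72)) (tri_grid 12) @ map (\<lambda>q. (q, - 54 * (J6 q * J6 q))) (square_grid 6) @
     map (\<lambda>q. (q, - 144)) (square_grid 12)"

definition point_weights :: "((int \<times> int) \<times> int) list" where
  "point_weights = merge_weights signed_weights"

lemma length_grids:
  "length (tri_grid 2) = 108" "length (tri_grid 3) = 48" "length (tri_grid 4) = 27"
  "length (tri_grid 6) = 12" "length (tri_grid 12) = 3" "length (square_grid 6) = 36" "length (square_grid 12) = 9"
  by code_simp+

lemma weighted_term:
  fixes w :: "'q \<Rightarrow> int" and u :: real
  assumes "M = (\<Sum>q\<leftarrow>G. f q * g q) / l" and w: "\<And>q. q \<in> set G \<Longrightarrow> c * f q / l = of_int (w q) * u"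
  shows "c * M = (\<Sum>(q, n)\<leftarrow>map (\<lambda>q. (q, w q)) G. of_int n * (u * g q))"
  unfolding assms(1) using w
proof (induction G)
  case (Cons q G)
  have "c * (f q * g q / l) = (c * f q / l) * g q" by simp
  also have "\<dots> = of_int (w q) * (u * g q)" using Cons.prems[of q] by (simp only: list.set_intros mult.assoc)
  finally show ?case using Cons by (simp add: add_divide_distrib distrib_left)
qed simp

text \<open>A weight is 23328 times the coefficient times the value of the density, divided by the
  number of points: 12/48/108 of 23328 is 54 for \<open>d_upper 6\<close>, 16/96/48 of it is 81 for
  \<open>d_upper 4\<close>, and 1/6/27 of it is the constant 144 for \<open>d_upper 3\<close>. Terms
  without a density are treated as weighted by 1.\<close>

lemma formula_eq_weights:
  assumes A: "A \<in> sets torus"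
  shows "1 / (48 * pi^4) * measure (weighted (\<lambda>w. (J w)\<^sup>2) (d_upper 6)) A
      + 1 / (96 * pi^4) * measure (weighted (\<lambda>w. (J w)\<^sup>2) (d_upper 4)) A
      + measure (weighted (\<lambda>w. 1 / 6 + 7 / (648 * pi^4) * (J w)\<^sup>2) (d_upper 3)) A
      + 1 / 18 * measure (d_upper 2) A
      - 1 / 108 * measure (d_upper 1) A
      - 1 / (144 * pi^4) * measure (weighted (\<lambda>w. (J w)\<^sup>2) (d_roots 3 \<Otimes>\<^sub>M d_roots 3)) A
      - 1 / 18 * measure (d_roots (3/2) \<Otimes>\<^sub>M d_roots (3/2)) A
    = (\<Sum>(q, n)\<leftarrow>point_weights. of_int n * (1 / 23328 * indicator A (pt q)))"
proof -
  let ?S = "\<lambda>w G. \<Sum>(q, n)\<leftarrow>map (\<lambda>q. (q, w q)) G. of_int n * (1 / 23328 * indicator A (pt q) :: real)"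
  have JJ: "(\<lambda>w. (J w)\<^sup>2) \<in> borel_measurable torus" by measurable
  have J3: "(\<lambda>w. 1 / 6 + 7 / (648 * pi^4) * (J w)\<^sup>2) \<in> borel_measurable torus" by measurable
  have "1 / (48 * pi^4) * measure (weighted (\<lambda>w. (J w)\<^sup>2) (d_upper 6)) A = ?S (\<lambda>q. 54 * (J6 q * J6 q)) (tri_grid 2)"
    by (rule weighted_term[OF measure_d_upper[of 6 2, OF _ JJ _ A, unfolded of_nat_numeral length_grids]])
      (simp_all add: J_sq_tri, simp_all add: power2_eq_square)
  moreover have "1 / (96 * pi^4) * measure (weighted (\<lambda>w. (J w)\<^sup>2) (d_upper 4)) A = ?S (\<lambda>q. 81 * (J4 q * J4 q)) (tri_grid 3)"
    by (rule weighted_term[OF measure_d_upper[of 4 3, OF _ JJ _ A, unfolded of_nat_numeral length_grids]])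
      (simp_all add: J_sq_tri, simp_all add: power2_eq_square)
  moreover have "1 * measure (weighted (\<lambda>w. 1 / 6 + 7 / (648 * pi^4) * (J w)\<^sup>2) (d_upper 3)) A = ?S (\<lambda>q. 144 + 112 * (J6 q * J6 q)) (tri_grid 4)"
    by (rule weighted_term[OF measure_d_upper[of 3 4, OF _ J3 _ A, unfolded of_nat_numeral length_grids]])
      (simp_all add: J_sq_tri field_simps, simp_all add: power2_eq_square)
  moreover have "(1 / 18) * measure (weighted (\<lambda>_. 1) (d_upper 2)) A = ?S (\<lambda>q. 108) (tri_grid 6)"
    by (rule weighted_term[OF measure_d_upper[of 2 6 "\<lambda>_. 1", OF _ _ _ A, unfolded of_nat_numeral length_grids]])
      simp_all
  moreover have "(- 1 / 108) * measure (weighted (\<lambda>_. 1) (d_upper 1)) A = ?S (\<lambda>q. - 72) (tri_grid 12)"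
    by (rule weighted_term[OF measure_d_upper[of 1 12 "\<lambda>_. 1", OF _ _ _ A, unfolded of_nat_numeral length_grids]])
      simp_all
  moreover have "(- 1 / (144 * pi^4)) * measure (weighted (\<lambda>w. (J w)\<^sup>2) (d_roots 3 \<Otimes>\<^sub>M d_roots 3)) A = ?S (\<lambda>q. - 54 * (J6 q * J6 q)) (square_grid 6)"
    by (rule weighted_term[OF measure_d_roots[of 3 6, OF _ JJ _ A, unfolded of_nat_numeral length_grids]])
      (simp_all add: J_sq_square, simp_all add: power2_eq_square)
  moreover have "(- 1 / 18) * measure (weighted (\<lambda>_. 1) (d_roots (3/2) \<Otimes>\<^sub>M d_roots (3/2))) A = ?S (\<lambda>q. - 144) (square_grid 12)"
    by (rule weighted_term[OF measure_d_roots[of "3/2" 12 "\<lambda>_. 1", OF _ _ _ A, unfolded of_nat_numeral length_grids]])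
      simp_all
  ultimately show ?thesis
    unfolding point_weights_def sum_merge_weights weighted_one signed_weights_def map_append sum_list_append
    by simp
qed

section \<open>Trace codes of the points\<close>

definition omega_code :: "int \<Rightarrow> eis" where
  "omega_code k = (if k mod 3 = 0 then (1, 0) else if k mod 3 = 1 then (0, 1) else (-1, -1))"

text \<open>The value of \<open>e\<^sup>\<pi>\<^sup>i\<^sup>m\<^sup>/\<^sup>9\<close> divided by \<open>\<epsilon>\<^sup>2\<^sup>r\<close>, where \<open>r = m mod 3\<close>.\<close>

definition unit_code :: "int \<Rightarrow> eis" where
  "unit_code m = eis_mul (if m mod 2 = 0 then 1 else - 1, 0) (omega_code (m + 2 * (m div 3)))"

text \<open>Exponents of the eigenvalues at a point, up to cancellation of opposite eigenvalues: only the
  even ones are Eisenstein integers times powers of \<open>\<epsilon>\<close>.\<close>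

definition pt_exps :: "int \<times> int \<Rightarrow> int list" where
  "pt_exps q = (case q of (a, b) \<Rightarrow>
     let x = a mod 36; y = (- b) mod 36; z = (b - a) mod 36
     in if (x - y) mod 36 = 18 then [z] else if (y - z) mod 36 = 18 then [x]
       else if (x - z) mod 36 = 18 then [y] else [x, y, z])"

text \<open>The factor \<open>(1, 2)\<close> compensates the division by the square root of -3 in
  \<open>trace_val\<close>; the power of \<epsilon> is read off from the head of the list of
  exponents.\<close>

definition pt_code :: "int \<times> int \<Rightarrow> nat \<times> eis" where
  "pt_code q = (nat (hd (pt_exps q) div 2 mod 3),
     eis_mul (1, 2) (foldr (\<lambda>e. eis_add (unit_code (e div 2))) (pt_exps q) (0, 0)))"

text \<open>Under this condition all remaining eigenvalues are Eisenstein integers times the same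
  power of \<epsilon>, which can be pulled out of their sum.\<close>

definition pt_code_ok :: "int \<times> int \<Rightarrow> bool" where
  "pt_code_ok q \<longleftrightarrow> list_all (\<lambda>e. e mod 2 = 0 \<and> e div 2 mod 3 = hd (pt_exps q) div 2 mod 3) (pt_exps q)"

lemma unit36_of_nat: "unit36 (int n * a) = unit36 a ^ n"
  by (induction n) (simp_all add: unit36_add distrib_right, simp add: unit36_def)

lemma omega_code: "eis_val (omega_code k) = unit36 (12 * k)"
proof -
  have "unit36 (12 * k) = unit36 (12 * (k mod 3))"
    using unit36_mod[of "12 * k"] by (simp add: mult_mod_right)
  moreover have w: "unit36 12 = \<omega>" by (simp add: unit36_def \<omega>_cis)
  moreover have "unit36 24 = \<omega> ^ 2" using unit36_of_nat[of 2 12] w by simp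
  moreover have "k mod 3 = 0 \<or> k mod 3 = 1 \<or> k mod 3 = 2" by presburger
  moreover have "unit36 0 = 1" by (simp add: unit36_def)
  ultimately show ?thesis by (auto simp: omega_code_def eis_val_def \<omega>_sq)
qed

text \<open>With \<open>m = 3 * d + r\<close> the quotient has exponent
  \<open>2 * m - 8 * r = 6 * (d - r)\<close>, a sixth root of unity, hence a sign times a power of
  \<omega>.\<close>

lemma unit_code: "unit36 (2 * m) = \<epsilon> ^ (2 * nat (m mod 3)) * eis_val (unit_code m)"
proof -
  define d r where "d = m div 3" "r = m mod 3"
  have m: "m = 3 * d + r" "0 \<le> r" by (simp_all add: d_r_def)
  have e: "unit36 4 = \<epsilon>" by (simp add: unit36_def \<epsilon>_cis)
  have 1: "\<epsilon> ^ (2 * nat r) = unit36 (8 * r)"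
    using unit36_of_nat[of "2 * nat r" 4] m(2) by (simp add: e)
  have "unit36 (18 * m) = unit36 (18 * (m mod 2))"
    using unit36_mod[of "18 * m"] by (simp add: mult_mod_right)
  moreover have "m mod 2 = 0 \<or> m mod 2 = 1" by presburger
  moreover have "unit36 0 = 1" by (simp add: unit36_def)
  ultimately have 2: "eis_val (if m mod 2 = 0 then 1 else - 1, 0) = unit36 (18 * m)"
    by (auto simp: eis_val_def unit36_18)
  \<comment> \<open>The three summands are the exponents of the power of \<epsilon>, of the sign and
    of the power of \<omega>; their sum is \<open>2 * m\<close> modulo 36.\<close>
  have "8 * r + (18 * m + 12 * (m + 2 * d)) = 36 * (r + 3 * d) + 2 * m" by (simp add: m)
  then have "unit36 (8 * r) * (unit36 (18 * m) * unit36 (12 * (m + 2 * d))) = unit36 (2 * m)"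
    by (simp only: unit36_add[symmetric]) (simp only: unit36_add unit36_period mult_1)
  then show ?thesis unfolding unit_code_def eis_val_mul omega_code 2 d_r_def[symmetric] 1 by simp
qed

lemma unit36_opposite: "(x - y) mod 36 = 18 \<Longrightarrow> unit36 x + unit36 y = 0"
proof -
  assume "(x - y) mod 36 = 18"
  then have "unit36 (x - y) = - 1" using unit36_mod[of "x - y"] by (simp add: unit36_18)
  then have "unit36 ((x - y) + y) = - 1 * unit36 y" by (simp only: unit36_add)
  then show ?thesis by simp
qed

lemma torus_tr_exps: "torus_tr (pt q) = sum_list (map unit36 (pt_exps q))"
proof -
  obtain a b where q: "q = (a, b)" by fastforce
  define x y z where xyz: "x = a mod 36" "y = (- b) mod 36" "z = (b - a) mod 36"
  have t: "torus_tr (pt q) = unit36 x + unit36 y + unit36 z"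
    unfolding q torus_tr_pt xyz unit36_mod ..
  have e: "pt_exps q = (if (x - y) mod 36 = 18 then [z] else if (y - z) mod 36 = 18 then [x]
       else if (x - z) mod 36 = 18 then [y] else [x, y, z])"
    by (simp add: pt_exps_def q Let_def xyz)
  show ?thesis
    using unit36_opposite[of x y] unit36_opposite[of y z] unit36_opposite[of x z]
    unfolding t e by (auto simp: add.assoc)
qed

lemma torus_tr_code:
  assumes "pt_code_ok q"
  shows "torus_tr (pt q) = trace_val (pt_code q)"
proof -
  define r where "r = hd (pt_exps q) div 2 mod 3"
  have "sum_list (map unit36 es) = \<epsilon> ^ (2 * nat r) * eis_val (foldr (\<lambda>e. eis_add (unit_code (e div 2))) es (0, 0))"
    if "\<forall>e\<in>set es. e mod 2 = 0 \<and> e div 2 mod 3 = r" for es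
    using that
  proof (induction es)
    case (Cons e es)
    then have "e = 2 * (e div 2)" by auto
    then have "unit36 e = \<epsilon> ^ (2 * nat r) * eis_val (unit_code (e div 2))"
      using unit_code[of "e div 2"] Cons.prems by simp
    then show ?case using Cons by (simp add: eis_val_add distrib_left)
  qed (simp add: eis_val_def)
  then have "torus_tr (pt q) = \<epsilon> ^ (2 * nat r) * eis_val (foldr (\<lambda>e. eis_add (unit_code (e div 2))) (pt_exps q) (0, 0))"
    using assms by (simp add: torus_tr_exps pt_code_ok_def list_all_iff r_def)
  moreover have "eis_val (1, 2) = \<i> * sqrt 3" by (simp add: eis_val_def sqrt_neg3)
  ultimately show ?thesis
    by (simp add: trace_val_def pt_code_def r_def eis_val_mul)
qed

text \<open>The whole comparison as one finite check: positivity, codable traces, invariance under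
  both Weyl generators, and agreement with the traces of the group. The factor 36 is
  23328/648.\<close>

definition weights_ok :: "((int \<times> int) \<times> int) list \<Rightarrow> bool" where
  "weights_ok ps \<longleftrightarrow> list_all (\<lambda>p. 0 \<le> snd p \<and> pt_code_ok (fst p)) ps \<and>
     weights_match (map (\<lambda>((a, b), n). (((- b) mod 36, (- a) mod 36), n)) ps) ps \<and>
     weights_match (map (\<lambda>((a, b), n). (((- b) mod 36, (a - b) mod 36), n)) ps) ps \<and>
     weights_match (map (\<lambda>(q, n). (pt_code q, n)) ps) (map (\<lambda>(x, n). (x, 36 * n)) trace_tab)"

lemma weights_ok: "weights_ok point_weights"
  by code_simp

section \<open>The spectral measure of the group\<close>

definition point_mass :: "complex \<times> complex \<Rightarrow> real" where
  "point_mass w = (\<Sum>(q, n)\<leftarrow>point_weights. of_int n * (if pt q = w then 1 / 23328 else 0))"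

definition support_pts :: "(complex \<times> complex) set" where
  "support_pts = pt ` fst ` set point_weights"

lemma support_pts: "finite support_pts" "support_pts \<subseteq> space torus"
  by (auto simp: support_pts_def)

lemma sum_point_mass:
  fixes g :: "_ \<Rightarrow> 'd :: real_field"
  shows "(\<Sum>w\<in>support_pts. of_real (point_mass w) * g w) = (\<Sum>(q, n)\<leftarrow>point_weights. of_int n * (1 / 23328 * g (pt q)))"
proof -
  \<comment> \<open>An arbitrary finite \<open>S\<close> containing the points of the list is fixed,
    so that the range of summation does not change during the induction.\<close>
  have "(\<Sum>w\<in>S. of_real (\<Sum>(q, n)\<leftarrow>ps. of_int n * (if pt q = w then 1 / 23328 else 0)) * g w) =
      (\<Sum>(q, n)\<leftarrow>ps. of_int n * (1 / 23328 * g (pt q)))" if "pt ` fst ` set ps \<subseteq> S" "finite S" for S ps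
    using that
  proof (induction ps)
    case (Cons p ps)
    have "(\<Sum>w\<in>S. of_real (of_int (snd p) * (if pt (fst p) = w then 1 / 23328 else 0)) * g w) =
        (\<Sum>w\<in>S. if pt (fst p) = w then of_int (snd p) * (1 / 23328 * g w) else 0)"
      by (intro sum.cong refl) auto
    also have "\<dots> = of_int (snd p) * (1 / 23328 * g (pt (fst p)))"
      using Cons.prems by (subst sum.delta') auto
    finally show ?case using Cons
      by (simp add: case_prod_beta distrib_right sum.distrib del: of_real_mult)
  qed simp
  then show ?thesis unfolding point_mass_def support_pts_def by simp
qed

lemma sum_point_mass_real:
  fixes g :: "_ \<Rightarrow> real"
  shows "(\<Sum>w\<in>support_pts. point_mass w * g w) = (\<Sum>(q, n)\<leftarrow>point_weights. of_int n * (1 / 23328 * g (pt q)))"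
  using sum_point_mass[of g] by (simp only: of_real_eq_id id_apply)

lemma point_weightsD:
  assumes "(q, n) \<in> set point_weights"
  shows "0 \<le> n" "torus_tr (pt q) = trace_val (pt_code q)"
  using weights_ok assms by (auto simp: weights_ok_def list_all_iff intro!: torus_tr_code)

lemma point_mass_nonneg: "0 \<le> point_mass w"
  unfolding point_mass_def by (intro sum_list_nonneg) (auto dest: point_weightsD(1))

definition Sigma_measure :: "(complex \<times> complex) measure" where
  "Sigma_measure = atomic support_pts point_mass"

lemma sets_Sigma_measure: "sets Sigma_measure = sets torus"
  by (simp add: Sigma_measure_def)

lemma measure_Sigma_measure:
  assumes "A \<in> sets torus"
  shows "emeasure Sigma_measure A = ennreal (\<Sum>(q, n)\<leftarrow>point_weights. of_int n * (1 / 23328 * indicator A (pt q)))"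
    "measure Sigma_measure A = (\<Sum>(q, n)\<leftarrow>point_weights. of_int n * (1 / 23328 * indicator A (pt q)))"
  unfolding Sigma_measure_def measure_atomic[OF support_pts point_mass_nonneg assms] sum_point_mass_real by simp_all

lemma integral_Sigma_measure:
  fixes f :: "_ \<Rightarrow> complex"
  assumes "f \<in> borel_measurable torus"
  shows "(\<integral>w. f w \<partial>Sigma_measure) = (\<Sum>(q, n)\<leftarrow>point_weights. of_int n * (1 / 23328 * f (pt q)))"
  unfolding Sigma_measure_def integral_atomic[OF support_pts assms point_mass_nonneg] sum_point_mass ..

text \<open>If \<sigma> describes the map \<open>t\<close> on exponents, invariance of the measure
  becomes equality of two weighted lists of exponents.\<close>

lemma distr_Sigma_measure:
  assumes t: "t \<in> measurable torus torus" and \<sigma>: "\<And>q. pt (\<sigma> q) = t (pt q)"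
    and match: "weights_match (map (\<lambda>(q, n). (\<sigma> q, n)) point_weights) point_weights"
  shows "distr Sigma_measure torus t = Sigma_measure"
proof (rule measure_eqI)
  show se: "sets (distr Sigma_measure torus t) = sets Sigma_measure" by (simp add: sets_Sigma_measure)
  fix A assume "A \<in> sets (distr Sigma_measure torus t)"
  then have A: "A \<in> sets torus" by simp
  have sp: "space Sigma_measure = space torus" by (simp add: Sigma_measure_def)
  have t': "t \<in> measurable Sigma_measure torus" using t measurable_cong_sets[OF sets_Sigma_measure refl] by blast
  have B: "t -` A \<inter> space torus \<in> sets torus" using t A by (rule measurable_sets)
  have i: "indicator (t -` A \<inter> space torus) (pt q) = (indicator A (pt (\<sigma> q)) :: real)" for q
    by (simp add: indicator_def \<sigma>)
  have "(\<Sum>(q, n)\<leftarrow>point_weights. of_int n * (1 / 23328 * indicator (t -` A \<inter> space torus) (pt q))) =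
      (\<Sum>(q, n)\<leftarrow>map (\<lambda>(q, n). (\<sigma> q, n)) point_weights. of_int n * (1 / 23328 * indicator A (pt q) :: real))"
    unfolding map_map by (intro arg_cong[of _ _ sum_list] map_cong refl) (auto simp: i)
  also have "\<dots> = (\<Sum>(q, n)\<leftarrow>point_weights. of_int n * (1 / 23328 * indicator A (pt q)))"
    by (rule weights_match_sum_list[OF match])
  finally show "emeasure (distr Sigma_measure torus t) A = emeasure Sigma_measure A"
    unfolding emeasure_distr[OF t' A] sp measure_Sigma_measure(1)[OF A] measure_Sigma_measure(1)[OF B] by simp
qed

lemma weyl_invariant_Sigma_measure:
  "distr Sigma_measure torus weyl1 = Sigma_measure" "distr Sigma_measure torus weyl2 = Sigma_measure"
proof -
  let ?s1 = "\<lambda>q :: int \<times> int. ((- snd q) mod 36, (- fst q) mod 36)"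
  let ?s2 = "\<lambda>q :: int \<times> int. ((- snd q) mod 36, (fst q - snd q) mod 36)"
  have m: "(\<lambda>((a, b), n). (((- b) mod 36, (- a) mod 36), n)) = (\<lambda>(q, n :: int). (?s1 q, n))"
    "(\<lambda>((a, b), n). (((- b) mod 36, (a - b) mod 36), n)) = (\<lambda>(q, n :: int). (?s2 q, n))"
    by (auto simp: fun_eq_iff)
  have w: "weights_match (map (\<lambda>(q, n). (?s1 q, n)) point_weights) point_weights"
    "weights_match (map (\<lambda>(q, n). (?s2 q, n)) point_weights) point_weights"
    using weights_ok unfolding weights_ok_def m by blast+
  show "distr Sigma_measure torus weyl1 = Sigma_measure"
    by (rule distr_Sigma_measure[OF weyl_measurable(1) _ w(1)]) (simp add: pt_mod weyl_pt[symmetric])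
  show "distr Sigma_measure torus weyl2 = Sigma_measure"
    by (rule distr_Sigma_measure[OF weyl_measurable(2) _ w(2)]) (simp add: pt_mod weyl_pt[symmetric])
qed

lemma mckay_moment_Sigma:
  "mckay_moment Sigma_216x3 m n = (\<Sum>g\<in>Sigma_216x3. mtrace g ^ m * cnj (mtrace g) ^ n) / 648"
proof -
  have sub: "Sigma_216x3 \<subseteq> carrier SU3" by (rule subgroup.subset[OF subgroup_Sigma])
  have gr: "group (SU3_sub Sigma_216x3)" by (rule subgroup.subgroup_is_group[OF subgroup_Sigma group_SU3])
  interpret finite_grp "SU3_sub Sigma_216x3"
    by (intro finite_grp.intro gr finite_grp_axioms.intro) (simp add: finite_Sigma)
  have iv: "inv\<^bsub>SU3_sub Sigma_216x3\<^esub> g = mat_adjoint g" if "g \<in> Sigma_216x3" for g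
    using SU3.m_inv_consistent[OF subgroup_Sigma that] SU3_inv sub that by auto
  have tr: "mtrace (inv\<^bsub>SU3_sub Sigma_216x3\<^esub> g) = cnj (mtrace g)" if "g \<in> Sigma_216x3" for g
    unfolding iv[OF that] using sub that by (intro mtrace_adjoint) (auto simp: SU3_carrier_iff)
  \<comment> \<open>Replacing each element by its inverse exchanges the two exponents; the trace of
    an inverse is a conjugate because inverses are adjoints.\<close>
  have "(\<Sum>g\<in>Sigma_216x3. mtrace g ^ n * mtrace (inv\<^bsub>SU3_sub Sigma_216x3\<^esub> g) ^ m) =
      (\<Sum>g\<in>Sigma_216x3. mtrace (inv\<^bsub>SU3_sub Sigma_216x3\<^esub> g) ^ n * mtrace g ^ m)"
    using inv_closed inv_inv
    by (intro sum.reindex_bij_witness[of _ "m_inv (SU3_sub Sigma_216x3)" "m_inv (SU3_sub Sigma_216x3)"]) auto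
  also have "\<dots> = (\<Sum>g\<in>Sigma_216x3. mtrace g ^ m * cnj (mtrace g) ^ n)"
    by (intro sum.cong refl) (simp add: tr mult.commute)
  finally show ?thesis
    unfolding mckay_moment_eq[OF finite_grp_axioms sub] card_Sigma by simp
qed

lemma moment_Sigma_measure: "(\<integral>w. R m n w \<partial>Sigma_measure) = mckay_moment Sigma_216x3 m n"
proof -
  define h where "h t = t ^ m * cnj t ^ n" for t
  have "(\<integral>w. R m n w \<partial>Sigma_measure) = (\<integral>w. h (torus_tr w) \<partial>Sigma_measure)"
    by (intro Bochner_Integration.integral_cong refl) (simp add: h_def Sigma_measure_def R_eq)
  also have "\<dots> = (\<Sum>(q, n)\<leftarrow>point_weights. of_int n * (1 / 23328 * h (torus_tr (pt q))))"
    unfolding h_def by (rule integral_Sigma_measure) measurable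
  also have "\<dots> = (\<Sum>(x, n)\<leftarrow>map (\<lambda>(q, n). (pt_code q, n)) point_weights. of_int n * (1 / 23328 * h (trace_val x)))"
    unfolding map_map by (intro arg_cong[of _ _ sum_list] map_cong refl) (auto simp: point_weightsD(2))
  also have "\<dots> = (\<Sum>(x, n)\<leftarrow>map (\<lambda>(x, n). (x, 36 * n)) trace_tab. of_int n * (1 / 23328 * h (trace_val x)))"
    using weights_ok by (intro weights_match_sum_list) (simp add: weights_ok_def)
  \<comment> \<open>36/23328 = 1/648, so the average over the group appears.\<close>
  also have "\<dots> = (\<Sum>(x, n)\<leftarrow>trace_tab. of_int n * h (trace_val x)) / 648"
  proof -
    have "(\<Sum>(x, n)\<leftarrow>map (\<lambda>(x, n). (x, 36 * n)) ps. of_int n * (1 / 23328 * h (trace_val x))) =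
        (\<Sum>(x, n)\<leftarrow>ps. of_int n * h (trace_val x)) / 648" for ps
      by (induction ps) (auto simp: add_divide_distrib)
    then show ?thesis .
  qed
  finally show ?thesis
    unfolding mckay_moment_Sigma using sum_trace_Sigma[of h] by (simp add: h_def)
qed

lemma spectral_Sigma_measure: "is_spectral_measure Sigma_216x3 Sigma_measure"
proof -
  have "emeasure Sigma_measure (space Sigma_measure) \<noteq> \<infinity>"
    using measure_Sigma_measure(1)[OF sets.top] by (simp add: Sigma_measure_def)
  then show ?thesis
    unfolding is_spectral_measure_def
    by (intro conjI allI finite_measureI weyl_invariant_Sigma_measure moment_Sigma_measure sets_Sigma_measure)
qed

lemma AE_Sigma_measure: "AE w in Sigma_measure. w \<in> support_pts"
proof (rule AE_I')
  have S: "support_pts \<in> sets torus"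
    using sets.finite_UN[OF support_pts(1), of "\<lambda>w. {w}" torus] support_pts(2) by (auto intro: singleton_torus)
  then show "space torus - support_pts \<in> null_sets Sigma_measure"
    unfolding null_sets_def Sigma_measure_def
    using measure_atomic(1)[OF support_pts point_mass_nonneg, of "space torus - support_pts"]
    by (auto simp: indicator_def)
qed (auto simp: Sigma_measure_def)

theorem theorem3p7:
  shows "subgroup Sigma_216x3 SU3 \<and> card Sigma_216x3 = 648 \<and>
    (\<exists>!\<mu>. is_spectral_measure Sigma_216x3 \<mu>) \<and>
    (\<forall>\<mu>. is_spectral_measure Sigma_216x3 \<mu> \<longrightarrow> (\<forall>A\<in>sets torus. measure \<mu> A =
        1 / (48 * pi^4) * measure (weighted (\<lambda>w. (J w)\<^sup>2) (d_upper 6)) A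
      + 1 / (96 * pi^4) * measure (weighted (\<lambda>w. (J w)\<^sup>2) (d_upper 4)) A
      + measure (weighted (\<lambda>w. 1 / 6 + 7 / (648 * pi^4) * (J w)\<^sup>2) (d_upper 3)) A
      + 1 / 18 * measure (d_upper 2) A
      - 1 / 108 * measure (d_upper 1) A
      - 1 / (144 * pi^4) * measure (weighted (\<lambda>w. (J w)\<^sup>2) (d_roots 3 \<Otimes>\<^sub>M d_roots 3)) A
      - 1 / 18 * measure (d_roots (3/2) \<Otimes>\<^sub>M d_roots (3/2)) A))"
proof -
  \<comment> \<open>The support is finite, so the trace takes finitely many values on it, as the
    uniqueness theorem demands.\<close>
  have "AE w in Sigma_measure. torus_tr w \<in> torus_tr ` support_pts"
    using AE_Sigma_measure by eventually_elim (rule imageI)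
  then have uniq: "\<mu> = Sigma_measure" if "is_spectral_measure Sigma_216x3 \<mu>" for \<mu>
    using spectral_measure_unique[OF spectral_Sigma_measure that] support_pts(1) by blast
  show ?thesis
    using subgroup_Sigma card_Sigma spectral_Sigma_measure uniq
      measure_Sigma_measure(2) formula_eq_weights by auto
qed

end
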